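(* Let $s\in[0,1]$ and $p\in[1,+\infty)$ be such that $sp<N$ and $s\neq p$. Let $\widetilde s,\widetilde p$ satisfy $$0\le\widetilde s\le s\qquad\text{and}\qquad p\le\widetilde p\le\frac{Np}{N-(s-\widetilde s)p}.$$ Then there exists a positive constant $C=C(N,s,p,\widetilde s,\widetilde p)$ such that, for any $u\in W^{s,p}(\mathbb{R}^N)$, $$\|u\|_{W^{\widetilde s,\widetilde p}(\mathbb{R}^N)}\le C\,\|u\|_{W^{s,p}(\mathbb{R}^N)},$$ namely, the space $W^{s,p}(\mathbb{R}^N)$ is continuously embedded in $W^{\widetilde s,\widetilde p}(\mathbb{R}^N)$. Moreover, the curve $\gamma:[0,1]\to\mathbb{R}^2$ defined as $$\gamma(\theta):=(s_\theta,p_\theta)=\left(\theta\widetilde s+(1-\theta)s,\ \frac{p\,\widetilde p}{\widetilde p+\theta(p-\widetilde p)}\right)$$ is such that, if $0\le\theta_1\le\theta_2\le1$, then the space $W^{s_{\theta_1},p_{\theta_1}}(\mathbb{R}^N)$ is continuously embedded in $W^{s_{\theta_2},p_{\theta_2}}(\mathbb{R}^N)$.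
   Context: $N\ge1$ is an integer and functions are real-valued and measurable. Let $\Omega$ be either $\mathbb{R}^N$ or an open bounded subset of $\mathbb{R}^N$ with Lipschitz boundary. For $s\in[0,1]$ and $p\in[1,+\infty)$ define $[u]_{W^{0,p}(\Omega)}:=\|u\|_{L^p(\Omega)}$, $[u]_{W^{1,p}(\Omega)}:=\|\nabla u\|_{L^p(\Omega)}$ (weak gradient) and, for $s\in(0,1)$, $$[u]_{W^{s,p}(\Omega)}:=\left(c_{N,s,p}\iint_{\Omega\times\Omega}\frac{|u(x)-u(y)|^p}{|x-y|^{N+sp}}\,dx\,dy\right)^{1/p},\qquad c_{N,s,p}:=\frac{s\,2^{2s-1}\,\Gamma\left(\frac{ps+p+N-2}{2}\right)}{\pi^{N/2}\,\Gamma(1-s)}.$$ Set $W^{s,p}(\Omega):=\{u\in L^p(\Omega):[u]_{W^{s,p}(\Omega)}<+\infty\}$, with norm $\|u\|_{W^{0,p}(\Omega)}:=\|u\|_{L^p(\Omega)}$ if $s=0$ and $\|u\|_{W^{s,p}(\Omega)}:=\big([u]^p_{W^{s,p}(\Omega)}+\|u\|^p_{L^p(\Omega)}\big)^{1/p}$ if $s\in(0,1]$. *)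

theory Defs
  imports "HOL-Analysis.Analysis"
begin

text \<open>
  Functions are total maps on the ambient Euclidean space; on a domain \<open>\<Omega>\<close> only their
  values on \<open>\<Omega>\<close> matter. Norms and seminorms take values in \<open>[0,\<infinity>]\<close>.
\<close>

text \<open>Powers with a positive exponent \<open>a\<close>; the value at \<open>\<infinity>\<close> is only meaningful for \<open>a > 0\<close>.\<close>

definition ennreal_powr :: "ennreal \<Rightarrow> real \<Rightarrow> ennreal" where
  "ennreal_powr x a = (if x = \<infinity> then \<infinity> else ennreal (enn2real x powr a))"

definition Lp_norm :: "'a::euclidean_space set \<Rightarrow> real \<Rightarrow> ('a \<Rightarrow> 'b::real_normed_vector) \<Rightarrow> ennreal" where
  "Lp_norm \<Omega> p f =
     ennreal_powr (\<integral>\<^sup>+x. ennreal (norm (f x) powr p) \<partial>lebesgue_on \<Omega>) (1 / p)"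

primrec C_k :: "nat \<Rightarrow> ('a::euclidean_space \<Rightarrow> real) \<Rightarrow> bool" where
  "C_k 0 f \<longleftrightarrow> continuous_on UNIV f"
| "C_k (Suc k) f \<longleftrightarrow>
     f differentiable_on UNIV \<and> (\<forall>i\<in>Basis. C_k k (\<lambda>x. frechet_derivative f (at x) i))"

definition test_function :: "'a::euclidean_space set \<Rightarrow> ('a \<Rightarrow> real) \<Rightarrow> bool" where
  "test_function \<Omega> \<phi> \<longleftrightarrow>
     (\<forall>k. C_k k \<phi>) \<and> compact (closure {x. \<phi> x \<noteq> 0}) \<and> closure {x. \<phi> x \<noteq> 0} \<subseteq> \<Omega>"

definition locally_integrable ::
  "'a::euclidean_space set \<Rightarrow> ('a \<Rightarrow> 'b::euclidean_space) \<Rightarrow> bool" where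
  "locally_integrable \<Omega> f \<longleftrightarrow> (\<forall>K. compact K \<and> K \<subseteq> \<Omega> \<longrightarrow> set_integrable lebesgue K f)"

definition has_weak_gradient ::
  "'a::euclidean_space set \<Rightarrow> ('a \<Rightarrow> real) \<Rightarrow> ('a \<Rightarrow> 'a) \<Rightarrow> bool" where
  "has_weak_gradient \<Omega> u g \<longleftrightarrow>
     locally_integrable \<Omega> u \<and> locally_integrable \<Omega> g \<and>
     (\<forall>\<phi>. test_function \<Omega> \<phi> \<longrightarrow>
        (\<forall>i\<in>Basis. (LINT x:\<Omega>|lebesgue. u x * frechet_derivative \<phi> (at x) i) =
                   - (LINT x:\<Omega>|lebesgue. (g x \<bullet> i) * \<phi> x)))"

text \<open>On an open set the weak gradient is unique up to null sets, so that \<open>L\<^sup>p\<close> norms do not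
  depend on the representative chosen here.\<close>

definition weak_gradient :: "'a::euclidean_space set \<Rightarrow> ('a \<Rightarrow> real) \<Rightarrow> 'a \<Rightarrow> 'a" where
  "weak_gradient \<Omega> u = (SOME g. has_weak_gradient \<Omega> u g)"

definition sobolev_const :: "nat \<Rightarrow> real \<Rightarrow> real \<Rightarrow> real" where
  "sobolev_const N s p =
     s * 2 powr (2 * s - 1) * Gamma ((p * s + p + real N - 2) / 2) /
     (pi powr (real N / 2) * Gamma (1 - s))"

text \<open>Meaningful for \<open>0 \<le> s \<le> 1\<close>. For \<open>s = 1\<close> the seminorm of a function without weak gradient
  is \<open>\<infinity>\<close>. For \<open>0 < s < 1\<close> the integrand takes the value \<open>0\<close> on the (null) diagonal.\<close>

definition sobolev_seminorm ::
  "'a::euclidean_space set \<Rightarrow> real \<Rightarrow> real \<Rightarrow> ('a \<Rightarrow> real) \<Rightarrow> ennreal" where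
  "sobolev_seminorm \<Omega> s p u =
     (if s = 0 then Lp_norm \<Omega> p u
      else if s = 1 then
        (if \<exists>g. has_weak_gradient \<Omega> u g then Lp_norm \<Omega> p (weak_gradient \<Omega> u) else \<infinity>)
      else
        ennreal_powr
          (ennreal (sobolev_const DIM('a) s p) *
           (\<integral>\<^sup>+(x, y). ennreal (\<bar>u x - u y\<bar> powr p / norm (x - y) powr (real DIM('a) + s * p))
              \<partial>(lebesgue_on \<Omega> \<Otimes>\<^sub>M lebesgue_on \<Omega>)))
          (1 / p))"

definition sobolev_space :: "'a::euclidean_space set \<Rightarrow> real \<Rightarrow> real \<Rightarrow> ('a \<Rightarrow> real) set" where
  "sobolev_space \<Omega> s p =
     {u \<in> borel_measurable (lebesgue_on \<Omega>). Lp_norm \<Omega> p u < \<infinity> \<and> sobolev_seminorm \<Omega> s p u < \<infinity>}"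

definition sobolev_norm ::
  "'a::euclidean_space set \<Rightarrow> real \<Rightarrow> real \<Rightarrow> ('a \<Rightarrow> real) \<Rightarrow> ennreal" where
  "sobolev_norm \<Omega> s p u =
     (if s = 0 then Lp_norm \<Omega> p u
      else ennreal_powr
             (ennreal_powr (sobolev_seminorm \<Omega> s p u) p + ennreal_powr (Lp_norm \<Omega> p u) p)
             (1 / p))"

definition sobolev_embedded ::
  "'a::euclidean_space set \<Rightarrow> real \<times> real \<Rightarrow> real \<times> real \<Rightarrow> bool" where
  "sobolev_embedded \<Omega> = (\<lambda>(s, p) (t, q).
     sobolev_space \<Omega> s p \<subseteq> sobolev_space \<Omega> t q \<and>
     (\<exists>C::real. 0 < C \<and>
        (\<forall>u\<in>sobolev_space \<Omega> s p. sobolev_norm \<Omega> t q u \<le> ennreal C * sobolev_norm \<Omega> s p u)))"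

definition sobolev_curve :: "real \<Rightarrow> real \<Rightarrow> real \<Rightarrow> real \<Rightarrow> real \<Rightarrow> real \<times> real" where
  "sobolev_curve s p t q \<theta> = (\<theta> * t + (1 - \<theta>) * s, p * q / (q + \<theta> * (p - q)))"

end

(* Call w in L^p a Hajlasz gradient of u if |u x - u y| <= |x - y|^s (w x + w y) and |u| <= w off
   a null set. Then |u| <= C w^(1-a) W^a with W = |w|_p, for every a in [0, sp/N]: by Chebyshev there
   are y_k in B(x, 2^k r) with w(y_k) at most of order |B(x, 2^k r)|^(-1/p) W, one sums the
   increments of u along them, and one optimises over r. Hence an increment of u over h is at most
   C min (|h|^s w, w^(1-a) W^a), with w taken at the end point where it is larger; integrating the
   q-th power over h gives the W^{t,q} seminorm, critical exponents included. For s < 1 and every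
   p >= 1 such a w comes directly from the Gagliardo integrand; for s = 1 < p it comes from the
   maximal function of the weak gradient. Along the curve, s and 1/p are affine in theta, so the
   hypotheses persist between any two of its points. *)

theory Submission
  imports Defs
begin

text \<open>The critical exponents are reached because the q-th power of
  \<open>w powr (1 - a) * W powr a\<close>, or its weighted integral over the increments, leaves
  exactly a multiple of \<open>w powr p\<close>. The hypothesis \<open>s \<noteq> p\<close> removes
  the case s = p = 1: there the maximal function of the gradient is not integrable unless the
  gradient vanishes, so it provides no \<open>w\<close> in L^1. For s = 1 < p the obstacle is that a
  weak gradient cannot simply be integrated along segments. Instead the average of \<open>u\<close>
  against a bump is moved along a straight path in centre and radius together. Its derivative is the
  weak gradient tested against smooth compactly supported vector fields, hence bounded by the
  maximal function, and Lebesgue points recover \<open>u\<close> as the radius tends to 0. In the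
  proof \<open>W\<close> is an arbitrary positive upper bound of the norm of \<open>w\<close>, and
  all constants are fixed before \<open>u\<close>. At the end \<open>W\<close> becomes a multiple of
  the norm of \<open>u\<close>, or tends to 0 if that norm vanishes.\<close>

section \<open>Radial integrals\<close>

text \<open>The Gagliardo integral lives on the product of two completed measures, so Tonelli's
  theorem is required for \<open>lebesgue\<close> itself. A countable cover for
  \<open>lborel\<close> serves for its completion.\<close>

lemma sigma_finite_lebesgue: "sigma_finite_measure (lebesgue :: 'a::euclidean_space measure)"
proof
  obtain A :: "'a set set" where A: "countable A" "A \<subseteq> sets lborel" "\<Union>A = space lborel"
      "\<forall>a\<in>A. emeasure lborel a \<noteq> \<infinity>"
    using lborel.sigma_finite_countable by blast
  show "\<exists>A::'a set set. countable A \<and> A \<subseteq> sets lebesgue \<and> \<Union>A = space lebesgue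
      \<and> (\<forall>a\<in>A. emeasure lebesgue a \<noteq> \<infinity>)"
    using A by (intro exI[of _ A]) (auto simp: subset_eq)
qed

interpretation lebesgue: sigma_finite_measure "lebesgue :: 'a::euclidean_space measure"
  by (rule sigma_finite_lebesgue)

interpretation lebesgue_pair: pair_sigma_finite
  "lebesgue :: 'a::euclidean_space measure" "lebesgue :: 'b::euclidean_space measure" ..

lemma emeasure_lebesgue_ball:
  fixes x :: "'a::euclidean_space"
  shows "0 \<le> r \<Longrightarrow> emeasure lebesgue (ball x r) = ennreal (unit_ball_vol DIM('a) * r ^ DIM('a))"
  by (simp add: emeasure_ball)

lemma nn_integral_cmult_ball:
  fixes x :: "'a::euclidean_space"
  assumes "0 \<le> c" "0 \<le> r"
  shows "(\<integral>\<^sup>+h. ennreal c * indicator (ball x r) h \<partial>lebesgue)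
    = ennreal (c * (unit_ball_vol DIM('a) * r ^ DIM('a)))"
proof -
  have "(\<integral>\<^sup>+h. ennreal c * indicator (ball x r) h \<partial>lebesgue) = ennreal c * emeasure lebesgue (ball x r)"
    by (rule nn_integral_cmult_indicator) simp
  then show ?thesis
    using assms by (simp only: emeasure_lebesgue_ball ennreal_mult' mult.assoc)
qed

lemma AE_lebesgue_not_negligible:
  "negligible Z \<Longrightarrow> AE x in lebesgue. x \<notin> Z"
  by (simp add: AE_not_in negligible_iff_null_sets)

text \<open>Chebyshev's inequality in existence form. The factor 2 makes the contradiction strict
  when \<open>I\<close> is positive; when \<open>I = 0\<close>, a function positive almost
  everywhere on \<open>B\<close> would have a positive integral. The point avoids a null set so that
  inequalities valid off that set can be used at it.\<close>

lemma exists_le_twice_average: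
  fixes f :: "'a::euclidean_space \<Rightarrow> ennreal"
  assumes f: "f \<in> borel_measurable lebesgue" and Z: "negligible Z"
    and B: "B \<in> sets lebesgue" "emeasure lebesgue B = ennreal m" "0 < m"
    and I: "(\<integral>\<^sup>+x. f x * indicator B x \<partial>lebesgue) \<le> ennreal I" "0 \<le> I"
  obtains y where "y \<in> B" "y \<notin> Z" "f y \<le> ennreal (2 * I / m)"
proof -
  have "\<exists>y\<in>B - Z. f y \<le> ennreal (2 * I / m)"
  proof (rule ccontr)
    assume "\<not> ?thesis"
    then have big: "f y > ennreal (2 * I / m)" if "y \<in> B" "y \<notin> Z" for y
      using that by (force simp: not_le)
    have ae: "AE y in lebesgue. y \<notin> Z"
      using Z by (rule AE_lebesgue_not_negligible)
    show False
    proof (cases "I = 0")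
      case True
      then have "(\<integral>\<^sup>+x. f x * indicator B x \<partial>lebesgue) = 0"
        using I by auto
      then have "AE x in lebesgue. f x * indicator B x = 0"
        by (subst (asm) nn_integral_0_iff_AE) (use f B in auto)
      with ae have "AE x in lebesgue. x \<notin> B"
        by eventually_elim (use big True in \<open>force simp: indicator_def split: if_splits\<close>)
      then have "emeasure lebesgue B = 0"
        by (subst (asm) AE_iff_null[OF _]) (use B in \<open>auto simp: null_sets_def\<close>)
      with B show False by auto
    next
      case False
      have "ennreal (2 * I) = (\<integral>\<^sup>+x. ennreal (2 * I / m) * indicator B x \<partial>lebesgue)"
        using B I by (subst nn_integral_cmult_indicator) (auto simp: ennreal_mult[symmetric])
      also have "\<dots> \<le> (\<integral>\<^sup>+x. f x * indicator B x \<partial>lebesgue)"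
        by (rule nn_integral_mono_AE, use ae in eventually_elim)
          (auto simp: indicator_def dest: big intro: less_imp_le)
      also have "\<dots> \<le> ennreal I" by fact
      finally show False using False I by (auto simp: ennreal_le_iff)
    qed
  qed
  then show ?thesis using that by auto
qed

text \<open>Dyadic shells replace polar coordinates: between the radii r / 2^(k+1) and r / 2^k the
  integrand is at most a constant \<open>c k\<close>, which is integrated over the whole ball of
  radius r / 2^k. This gives a geometric series with ratio
  \<open>2 powr (-\<alpha>)\<close>.\<close>

lemma nn_integral_ball_powr:
  fixes r \<alpha> :: real
  assumes \<alpha>: "0 < \<alpha>" and r: "0 < r"
  shows "(\<integral>\<^sup>+h. ennreal (norm (h::'a::euclidean_space) powr (\<alpha> - DIM('a))) * indicator (ball 0 r) h \<partial>lebesgue)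
     \<le> ennreal (2 ^ DIM('a) * unit_ball_vol DIM('a) / (1 - 2 powr (-\<alpha>)) * r powr \<alpha>)"
proof -
  let ?N = "DIM('a)" and ?q = "2 powr (-\<alpha>) :: real"
  let ?v = "unit_ball_vol (real ?N)"
  \<comment> \<open>The factor 2^N covers both signs of \<alpha> - N: a nonpositive exponent is
    largest at the inner radius and costs 2^(N - \<alpha>) \<le> 2^N, a positive one is largest at
    the outer radius.\<close>
  define c where "c k = 2 ^ ?N * (r / 2 ^ k) powr (\<alpha> - ?N)" for k :: nat
  have [measurable]: "ball (0::'a) R \<in> sets lebesgue" for R by simp
  have q: "0 < ?q" "?q < 1" using \<alpha> by (auto simp: powr_less_one)
  have "(\<integral>\<^sup>+h. ennreal (norm (h::'a) powr (\<alpha> - ?N)) * indicator (ball 0 r) h \<partial>lebesgue)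
      \<le> (\<integral>\<^sup>+h. (\<Sum>k. ennreal (c k) * indicator (ball (0::'a) (r / 2 ^ k)) h) \<partial>lebesgue)"
  proof (rule nn_integral_mono)
    fix h :: 'a
    show "ennreal (norm h powr (\<alpha> - ?N)) * indicator (ball 0 r) h
        \<le> (\<Sum>k. ennreal (c k) * indicator (ball 0 (r / 2 ^ k)) h)"
    proof (cases "h = 0 \<or> norm h \<ge> r")
      case True
      then show ?thesis by (auto simp: indicator_def)
    next
      case False
      then have h: "0 < norm h" "norm h < r" by auto
      have "\<exists>k. r / 2 ^ k \<le> norm h"
      proof -
        obtain k where "(1/2) ^ k < norm h / r"
          using real_arch_pow_inv[of "norm h / r" "1/2"] h r by (auto simp: zero_less_divide_iff)
        then show ?thesis using r by (intro exI[of _ k]) (auto simp: field_simps power_divide)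
      qed
      then have ex: "r / 2 ^ (LEAST k. r / 2 ^ k \<le> norm h) \<le> norm h" (is "r / 2 ^ ?k \<le> _")
        by (rule LeastI_ex)
      have "?k \<noteq> 0" using ex h by (intro notI) auto
      then obtain k where k: "?k = Suc k" by (cases ?k) auto
      then have lt: "norm h < r / 2 ^ k"
        using not_less_Least[of k "\<lambda>k. r / 2 ^ k \<le> norm h"] by auto
      have ge: "r / 2 ^ k / 2 \<le> norm h" using ex k by simp
      have "norm h powr (\<alpha> - ?N) \<le> c k"
      proof (cases "\<alpha> \<le> ?N")
        case True
        have "norm h powr (\<alpha> - ?N) \<le> (r / 2 ^ k / 2) powr (\<alpha> - ?N)"
          using True by (intro powr_mono2'[OF _ _ ge]) (use r in simp_all)
        also have "\<dots> = (r / 2 ^ k) powr (\<alpha> - ?N) * 2 powr (?N - \<alpha>)"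
          by (subst powr_divide) (use r in \<open>simp_all add: powr_diff del: divide_divide_eq_left\<close>)
        also have "\<dots> \<le> (r / 2 ^ k) powr (\<alpha> - ?N) * 2 powr ?N"
          using \<alpha> by (intro mult_left_mono powr_mono) auto
        finally show ?thesis by (simp add: c_def powr_realpow mult.commute)
      next
        case False
        have "norm h powr (\<alpha> - ?N) \<le> 1 * (r / 2 ^ k) powr (\<alpha> - ?N)"
          using lt False h by (auto intro: powr_mono2)
        also have "\<dots> \<le> c k"
          unfolding c_def by (intro mult_right_mono) auto
        finally show ?thesis .
      qed
      then have "ennreal (norm h powr (\<alpha> - ?N)) * indicator (ball 0 r) h
          \<le> ennreal (c k) * indicator (ball 0 (r / 2 ^ k)) h"
        using lt h by (auto simp: indicator_def intro: ennreal_leI)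
      also have "\<dots> = (\<Sum>j\<in>{k}. ennreal (c j) * indicator (ball 0 (r / 2 ^ j)) h)"
        by (subst sum.insert) (simp_all only: finite.emptyI empty_iff not_False_eq_True sum.empty add_0_right)
      also have "\<dots> \<le> (\<Sum>j. ennreal (c j) * indicator (ball 0 (r / 2 ^ j)) h)"
        by (rule sum_le_suminf) auto
      finally show ?thesis .
    qed
  qed
  also have "\<dots> = (\<Sum>k. \<integral>\<^sup>+h. ennreal (c k) * indicator (ball (0::'a) (r / 2 ^ k)) h \<partial>lebesgue)"
    by (rule nn_integral_suminf) measurable
  also have "\<dots> = (\<Sum>k. ennreal (2 ^ ?N * ?v * r powr \<alpha> * ?q ^ k))"
  proof (rule suminf_cong)
    fix k :: nat
    have "(r / 2 ^ k) powr (\<alpha> - ?N) * (r / 2 ^ k) ^ ?N = (r / 2 ^ k) powr \<alpha>"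
      using r by (simp add: powr_realpow[symmetric] powr_add[symmetric])
    also have "\<dots> = r powr \<alpha> * ?q ^ k"
      using r by (simp add: powr_divide powr_minus powr_powr powr_realpow[symmetric] field_simps)
    finally have e: "(r / 2 ^ k) powr (\<alpha> - ?N) * (r / 2 ^ k) ^ ?N = r powr \<alpha> * ?q ^ k" .
    have "(\<integral>\<^sup>+h. ennreal (c k) * indicator (ball (0::'a) (r / 2 ^ k)) h \<partial>lebesgue)
       = ennreal (c k * (?v * (r / 2 ^ k) ^ ?N))"
      using r by (intro nn_integral_cmult_ball) (auto simp: c_def)
    also have "c k * (?v * (r / 2 ^ k) ^ ?N)
        = 2 ^ ?N * ?v * ((r / 2 ^ k) powr (\<alpha> - ?N) * (r / 2 ^ k) ^ ?N)"
      unfolding c_def by (simp only: mult_ac)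
    finally show "(\<integral>\<^sup>+h. ennreal (c k) * indicator (ball (0::'a) (r / 2 ^ k)) h \<partial>lebesgue)
       = ennreal (2 ^ ?N * ?v * r powr \<alpha> * ?q ^ k)"
      by (simp only: e mult.assoc)
  qed
  also have "\<dots> = ennreal (\<Sum>k. 2 ^ ?N * ?v * r powr \<alpha> * ?q ^ k)"
    using q by (intro suminf_ennreal2 summable_mult) auto
  also have "(\<Sum>k. 2 ^ ?N * ?v * r powr \<alpha> * ?q ^ k) = 2 ^ ?N * ?v * r powr \<alpha> * (1 / (1 - ?q))"
    using q by (subst suminf_mult) (auto simp: suminf_geometric)
  finally show ?thesis by (simp add: mult_ac)
qed

text \<open>Shells of doubling radii this time. The exponent is negative, so \<open>c k\<close> is
  the value at the inner radius, and the 2^N of the bound comes from the volume of the ball of twice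
  that radius.\<close>

lemma nn_integral_compl_ball_powr:
  fixes r \<beta> :: real
  assumes \<beta>: "0 < \<beta>" and r: "0 < r"
  shows "(\<integral>\<^sup>+h. ennreal (norm (h::'a::euclidean_space) powr (- real DIM('a) - \<beta>)) * indicator (- ball 0 r) h \<partial>lebesgue)
     \<le> ennreal (2 ^ DIM('a) * unit_ball_vol DIM('a) / (1 - 2 powr (-\<beta>)) * r powr (-\<beta>))"
proof -
  let ?N = "DIM('a)" and ?q = "2 powr (-\<beta>) :: real"
  let ?v = "unit_ball_vol (real ?N)"
  define c where "c k = (r * 2 ^ k) powr (- ?N - \<beta>)" for k :: nat
  have [measurable]: "ball (0::'a) R \<in> sets lebesgue" for R by simp
  have q: "0 < ?q" "?q < 1" using \<beta> by (auto simp: powr_less_one)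
  have "(\<integral>\<^sup>+h. ennreal (norm (h::'a) powr (- ?N - \<beta>)) * indicator (- ball 0 r) h \<partial>lebesgue)
      \<le> (\<integral>\<^sup>+h. (\<Sum>k. ennreal (c k) * indicator (ball (0::'a) (2 * (r * 2 ^ k))) h) \<partial>lebesgue)"
  proof (rule nn_integral_mono)
    fix h :: 'a
    show "ennreal (norm h powr (- ?N - \<beta>)) * indicator (- ball 0 r) h
        \<le> (\<Sum>k. ennreal (c k) * indicator (ball 0 (2 * (r * 2 ^ k))) h)"
    proof (cases "norm h < r")
      case True
      then show ?thesis by (auto simp: indicator_def)
    next
      case False
      then have h: "r \<le> norm h" "0 < norm h" using r by auto
      have "\<exists>k. norm h < r * 2 ^ k"
        using real_arch_pow[of 2 "norm h / r"] r by (auto simp: field_simps)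
      then have ex: "norm h < r * 2 ^ (LEAST k. norm h < r * 2 ^ k)" (is "_ < r * 2 ^ ?k")
        by (rule LeastI_ex)
      have "?k \<noteq> 0" using ex h by (intro notI) auto
      then obtain k where k: "?k = Suc k" by (cases ?k) auto
      then have ge: "r * 2 ^ k \<le> norm h"
        using not_less_Least[of k "\<lambda>k. norm h < r * 2 ^ k"] by auto
      have lt: "norm h < 2 * (r * 2 ^ k)" using ex k by (simp add: mult_ac)
      have "norm h powr (- ?N - \<beta>) \<le> c k"
        unfolding c_def using ge r h \<beta> by (intro powr_mono2') auto
      then have "ennreal (norm h powr (- ?N - \<beta>)) * indicator (- ball 0 r) h
          \<le> ennreal (c k) * indicator (ball 0 (2 * (r * 2 ^ k))) h"
        using lt h by (auto simp: indicator_def intro: ennreal_leI)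
      also have "\<dots> = (\<Sum>j\<in>{k}. ennreal (c j) * indicator (ball 0 (2 * (r * 2 ^ j))) h)"
        by (subst sum.insert) (simp_all only: finite.emptyI empty_iff not_False_eq_True sum.empty add_0_right)
      also have "\<dots> \<le> (\<Sum>j. ennreal (c j) * indicator (ball 0 (2 * (r * 2 ^ j))) h)"
        by (rule sum_le_suminf) auto
      finally show ?thesis .
    qed
  qed
  also have "\<dots> = (\<Sum>k. \<integral>\<^sup>+h. ennreal (c k) * indicator (ball (0::'a) (2 * (r * 2 ^ k))) h \<partial>lebesgue)"
    by (rule nn_integral_suminf) measurable
  also have "\<dots> = (\<Sum>k. ennreal (2 ^ ?N * ?v * r powr (-\<beta>) * ?q ^ k))"
  proof (rule suminf_cong)
    fix k :: nat
    have "(r * 2 ^ k) powr (- ?N - \<beta>) * (r * 2 ^ k) ^ ?N = (r * 2 ^ k) powr (-\<beta>)"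
      using r by (simp add: powr_realpow[symmetric] powr_add[symmetric])
    also have "\<dots> = r powr (-\<beta>) * ?q ^ k"
      using r by (simp add: powr_mult powr_powr powr_realpow[symmetric] mult.commute)
    finally have e: "(r * 2 ^ k) powr (- ?N - \<beta>) * (r * 2 ^ k) ^ ?N = r powr (-\<beta>) * ?q ^ k" .
    have "(\<integral>\<^sup>+h. ennreal (c k) * indicator (ball (0::'a) (2 * (r * 2 ^ k))) h \<partial>lebesgue)
       = ennreal (c k * (?v * (2 * (r * 2 ^ k)) ^ ?N))"
      using r by (intro nn_integral_cmult_ball) (auto simp: c_def)
    also have "c k * (?v * (2 * (r * 2 ^ k)) ^ ?N)
        = 2 ^ ?N * ?v * ((r * 2 ^ k) powr (- ?N - \<beta>) * (r * 2 ^ k) ^ ?N)"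
      unfolding c_def power_mult_distrib[of 2] by (simp only: mult_ac)
    finally show "(\<integral>\<^sup>+h. ennreal (c k) * indicator (ball (0::'a) (2 * (r * 2 ^ k))) h \<partial>lebesgue)
       = ennreal (2 ^ ?N * ?v * r powr (-\<beta>) * ?q ^ k)"
      by (simp only: e mult.assoc)
  qed
  also have "\<dots> = ennreal (\<Sum>k. 2 ^ ?N * ?v * r powr (-\<beta>) * ?q ^ k)"
    using q by (intro suminf_ennreal2 summable_mult) auto
  also have "(\<Sum>k. 2 ^ ?N * ?v * r powr (-\<beta>) * ?q ^ k) = 2 ^ ?N * ?v * r powr (-\<beta>) * (1 / (1 - ?q))"
    using q by (subst suminf_mult) (auto simp: suminf_geometric)
  finally show ?thesis by (simp add: mult_ac)
qed

section \<open>Hajlasz gradients\<close>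

lemma powr_add_le:
  fixes x y q :: real
  assumes "0 \<le> x" "0 \<le> y" "0 \<le> q"
  shows "(x + y) powr q \<le> 2 powr q * (x powr q + y powr q)"
proof -
  have "(x + y) powr q \<le> (2 * max x y) powr q"
    using assms by (intro powr_mono2) auto
  also have "\<dots> = 2 powr q * max x y powr q"
    using assms by (simp add: powr_mult)
  also have "\<dots> \<le> 2 powr q * (x powr q + y powr q)"
    by (intro mult_left_mono) (auto simp: max_def)
  finally show ?thesis .
qed

lemma ennreal_mult_add_mult:
  assumes "0 \<le> a" "0 \<le> b" "0 \<le> c" "0 \<le> d"
  shows "ennreal a * ennreal b + ennreal c * ennreal d = ennreal (a * b + c * d)"
  using assms by (simp add: ennreal_mult)

lemma powr_le_iff:
  fixes x y a :: real
  assumes "0 \<le> x" "0 \<le> y" "0 < a"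
  shows "x powr a \<le> y powr a \<longleftrightarrow> x \<le> y"
  by (metis assms less_eq_real_def linorder_not_less powr_less_mono2 powr_mono2)

text \<open>The radial profile below comes from comparing the two available bounds on the increments
  of \<open>u\<close>; they cross at \<open>\<bar>h\<bar> = (W / w) powr (a / s)\<close>, and \<open>a\<close> is chosen such that both
  contributions scale like \<open>w powr p\<close>.\<close>

lemma nn_integral_min_powr:
  fixes s t p q a w W :: real
  assumes s: "0 < s" and t: "0 < t" "t < s" and p: "1 \<le> p" "p \<le> q"
    and a: "a = (1 - p / q) * s / (s - t)" and W: "0 < W" and w: "0 \<le> w"
  shows "(\<integral>\<^sup>+h. ennreal (min (norm (h::'a::euclidean_space) powr s * w) (w powr (1 - a) * W powr a) powr q
             / norm h powr (DIM('a) + t * q)) \<partial>lebesgue)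
    \<le> ennreal (2 ^ DIM('a) * unit_ball_vol DIM('a)
        * (1 / (1 - 2 powr (-((s - t) * q))) + 1 / (1 - 2 powr (-(t * q)))) * (w powr p * W powr (q - p)))"
    (is "?I \<le> ennreal (?V * (?c1 + ?c2) * ?R)")
proof (cases "w = 0")
  case True
  then show ?thesis using p by simp
next
  case False
  with w have w: "0 < w" by simp
  let ?N = "real DIM('a)"
  define \<rho> where "\<rho> = (W / w) powr (a / s)"
  have \<rho>: "0 < \<rho>" using w W by (simp add: \<rho>_def)
  have q: "0 < q" using p by simp
  have alpha: "0 < (s - t) * q" and beta: "0 < t * q" using t q by auto
  \<comment> \<open>This form of the choice of \<open>a\<close> makes the exponent of
    \<open>W\<close> equal to q - p in both \<open>e1\<close> and \<open>e2\<close>.\<close>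
  have asq: "a * q * (s - t) = (q - p) * s" using a q t by (simp add: field_simps)
  have e1: "w powr q * \<rho> powr ((s - t) * q) = ?R"
  proof -
    have "a / s * ((s - t) * q) = q - p" using asq s by (simp add: field_simps)
    then have "\<rho> powr ((s - t) * q) = (W / w) powr (q - p)"
      by (simp only: \<rho>_def powr_powr)
    then show ?thesis using w W by (simp add: powr_divide powr_diff field_simps)
  qed
  have e2: "(w powr (1 - a) * W powr a) powr q * \<rho> powr (-(t * q)) = ?R"
  proof -
    define m where "m = a / s * (t * q)"
    have m: "a * q - m = q - p" using asq s unfolding m_def by (simp add: field_simps)
    have "(w powr (1 - a) * W powr a) powr q * \<rho> powr (-(t * q))
        = w powr ((1 - a) * q) * W powr (a * q) * (W powr (-m) * w powr m)"
    proof -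
      have "\<rho> powr (-(t * q)) = (W / w) powr (- m)"
        by (simp add: \<rho>_def powr_powr m_def)
      also have "\<dots> = W powr (- m) * w powr m"
        using w W by (simp add: powr_divide powr_minus field_simps)
      finally show ?thesis using w W by (simp add: powr_powr powr_mult)
    qed
    also have "\<dots> = w powr ((1 - a) * q + m) * W powr (a * q - m)"
      by (simp add: powr_add powr_diff powr_minus field_simps)
    also have "(1 - a) * q + m = p" using m by (simp add: algebra_simps)
    finally show ?thesis using m by simp
  qed
  have "?I \<le> (\<integral>\<^sup>+h. ennreal (w powr q) * (ennreal (norm (h::'a) powr ((s - t) * q - DIM('a))) * indicator (ball 0 \<rho>) h)
      + ennreal ((w powr (1 - a) * W powr a) powr q)
        * (ennreal (norm h powr (- real DIM('a) - t * q)) * indicator (- ball 0 \<rho>) h) \<partial>lebesgue)"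
  proof (rule nn_integral_mono)
    fix h :: 'a
    let ?m = "min (norm h powr s * w) (w powr (1 - a) * W powr a)"
    show "ennreal (?m powr q / norm h powr (?N + t * q)) \<le> ennreal (w powr q) * (ennreal (norm h powr ((s - t) * q - ?N)) * indicator (ball 0 \<rho>) h)
      + ennreal ((w powr (1 - a) * W powr a) powr q)
        * (ennreal (norm h powr (- ?N - t * q)) * indicator (- ball 0 \<rho>) h)"
    proof (cases "norm h < \<rho>")
      case True
      have "?m powr q / norm h powr (?N + t * q) \<le> (norm h powr s * w) powr q / norm h powr (?N + t * q)"
        using w W q by (intro divide_right_mono powr_mono2) auto
      also have "\<dots> = w powr q * norm h powr ((s - t) * q - ?N)"
        using w by (cases "h = 0") (simp_all add: powr_mult powr_powr powr_diff powr_add algebra_simps)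
      finally show ?thesis using True by (simp add: ennreal_mult[symmetric] ennreal_leI)
    next
      case False
      have "?m powr q / norm h powr (?N + t * q)
          \<le> (w powr (1 - a) * W powr a) powr q / norm h powr (?N + t * q)"
        using w W q by (intro divide_right_mono powr_mono2) auto
      also have "\<dots> = (w powr (1 - a) * W powr a) powr q * norm h powr (- ?N - t * q)"
        using powr_minus_divide[of "norm h" "?N + t * q"] by simp
      finally show ?thesis using False by (simp add: ennreal_mult[symmetric] ennreal_leI)
    qed
  qed
  also have "\<dots> = ennreal (w powr q) * (\<integral>\<^sup>+h. ennreal (norm (h::'a) powr ((s - t) * q - DIM('a))) * indicator (ball 0 \<rho>) h \<partial>lebesgue)
      + ennreal ((w powr (1 - a) * W powr a) powr q)
        * (\<integral>\<^sup>+h. ennreal (norm (h::'a) powr (- real DIM('a) - t * q)) * indicator (- ball 0 \<rho>) h \<partial>lebesgue)"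
  proof -
    have [measurable]: "ball (0::'a) \<rho> \<in> sets lebesgue" by simp
    have [measurable]: "(\<lambda>h::'a. ennreal (norm h powr c)) \<in> borel_measurable lebesgue" for c
      by (rule measurable_completion) simp
    have f: "(\<lambda>h::'a. ennreal (norm h powr c) * indicator (ball 0 \<rho>) h) \<in> borel_measurable lebesgue"
      and g: "(\<lambda>h::'a. ennreal (norm h powr c) * indicator (- ball 0 \<rho>) h) \<in> borel_measurable lebesgue" for c
      by measurable
    show ?thesis
      by (simp only: nn_integral_add[OF borel_measurable_times_ennreal[OF borel_measurable_const f]
            borel_measurable_times_ennreal[OF borel_measurable_const g]] nn_integral_cmult[OF f] nn_integral_cmult[OF g])
  qed
  also have "\<dots> \<le> ennreal (w powr q) * ennreal (2 ^ DIM('a) * unit_ball_vol DIM('a) / (1 - 2 powr (-((s - t) * q))) * \<rho> powr ((s - t) * q))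
      + ennreal ((w powr (1 - a) * W powr a) powr q)
        * ennreal (2 ^ DIM('a) * unit_ball_vol DIM('a) / (1 - 2 powr (-(t * q))) * \<rho> powr (-(t * q)))"
    by (intro add_mono mult_left_mono nn_integral_ball_powr nn_integral_compl_ball_powr alpha beta \<rho>) auto
  also have "\<dots> = ennreal (?V * ?c1 * (w powr q * \<rho> powr ((s - t) * q))
      + ?V * ?c2 * ((w powr (1 - a) * W powr a) powr q * \<rho> powr (-(t * q))))"
  proof -
    have "0 \<le> 1 - 2 powr (-((s - t) * q))" "0 \<le> 1 - 2 powr (-(t * q))"
      using alpha beta by (auto simp: powr_less_one less_imp_le)
    moreover have "A * (V / d * R) + B * (V / e * S) = V * (1 / d) * (A * R) + V * (1 / e) * (B * S)"
      for A B V d e R S :: real by (simp add: mult_ac)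
    ultimately show ?thesis
      by (subst ennreal_mult_add_mult) (simp_all only: mult_nonneg_nonneg divide_nonneg_nonneg
        powr_ge_zero zero_le_power zero_le_numeral unit_ball_vol_nonneg of_nat_0_le_iff)
  qed
  also have "\<dots> = ennreal (?V * (?c1 + ?c2) * ?R)"
    unfolding e1 e2 by (simp add: algebra_simps)
  finally show ?thesis .
qed

text \<open>\<open>W\<close> is a positive upper bound of the norm rather than the norm, so that
  powers of \<open>W / w x\<close> can be formed whenever \<open>w x\<close> is positive. The
  pointwise bound of \<open>u\<close> by \<open>w\<close> has two tasks: it forces decay, which
  excludes added constants, and it yields the exponents below the critical one.\<close>

locale hajlasz =
  fixes s p W :: real and u w :: "'a::euclidean_space \<Rightarrow> real" and Z :: "'a set"
  assumes s: "0 < s" and p: "1 \<le> p" and sp: "s * p < DIM('a)" and W: "0 < W"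
    and u_meas [measurable]: "u \<in> borel_measurable lebesgue"
    and w_meas [measurable]: "w \<in> borel_measurable lebesgue"
    and w_nonneg: "\<And>x. 0 \<le> w x"
    and Z: "negligible Z"
    and w_norm: "(\<integral>\<^sup>+x. ennreal (w x powr p) \<partial>lebesgue) \<le> ennreal (W powr p)"
    and osc: "\<And>x y. x \<notin> Z \<Longrightarrow> y \<notin> Z \<Longrightarrow> \<bar>u x - u y\<bar> \<le> norm (x - y) powr s * (w x + w y)"
    and bound: "\<And>x. x \<notin> Z \<Longrightarrow> \<bar>u x\<bar> \<le> w x"
begin

text \<open>The constant of Chebyshev's inequality on a ball: the 2 is that of
  \<open>exists_le_twice_average\<close>, and the root passes from \<open>w powr p\<close> to
  \<open>w\<close>.\<close>

definition point_const :: real where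
  "point_const = (2 / unit_ball_vol DIM('a)) powr (1 / p)"

text \<open>The 3 bounds the distance of consecutive points (R + 2 R), the 2 counts the two values
  of \<open>w\<close> in an increment, the denominator sums a geometric series, and the leading 1
  belongs to the term with \<open>w x\<close> itself. The constant depends on s, p and the dimension
  only, hence is uniform in \<open>u\<close>.\<close>

definition decay_const :: real where
  "decay_const = 1 + point_const * (1 + 2 * 3 powr s / (1 - 2 powr (s - DIM('a) / p)))"

lemma exponent_neg: "s - DIM('a) / p < 0"
  using sp p by (simp add: field_simps)

lemma point_const_pos: "0 < point_const"
  unfolding point_const_def by (intro powr_gt_zero[THEN iffD2]) (simp add: less_imp_neq[symmetric])

lemma decay_const_ge_1: "1 \<le> decay_const"
proof -
  have "2 powr (s - DIM('a) / p) < (1::real)"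
    using exponent_neg by (simp add: powr_less_one)
  then show ?thesis unfolding decay_const_def using point_const_pos by simp
qed

lemma exists_small_point:
  assumes R: "0 < R"
  obtains y where "y \<in> ball x R" "y \<notin> Z" "w y \<le> point_const * R powr (- (DIM('a) / p)) * W"
proof -
  let ?v = "unit_ball_vol (real DIM('a))"
  have v: "0 < ?v" by simp
  have "(\<integral>\<^sup>+y. ennreal (w y powr p) * indicator (ball x R) y \<partial>lebesgue) \<le> (\<integral>\<^sup>+y. ennreal (w y powr p) \<partial>lebesgue)"
    by (intro nn_integral_mono) (auto simp: indicator_def)
  also note w_norm
  finally have le: "(\<integral>\<^sup>+y. ennreal (w y powr p) * indicator (ball x R) y \<partial>lebesgue) \<le> ennreal (W powr p)" .
  obtain y where y: "y \<in> ball x R" "y \<notin> Z"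
      "ennreal (w y powr p) \<le> ennreal (2 * W powr p / (?v * R ^ DIM('a)))"
    by (rule exists_le_twice_average[OF _ Z _ emeasure_lebesgue_ball[of R x] _ le])
      (use R v that in \<open>auto simp del: ennreal_le_iff\<close>)
  have "w y powr p \<le> 2 * W powr p / (?v * R ^ DIM('a))"
    using y(3) v R by (subst (asm) ennreal_le_iff) auto
  also have "\<dots> = (point_const * R powr (- (DIM('a) / p)) * W) powr p"
  proof -
    have "point_const powr p = 2 / ?v" using p v by (simp add: point_const_def powr_powr)
    moreover have "(R powr (- (DIM('a) / p))) powr p = 1 / R ^ DIM('a)"
    proof -
      have "(R powr (- (DIM('a) / p))) powr p = R powr (- (DIM('a) / p) * p)" by (rule powr_powr)
      also have "- (DIM('a) / p) * p = - real DIM('a)" using p by simp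
      finally show ?thesis
        by (simp only: powr_minus_divide powr_realpow[OF R])
    qed
    ultimately show ?thesis
      using point_const_pos W by (simp add: powr_mult)
  qed
  finally have "w y \<le> point_const * R powr (- (DIM('a) / p)) * W"
    using p W point_const_pos by (subst (asm) powr_le_iff) (auto simp: w_nonneg)
  with y show ?thesis using that by blast
qed

lemma decay:
  assumes x: "x \<notin> Z" and r: "0 < r"
  shows "\<bar>u x\<bar> \<le> r powr s * w x + (decay_const - 1) * r powr (s - DIM('a) / p) * W"
proof -
  let ?e = "DIM('a) / p" and ?c = point_const
  define R where "R k = r * 2 ^ k" for k :: nat
  have R: "0 < R k" for k using r by (simp add: R_def)
  have "\<exists>y. \<forall>k. y k \<in> ball x (R k) \<and> y k \<notin> Z \<and> w (y k) \<le> ?c * R k powr (- ?e) * W"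
    by (rule choice) (use exists_small_point[OF R] in metis)
  then obtain y where y: "\<And>k. y k \<in> ball x (R k)" "\<And>k. y k \<notin> Z"
      "\<And>k. w (y k) \<le> ?c * R k powr (- ?e) * W" by blast
  have e: "0 < ?e" using p by simp
  \<comment> \<open>The increments along doubling radii form a convergent geometric series because s
    p < N.\<close>
  define \<rho> where "\<rho> = (2::real) powr (s - ?e)"
  have \<rho>: "0 < \<rho>" "\<rho> < 1" using exponent_neg by (auto simp: \<rho>_def powr_less_one)
  define D where "D = 2 * 3 powr s * ?c * r powr (s - ?e) * W"
  have D: "0 \<le> D" using W point_const_pos by (simp add: D_def)
  have step: "\<bar>u (y k) - u (y (Suc k))\<bar> \<le> D * \<rho> ^ k" for k
  proof -
    have "norm (y k - y (Suc k)) \<le> norm (y k - x) + norm (x - y (Suc k))"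
      using norm_triangle_ineq[of "y k - x" "x - y (Suc k)"] by simp
    also have "\<dots> \<le> R k + R (Suc k)"
      using y(1)[of k] y(1)[of "Suc k"] by (auto simp: dist_norm norm_minus_commute)
    also have "\<dots> = 3 * R k" by (simp add: R_def)
    finally have d: "norm (y k - y (Suc k)) \<le> 3 * R k" .
    have "w (y (Suc k)) \<le> ?c * R (Suc k) powr (- ?e) * W" by (rule y)
    also have "\<dots> \<le> ?c * R k powr (- ?e) * W"
      using e W point_const_pos R[of k] by (intro mult_right_mono mult_left_mono powr_mono2') (auto simp: R_def)
    finally have "w (y k) + w (y (Suc k)) \<le> 2 * (?c * R k powr (- ?e) * W)"
      using y(3)[of k] by simp
    then have "\<bar>u (y k) - u (y (Suc k))\<bar> \<le> (3 * R k) powr s * (2 * (?c * R k powr (- ?e) * W))"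
      using d s W point_const_pos
      by (intro order.trans[OF osc[OF y(2) y(2)]] mult_mono powr_mono2) (auto intro!: add_nonneg_nonneg w_nonneg)
    also have "\<dots> = 2 * 3 powr s * ?c * (R k powr (s - ?e)) * W"
      using R[of k] by (simp add: powr_mult powr_diff powr_minus field_simps)
    also have "R k powr (s - ?e) = r powr (s - ?e) * \<rho> ^ k"
      using r by (simp add: R_def \<rho>_def powr_mult powr_powr powr_realpow[symmetric] mult.commute)
    finally show ?thesis by (simp add: D_def mult_ac)
  qed
  have tele: "\<bar>u (y 0)\<bar> \<le> D * (\<Sum>k<n. \<rho> ^ k) + \<bar>u (y n)\<bar>" for n
  proof (induction n)
    case (Suc n)
    then show ?case using step[of n] by (simp add: distrib_left)
  qed simp
  have sum_le: "(\<Sum>k<n. \<rho> ^ k) \<le> 1 / (1 - \<rho>)" for n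
    using \<rho> by (simp add: sum_gp_strict divide_right_mono)
  \<comment> \<open>At the far point \<open>y n\<close> the function is bounded by \<open>w\<close>,
    and this last term tends to 0 like a negative power of \<open>R n\<close>.\<close>
  have "\<bar>u (y 0)\<bar> \<le> D / (1 - \<rho>) + ?c * R n powr (- ?e) * W" for n
    using tele[of n] mult_left_mono[OF sum_le[of n] D] bound[OF y(2), of n] y(3)[of n] by simp
  moreover have "(\<lambda>n. D / (1 - \<rho>) + ?c * R n powr (- ?e) * W) \<longlonglongrightarrow> D / (1 - \<rho>) + ?c * 0 * W"
  proof (intro tendsto_intros)
    have "R n powr (- ?e) = r powr (- ?e) * (2 powr (- ?e)) ^ n" for n
      using r by (simp add: R_def powr_mult powr_powr powr_realpow[symmetric] mult.commute)
    moreover have "(\<lambda>n. r powr (- ?e) * (2 powr (- ?e)) ^ n) \<longlonglongrightarrow> r powr (- ?e) * 0"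
      using e by (intro tendsto_intros LIMSEQ_realpow_zero) (auto simp: powr_less_one)
    ultimately show "(\<lambda>n. R n powr (- ?e)) \<longlonglongrightarrow> 0" by simp
  qed
  ultimately have "\<bar>u (y 0)\<bar> \<le> D / (1 - \<rho>)"
    by (intro LIMSEQ_le_const) auto
  moreover have "\<bar>u x - u (y 0)\<bar> \<le> r powr s * (w x + ?c * r powr (- ?e) * W)"
    using y(1)[of 0] y(3)[of 0] s x W point_const_pos
    by (intro order.trans[OF osc[OF x y(2)]] mult_mono powr_mono2)
       (auto simp: R_def dist_norm intro!: add_nonneg_nonneg w_nonneg)
  ultimately have "\<bar>u x\<bar> \<le> r powr s * (w x + ?c * r powr (- ?e) * W) + D / (1 - \<rho>)"
    by linarith
  also have "\<dots> = r powr s * w x + (decay_const - 1) * r powr (s - DIM('a) / p) * W"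
    using r \<rho> unfolding D_def decay_const_def \<rho>_def[symmetric]
    by (simp add: powr_diff powr_minus field_simps)
  finally show ?thesis .
qed

text \<open>At the critical exponent b = s p / N this is \<open>decay\<close> with the radius that
  balances its two terms. Smaller exponents follow by comparing \<open>w x\<close> with
  \<open>W\<close>: if \<open>w x \<le> W\<close>, the bound of \<open>u\<close> by \<open>w\<close>
  suffices; otherwise \<open>W / w x\<close> is below 1, and lowering its exponent enlarges the
  right-hand side.\<close>

lemma hedberg:
  assumes x: "x \<notin> Z" and a: "0 \<le> a" "a \<le> s * p / DIM('a)"
  shows "\<bar>u x\<bar> \<le> decay_const * (w x powr (1 - a) * W powr a)"
proof (cases "w x = 0")
  case True
  then show ?thesis using bound[OF x] decay_const_ge_1 by simp
next
  case False
  with w_nonneg[of x] have w: "0 < w x" by simp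
  let ?N = "real DIM('a)"
  define b where "b = s * p / ?N"
  have *: "\<bar>u x\<bar> \<le> decay_const * (w x powr (1 - b) * W powr b)"
  proof -
    define r where "r = (W / w x) powr (p / ?N)"
    have r: "0 < r" using w W by (simp add: r_def)
    have "r powr s * w x = w x powr (1 - b) * W powr b"
      using w W unfolding r_def b_def by (simp add: powr_powr powr_divide powr_diff mult_ac)
    moreover have "r powr (s - ?N / p) * W = w x powr (1 - b) * W powr b"
    proof -
      have "p / ?N * (s - ?N / p) = b - 1" using p unfolding b_def by (simp add: field_simps)
      then have "r powr (s - ?N / p) = (W / w x) powr (b - 1)"
        unfolding r_def by (simp add: powr_powr)
      then show ?thesis using w W by (simp add: powr_divide powr_diff field_simps)
    qed
    ultimately have "\<bar>u x\<bar> \<le> w x powr (1 - b) * W powr b + (decay_const - 1) * (w x powr (1 - b) * W powr b)"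
      using decay[OF x r] by (simp only: mult.assoc)
    then show ?thesis by (simp add: algebra_simps)
  qed
  show ?thesis
  proof (cases "w x \<le> W")
    case True
    have "w x = w x powr (1 - a) * w x powr a" using w by (simp add: powr_add[symmetric])
    also have "\<dots> \<le> w x powr (1 - a) * W powr a"
      using True w a by (intro mult_left_mono powr_mono2) auto
    finally show ?thesis
      using bound[OF x] decay_const_ge_1 mult_right_mono[OF decay_const_ge_1, of "w x powr (1 - a) * W powr a"] by simp
  next
    case False
    have eq: "w x powr (1 - c) * W powr c = w x * (W / w x) powr c" for c
      using w W by (simp add: powr_divide powr_diff)
    have "(W / w x) powr b \<le> (W / w x) powr a"
      using False w W a b_def by (intro powr_mono') auto
    then have "w x powr (1 - b) * W powr b \<le> w x powr (1 - a) * W powr a"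
      using w by (simp add: eq)
    then show ?thesis
      using * decay_const_ge_1 by (meson dual_order.trans mult_left_mono zero_le_one)
  qed
qed

text \<open>Rewritten in terms of 1 - p / q, the upper bound of \<open>q\<close> reads 1 - p / q
  \<le> (s - t) p / N. Equality holds at the critical exponent, where \<open>a\<close> takes the
  largest value s p / N that \<open>hedberg\<close> admits.\<close>

lemma exponent_bounds:
  fixes t q :: real
  assumes "0 \<le> t" "t < s" "p \<le> q" "q \<le> DIM('a) * p / (DIM('a) - (s - t) * p)"
  shows "0 \<le> (1 - p / q) * s / (s - t)" "(1 - p / q) * s / (s - t) \<le> s * p / DIM('a)"
proof -
  let ?N = "real DIM('a)"
  show "0 \<le> (1 - p / q) * s / (s - t)" using assms p s by auto
  have "(s - t) * p \<le> s * p" using assms p by (intro mult_right_mono) auto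
  then have pos: "0 < ?N - (s - t) * p" using sp by linarith
  have "q * (?N - (s - t) * p) \<le> ?N * p" using assms pos by (simp add: field_simps)
  then have "(q - p) * ?N \<le> (s - t) * p * q" by (simp add: algebra_simps)
  then have "1 - p / q \<le> (s - t) * p / ?N" using assms p by (simp add: field_simps)
  then have "(1 - p / q) * (s / (s - t)) \<le> (s - t) * p / ?N * (s / (s - t))"
    using s assms by (intro mult_right_mono) auto
  then show "(1 - p / q) * s / (s - t) \<le> s * p / ?N" using assms by (simp add: mult.commute)
qed

text \<open>For t = 0 the exponent is a = 1 - p / q, so (1 - a) q = p, and the q-th power of the
  pointwise bound is a multiple of \<open>w powr p\<close>.\<close>

lemma Lq_bound:
  fixes q :: real
  assumes q: "p \<le> q" "q \<le> DIM('a) * p / (DIM('a) - s * p)"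
  shows "(\<integral>\<^sup>+x. ennreal (\<bar>u x\<bar> powr q) \<partial>lebesgue) \<le> ennreal (decay_const powr q * W powr q)"
proof -
  define a where "a = 1 - p / q"
  have a: "0 \<le> a" "a \<le> s * p / DIM('a)"
    using exponent_bounds[of 0 q] s q by (auto simp: a_def)
  have aq: "(1 - a) * q = p" "a * q = q - p" using q p by (auto simp: a_def field_simps)
  have "(\<integral>\<^sup>+x. ennreal (\<bar>u x\<bar> powr q) \<partial>lebesgue)
      \<le> (\<integral>\<^sup>+x. ennreal (decay_const powr q * W powr (q - p)) * ennreal (w x powr p) \<partial>lebesgue)"
  proof (rule nn_integral_mono_AE, use AE_lebesgue_not_negligible[OF Z] in eventually_elim)
    fix x assume x: "x \<notin> Z"
    have "\<bar>u x\<bar> powr q \<le> (decay_const * (w x powr (1 - a) * W powr a)) powr q"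
      using hedberg[OF x a] q p by (intro powr_mono2) auto
    also have "\<dots> = decay_const powr q * W powr (q - p) * w x powr p"
      using decay_const_ge_1 by (simp add: powr_mult powr_powr aq)
    finally show "ennreal (\<bar>u x\<bar> powr q) \<le> ennreal (decay_const powr q * W powr (q - p)) * ennreal (w x powr p)"
      by (simp add: ennreal_mult[symmetric] ennreal_leI)
  qed
  also have "\<dots> = ennreal (decay_const powr q * W powr (q - p)) * (\<integral>\<^sup>+x. ennreal (w x powr p) \<partial>lebesgue)"
    by (rule nn_integral_cmult) simp
  also have "\<dots> \<le> ennreal (decay_const powr q * W powr (q - p)) * ennreal (W powr p)"
    by (intro mult_left_mono w_norm) simp
  also have "\<dots> = ennreal (decay_const powr q * W powr q)"
    by (simp add: ennreal_mult[symmetric] powr_diff)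
  finally show ?thesis .
qed

text \<open>The power of \<open>2 * decay_const\<close> comes from the increments, the next 2 from
  the two end points, and the rest is the constant of \<open>nn_integral_min_powr\<close>.\<close>

definition seminorm_const :: "real \<Rightarrow> real \<Rightarrow> real" where
  "seminorm_const t q = (2 * decay_const) powr q * 2 * (2 ^ DIM('a) * unit_ball_vol DIM('a)
        * (1 / (1 - 2 powr (-((s - t) * q))) + 1 / (1 - 2 powr (-(t * q)))))"

text \<open>Which end point carries the larger \<open>w\<close> varies with the pair, so the maximum
  of the two contributions is estimated by their sum. Each summand is integrated first over the
  other end point, where its \<open>w\<close> is constant.\<close>

lemma seminorm_bound:
  fixes t q :: real
  assumes t: "0 < t" "t < s" and q: "p \<le> q" "q \<le> DIM('a) * p / (DIM('a) - (s - t) * p)"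
  shows "(\<integral>\<^sup>+(x, y). ennreal (\<bar>u x - u y\<bar> powr q / norm (x - y) powr (DIM('a) + t * q)) \<partial>(lebesgue \<Otimes>\<^sub>M lebesgue))
    \<le> ennreal (seminorm_const t q * W powr q)"
proof -
  let ?N = "real DIM('a)"
  define a where "a = (1 - p / q) * s / (s - t)"
  have a: "0 \<le> a" "a \<le> s * p / ?N"
    using exponent_bounds[of t q] t q by (auto simp: a_def)
  have q0: "0 < q" using p q by simp
  define F where "F x h = min (norm h powr s * w x) (w x powr (1 - a) * W powr a)" for x h :: 'a
  define V where "V = 2 ^ DIM('a) * unit_ball_vol DIM('a)
        * (1 / (1 - 2 powr (-((s - t) * q))) + 1 / (1 - 2 powr (-(t * q))))"
  have V: "0 \<le> V"
    unfolding V_def using t q0 by (intro mult_nonneg_nonneg add_nonneg_nonneg) (auto simp: powr_less_one less_imp_le)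
  have F_nonneg: "0 \<le> F x h" for x h by (simp add: F_def w_nonneg)
  have F_sym: "F x (- h) = F x h" for x h by (simp add: F_def)
  have F_le: "\<bar>u x - u y\<bar> \<le> 2 * decay_const * max (F x (x - y)) (F y (x - y))"
    if xy: "x \<notin> Z" "y \<notin> Z" "w x \<le> w y" for x y
  proof -
    \<comment> \<open>With a < 1 the function \<open>w powr (1 - a)\<close> increases with
      \<open>w\<close>; this allows passing to the end point with the larger
      \<open>w\<close>.\<close>
    have "s * p / ?N < 1" using sp by simp
    then have "a < 1" using a by linarith
    then have m: "w x powr (1 - a) \<le> w y powr (1 - a)"
      using xy w_nonneg by (intro powr_mono2) auto
    have "\<bar>u x - u y\<bar> \<le> norm (x - y) powr s * (w x + w y)" using osc xy by blast
    also have "\<dots> \<le> norm (x - y) powr s * (2 * w y)" using xy by (intro mult_left_mono) auto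
    also have "\<dots> \<le> decay_const * (norm (x - y) powr s * (2 * w y))"
      using mult_right_mono[OF decay_const_ge_1, of "norm (x - y) powr s * (2 * w y)"] w_nonneg[of y]
      by (simp only: mult_1_left) simp
    finally have 1: "\<bar>u x - u y\<bar> \<le> 2 * decay_const * (norm (x - y) powr s * w y)" by (simp add: mult_ac)
    have "\<bar>u x - u y\<bar> \<le> decay_const * (w x powr (1 - a) * W powr a) + decay_const * (w y powr (1 - a) * W powr a)"
      using hedberg[OF xy(1) a] hedberg[OF xy(2) a] by linarith
    also have "\<dots> \<le> decay_const * (w y powr (1 - a) * W powr a) + decay_const * (w y powr (1 - a) * W powr a)"
      using m decay_const_ge_1 by (intro add_right_mono mult_left_mono mult_right_mono) auto
    finally have 2: "\<bar>u x - u y\<bar> \<le> 2 * decay_const * (w y powr (1 - a) * W powr a)"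
      by (simp add: mult_ac)
    have "\<bar>u x - u y\<bar> \<le> 2 * decay_const * F y (x - y)"
      using 1 2 unfolding F_def by (simp add: min_def)
    also have "\<dots> \<le> 2 * decay_const * max (F x (x - y)) (F y (x - y))"
      using decay_const_ge_1 by (intro mult_left_mono) auto
    finally show ?thesis .
  qed
  have F_le': "\<bar>u x - u y\<bar> \<le> 2 * decay_const * max (F x (x - y)) (F y (x - y))"
    if "x \<notin> Z" "y \<notin> Z" for x y
  proof (cases "w x \<le> w y")
    case False
    then have "\<bar>u y - u x\<bar> \<le> 2 * decay_const * max (F y (y - x)) (F x (y - x))"
      using that by (intro F_le) auto
    then show ?thesis using F_sym[of x "x - y"] F_sym[of y "x - y"] by (simp add: abs_minus_commute max.commute)
  qed (use F_le that in auto)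
  define G where "G x h = ennreal (F x h powr q / norm h powr (?N + t * q))" for x h
  have G_sym: "G x (- h) = G x h" for x h by (simp add: G_def F_sym)
  \<comment> \<open>Forming x - y asks for Borel measurable coordinates, so the identity is regarded
    as a map from \<open>lebesgue\<close> to \<open>borel\<close>.\<close>
  have [measurable]: "(\<lambda>x. x) \<in> lebesgue \<rightarrow>\<^sub>M (borel :: 'a measure)" by (rule measurable_completion) simp
  have G_meas: "(\<lambda>(x, y). G x (x - y)) \<in> borel_measurable (lebesgue \<Otimes>\<^sub>M lebesgue)"
    unfolding G_def F_def split_beta by measurable
  have G_meas': "(\<lambda>(x, y). G y (x - y)) \<in> borel_measurable (lebesgue \<Otimes>\<^sub>M lebesgue)"
    unfolding G_def F_def split_beta by measurable
  have inner: "(\<integral>\<^sup>+y. G x (x - y) \<partial>lebesgue) \<le> ennreal (V * W powr (q - p)) * ennreal (w x powr p)" for x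
  proof -
    \<comment> \<open>Translation invariance is applied to \<open>lborel\<close>; the integrals with
      respect to its completion agree.\<close>
    have "(\<integral>\<^sup>+y. G x (x - y) \<partial>lebesgue) = (\<integral>\<^sup>+y. G x (x - y) \<partial>lborel)"
      by (simp add: nn_integral_completion)
    also have "\<dots> = (\<integral>\<^sup>+h. G x h \<partial>lborel)"
    proof -
      have "(\<integral>\<^sup>+h. G x h \<partial>lborel) = (\<integral>\<^sup>+h. G x (- h) \<partial>lborel)" by (simp add: G_sym)
      also have "\<dots> = (\<integral>\<^sup>+h. G x (- h) \<partial>distr lborel borel ((+) (- x)))"
        by (simp add: lborel_distr_plus)
      also have "\<dots> = (\<integral>\<^sup>+y. G x (- (- x + y)) \<partial>lborel)"
        unfolding G_def F_def by (subst nn_integral_distr) auto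
      finally show ?thesis by simp
    qed
    also have "\<dots> = (\<integral>\<^sup>+h. G x h \<partial>lebesgue)" by (simp add: nn_integral_completion)
    also have "\<dots> \<le> ennreal (V * (w x powr p * W powr (q - p)))"
      unfolding G_def F_def V_def
      by (rule nn_integral_min_powr) (use s t p q W w_nonneg a_def in auto)
    finally show ?thesis using V by (simp add: ennreal_mult[symmetric] mult_ac)
  qed
  have total: "(\<integral>\<^sup>+x. \<integral>\<^sup>+y. G x (x - y) \<partial>lebesgue \<partial>lebesgue) \<le> ennreal (V * W powr q)"
  proof -
    have "(\<integral>\<^sup>+x. \<integral>\<^sup>+y. G x (x - y) \<partial>lebesgue \<partial>lebesgue)
        \<le> (\<integral>\<^sup>+x. ennreal (V * W powr (q - p)) * ennreal (w x powr p) \<partial>lebesgue)"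
      by (intro nn_integral_mono inner)
    also have "\<dots> = ennreal (V * W powr (q - p)) * (\<integral>\<^sup>+x. ennreal (w x powr p) \<partial>lebesgue)"
      by (rule nn_integral_cmult) simp
    also have "\<dots> \<le> ennreal (V * W powr (q - p)) * ennreal (W powr p)"
      by (intro mult_left_mono w_norm) simp
    also have "\<dots> = ennreal (V * W powr q)"
      using V by (simp add: ennreal_mult[symmetric] powr_diff)
    finally show ?thesis .
  qed
  have G1: "(\<integral>\<^sup>+(x, y). G x (x - y) \<partial>(lebesgue \<Otimes>\<^sub>M lebesgue)) \<le> ennreal (V * W powr q)"
    using total lebesgue.nn_integral_fst[OF G_meas] by simp
  have G2: "(\<integral>\<^sup>+(x, y). G y (x - y) \<partial>(lebesgue \<Otimes>\<^sub>M lebesgue)) \<le> ennreal (V * W powr q)"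
  proof -
    have "(\<integral>\<^sup>+x. G y (x - y) \<partial>lebesgue) = (\<integral>\<^sup>+x. G y (y - x) \<partial>lebesgue)" for y
      using G_sym[of y "_ - y"] by simp
    then show ?thesis using total lebesgue_pair.nn_integral_snd[OF G_meas'] by simp
  qed
  \<comment> \<open>The set \<open>Z\<close> is measurable for \<open>lebesgue\<close>, so both
    strips over it are measurable rectangles, of measure 0 because 0 times \<infinity> is 0.\<close>
  have ae: "AE z in lebesgue \<Otimes>\<^sub>M lebesgue. fst z \<notin> Z \<and> snd z \<notin> (Z :: 'a set)"
  proof -
    have "Z \<times> UNIV \<in> null_sets (lebesgue \<Otimes>\<^sub>M (lebesgue :: 'a measure))"
      "UNIV \<times> Z \<in> null_sets ((lebesgue :: 'a measure) \<Otimes>\<^sub>M lebesgue)"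
      using Z by (auto simp: null_sets_def negligible_iff_null_sets lebesgue.emeasure_pair_measure_Times
          intro!: pair_measureI)
    then show ?thesis by (auto dest!: AE_not_in)
  qed
  have "(\<integral>\<^sup>+(x, y). ennreal (\<bar>u x - u y\<bar> powr q / norm (x - y) powr (?N + t * q)) \<partial>(lebesgue \<Otimes>\<^sub>M lebesgue))
      \<le> (\<integral>\<^sup>+z. ennreal ((2 * decay_const) powr q) * ((case z of (x, y) \<Rightarrow> G x (x - y))
           + (case z of (x, y) \<Rightarrow> G y (x - y))) \<partial>(lebesgue \<Otimes>\<^sub>M lebesgue))"
  proof (rule nn_integral_mono_AE, use ae in eventually_elim)
    fix z assume z: "fst z \<notin> Z \<and> snd z \<notin> Z"
    obtain x y where xy: "z = (x, y)" by (cases z)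
    have "\<bar>u x - u y\<bar> powr q \<le> (2 * decay_const * max (F x (x - y)) (F y (x - y))) powr q"
      using F_le' z xy q0 by (intro powr_mono2) auto
    also have "\<dots> = (2 * decay_const) powr q * max (F x (x - y)) (F y (x - y)) powr q"
      by (rule powr_mult)
    also have "\<dots> \<le> (2 * decay_const) powr q * (F x (x - y) powr q + F y (x - y) powr q)"
      by (intro mult_left_mono) (auto simp: max_def)
    finally have "\<bar>u x - u y\<bar> powr q / norm (x - y) powr (?N + t * q)
        \<le> (2 * decay_const) powr q * (F x (x - y) powr q + F y (x - y) powr q) / norm (x - y) powr (?N + t * q)"
      by (rule divide_right_mono) simp
    then show "(case z of (x, y) \<Rightarrow> ennreal (\<bar>u x - u y\<bar> powr q / norm (x - y) powr (?N + t * q)))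
      \<le> ennreal ((2 * decay_const) powr q) * ((case z of (x, y) \<Rightarrow> G x (x - y))
           + (case z of (x, y) \<Rightarrow> G y (x - y)))"
      unfolding xy G_def by (simp add: ennreal_mult[symmetric] ennreal_plus[symmetric] ennreal_leI add_divide_distrib
          distrib_left del: ennreal_plus)
  qed
  also have "\<dots> = ennreal ((2 * decay_const) powr q) * ((\<integral>\<^sup>+(x, y). G x (x - y) \<partial>(lebesgue \<Otimes>\<^sub>M lebesgue))
      + (\<integral>\<^sup>+(x, y). G y (x - y) \<partial>(lebesgue \<Otimes>\<^sub>M lebesgue)))"
    by (subst nn_integral_cmult, use G_meas G_meas' in simp, subst nn_integral_add)
      (use G_meas G_meas' in auto)
  also have "\<dots> \<le> ennreal ((2 * decay_const) powr q) * (ennreal (V * W powr q) + ennreal (V * W powr q))"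
    by (intro mult_left_mono add_mono G1 G2) auto
  also have "\<dots> = ennreal (seminorm_const t q * W powr q)"
    using V unfolding seminorm_const_def V_def[symmetric]
    by (simp add: ennreal_mult[symmetric] ennreal_plus[symmetric] mult_ac del: ennreal_plus)
  finally show ?thesis .
qed

end

section \<open>The maximal function\<close>

text \<open>The uncentred maximal function. Balls that merely contain \<open>x\<close> make the
  superlevel sets open, hence it is Borel measurable for every \<open>f\<close>, and they
  accommodate the off-centre balls met along a path. The condition \<open>dist y x < r\<close> also
  makes the radius positive.\<close>

definition maximal :: "('a::euclidean_space \<Rightarrow> ennreal) \<Rightarrow> 'a \<Rightarrow> ennreal" where
  "maximal f x = (SUP (y, r) \<in> {(y, r). dist y x < r}.
     ennreal (1 / measure lebesgue (ball y r)) * (\<integral>\<^sup>+z. f z * indicator (ball y r) z \<partial>lebesgue))"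

lemma ennreal_less_inverse_mult_iff:
  assumes "0 < m" "0 \<le> c"
  shows "ennreal c < ennreal (1 / m) * I \<longleftrightarrow> ennreal (c * m) < I"
proof (cases I)
  case (real b)
  then show ?thesis
    using assms by (simp add: ennreal_mult[symmetric] ennreal_less_iff field_simps)
next
  case top
  then show ?thesis using assms by (simp add: ennreal_mult_top)
qed

lemma measure_ball_pos: "0 < r \<Longrightarrow> 0 < measure lebesgue (ball (x::'a::euclidean_space) r)"
  by (simp add: content_ball_pos)

lemma less_maximal_iff:
  assumes "0 \<le> c"
  shows "ennreal c < maximal f x \<longleftrightarrow> (\<exists>y r. dist y x < r \<and>
     ennreal (c * measure lebesgue (ball y r)) < (\<integral>\<^sup>+z. f z * indicator (ball y r) z \<partial>lebesgue))"
proof -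
  have "ennreal c < ennreal (1 / measure lebesgue (ball y r)) * I
      \<longleftrightarrow> ennreal (c * measure lebesgue (ball y r)) < I" if "dist y x < r" for y :: 'a and r I
    by (rule ennreal_less_inverse_mult_iff[OF measure_ball_pos assms])
      (use that in \<open>meson dist_not_less_zero le_less_trans not_less\<close>)
  then show ?thesis
    unfolding maximal_def less_SUP_iff Bex_def split_paired_Ex
    by (simp cong: conj_cong)
qed

lemma nn_integral_ball_le_maximal:
  assumes "dist y x < r"
  shows "(\<integral>\<^sup>+z. f z * indicator (ball y r) z \<partial>lebesgue)
    \<le> ennreal (measure lebesgue (ball y r)) * maximal f x"
proof -
  have m: "0 < measure lebesgue (ball y r)"
    using assms by (intro measure_ball_pos) (meson dist_not_less_zero le_less_trans not_less)
  have "ennreal (1 / measure lebesgue (ball y r)) * (\<integral>\<^sup>+z. f z * indicator (ball y r) z \<partial>lebesgue) \<le> maximal f x"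
    unfolding maximal_def by (rule SUP_upper2[of "(y, r)"]) (use assms in auto)
  then have "ennreal (measure lebesgue (ball y r)) * (ennreal (1 / measure lebesgue (ball y r))
      * (\<integral>\<^sup>+z. f z * indicator (ball y r) z \<partial>lebesgue)) \<le> ennreal (measure lebesgue (ball y r)) * maximal f x"
    by (intro mult_left_mono) auto
  then show ?thesis
    using m by (simp add: mult.assoc[symmetric] ennreal_mult[symmetric])
qed

lemma open_maximal_gt: "open {x. c < maximal f x}"
proof (rule openI)
  fix x assume "x \<in> {x. c < maximal f x}"
  then obtain y r where yr: "dist y x < r"
    and c: "c < ennreal (1 / measure lebesgue (ball y r)) * (\<integral>\<^sup>+z. f z * indicator (ball y r) z \<partial>lebesgue)"
    by (auto simp: maximal_def less_SUP_iff)
  have "c < maximal f x'" if "dist y x' < r" for x'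
    unfolding maximal_def using that c by (auto simp: less_SUP_iff)
  then have "ball y r \<subseteq> {x. c < maximal f x}" by auto
  then show "\<exists>e>0. ball x e \<subseteq> {x. c < maximal f x}"
    using yr openE[OF open_ball, of x y r] by (metis dual_order.trans mem_ball)
qed

lemma borel_measurable_maximal [measurable]: "maximal f \<in> borel_measurable borel"
  by (rule borel_measurableI_greater) (simp add: open_maximal_gt borel_open)

text \<open>Writing the sum as an integral over a counting measure suits the unordered countable
  subfamily delivered by the Vitali covering lemma.\<close>

lemma emeasure_UN_subadditive_countable:
  assumes "countable I" and [measurable]: "\<And>i. i \<in> I \<Longrightarrow> X i \<in> sets M"
  shows "emeasure M (\<Union>i\<in>I. X i) \<le> (\<integral>\<^sup>+i. emeasure M (X i) \<partial>count_space I)"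
proof -
  have "emeasure M (\<Union>i\<in>I. X i) = (\<integral>\<^sup>+x. indicator (\<Union>i\<in>I. X i) x \<partial>M)"
    using assms by (intro nn_integral_indicator[symmetric] sets.countable_UN'') auto
  also have "\<dots> \<le> (\<integral>\<^sup>+x. \<integral>\<^sup>+i. indicator (X i) x \<partial>count_space I \<partial>M)"
  proof (rule nn_integral_mono)
    fix x
    show "indicator (\<Union>i\<in>I. X i) x \<le> (\<integral>\<^sup>+i. indicator (X i) x \<partial>count_space I)"
    proof (cases "x \<in> (\<Union>i\<in>I. X i)")
      case True
      then obtain i where i: "i \<in> I" "x \<in> X i" by auto
      have "1 = (\<integral>\<^sup>+j. indicator {i} j \<partial>count_space I)"
        using i by (subst nn_integral_indicator) auto
      also have "\<dots> \<le> (\<integral>\<^sup>+i. indicator (X i) x \<partial>count_space I)"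
        using i by (intro nn_integral_mono) (auto simp: indicator_def)
      finally show ?thesis using True by simp
    qed simp
  qed
  also have "\<dots> = (\<integral>\<^sup>+i. \<integral>\<^sup>+x. indicator (X i) x \<partial>M \<partial>count_space I)"
    by (rule nn_integral_count_space_nn_integral) (use assms in auto)
  also have "\<dots> = (\<integral>\<^sup>+i. emeasure M (X i) \<partial>count_space I)"
    by (intro nn_integral_cong) simp
  finally show ?thesis .
qed

text \<open>Vitali's argument: every point of the superlevel set lies in a ball on which the
  integral of \<open>f\<close> exceeds \<open>c\<close> times the volume. A disjoint subfamily still
  covers the set after enlargement by 5, and its total volume is at most the integral of
  \<open>f\<close> divided by \<open>c\<close>.\<close>

lemma maximal_weak_type:
  fixes f :: "'a::euclidean_space \<Rightarrow> ennreal"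
  assumes f [measurable]: "f \<in> borel_measurable lebesgue" and c: "0 < c"
  shows "emeasure lebesgue {x. ennreal c < maximal f x} \<le> ennreal (5 ^ DIM('a) / c) * (\<integral>\<^sup>+x. f x \<partial>lebesgue)"
proof (cases "\<integral>\<^sup>+x. f x \<partial>lebesgue")
  case top
  then show ?thesis using c by (simp add: ennreal_mult_top)
next
  case (real I)
  let ?v = "unit_ball_vol (real DIM('a))" and ?N = "DIM('a)"
  have v: "0 < ?v" by simp
  let ?K = "{i::'a \<times> real. 0 < snd i \<and> ennreal (c * measure lebesgue (ball (fst i) (snd i)))
     < (\<integral>\<^sup>+z. f z * indicator (ball (fst i) (snd i)) z \<partial>lebesgue)}"
  have sub: "{x. ennreal c < maximal f x} \<subseteq> (\<Union>i\<in>?K. ball (fst i) (snd i))"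
  proof
    fix x assume "x \<in> {x. ennreal c < maximal f x}"
    then obtain y r where yr: "dist y x < r" "ennreal (c * measure lebesgue (ball y r))
        < (\<integral>\<^sup>+z. f z * indicator (ball y r) z \<partial>lebesgue)"
      using c by (auto simp: less_maximal_iff)
    moreover have "0 < r" using yr(1) by (meson dist_not_less_zero le_less_trans not_less)
    ultimately show "x \<in> (\<Union>i\<in>?K. ball (fst i) (snd i))"
      by (intro UN_I[of "(y, r)"]) auto
  qed
  \<comment> \<open>The covering lemma asks for bounded radii. Finiteness of the integral bounds
    r^N, which bounds r itself only when r > 1; hence the maximum with 1.\<close>
  have rad: "0 < snd i \<and> snd i \<le> max 1 (I / (c * ?v))" if i: "i \<in> ?K" for i
  proof -
    define r where "r = snd i"
    have r: "0 < r" using i by (simp add: r_def)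
    have "(\<integral>\<^sup>+z. f z * indicator (ball (fst i) r) z \<partial>lebesgue) \<le> (\<integral>\<^sup>+z. f z \<partial>lebesgue)"
      by (intro nn_integral_mono) (auto simp: indicator_def)
    moreover have "ennreal (c * measure lebesgue (ball (fst i) r))
        < (\<integral>\<^sup>+z. f z * indicator (ball (fst i) r) z \<partial>lebesgue)"
      using i unfolding r_def by blast
    ultimately have "ennreal (c * measure lebesgue (ball (fst i) r)) < ennreal I"
      unfolding real(2) by (rule less_le_trans[rotated])
    then have "c * (?v * r ^ ?N) \<le> I"
      using real(1) c r by (simp add: ennreal_less_iff content_ball)
    then have le: "r ^ ?N \<le> I / (c * ?v)" using c v by (simp add: field_simps)
    have "r \<le> max 1 (I / (c * ?v))"
    proof (cases "r \<le> 1")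
      case False
      then have "r ^ 1 \<le> r ^ ?N" by (intro power_increasing) auto
      with le show ?thesis by simp
    qed simp
    with r show ?thesis by (simp add: r_def)
  qed
  obtain C where C: "countable C" "C \<subseteq> ?K"
     "pairwise (\<lambda>i j. disjnt (ball (fst i) (snd i)) (ball (fst j) (snd j))) C"
     "{x. ennreal c < maximal f x} \<subseteq> (\<Union>i\<in>C. ball (fst i) (5 * snd i))"
    using Vitali_covering_lemma_balls[OF sub rad] by blast
  have [measurable]: "ball x r \<in> sets lebesgue" for x :: 'a and r by simp
  define B where "B i = ball (fst i) (snd i)" for i :: "'a \<times> real"
  \<comment> \<open>As a measure, the integral of \<open>f\<close> is additive over the disjoint
    balls and at most its total mass.\<close>
  define \<nu> where "\<nu> = density lebesgue f"
  have \<nu>: "emeasure \<nu> (B i) = (\<integral>\<^sup>+z. f z * indicator (B i) z \<partial>lebesgue)" for i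
    unfolding \<nu>_def B_def by (rule emeasure_density) auto
  have "emeasure lebesgue {x. ennreal c < maximal f x} \<le> emeasure lebesgue (\<Union>i\<in>C. ball (fst i) (5 * snd i))"
    by (rule emeasure_mono[OF C(4)]) (use C(1) in \<open>intro sets.countable_UN''; simp\<close>)
  also have "\<dots> \<le> (\<integral>\<^sup>+i. emeasure lebesgue (ball (fst i) (5 * snd i)) \<partial>count_space C)"
    by (rule emeasure_UN_subadditive_countable[OF C(1)]) simp
  also have "\<dots> \<le> (\<integral>\<^sup>+i. ennreal (5 ^ ?N / c) * emeasure \<nu> (B i) \<partial>count_space C)"
  proof (rule nn_integral_mono)
    fix i assume "i \<in> space (count_space C)"
    then have i: "i \<in> ?K" using C(2) by auto
    then have r: "0 < snd i" by simp
    have "emeasure lebesgue (ball (fst i) (5 * snd i)) = ennreal (5 ^ ?N / c) * ennreal (c * measure lebesgue (ball (fst i) (snd i)))"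
      using r c by (simp add: emeasure_lebesgue_ball emeasure_ball content_ball ennreal_mult[symmetric] power_mult_distrib mult_ac)
    also have "\<dots> \<le> ennreal (5 ^ ?N / c) * emeasure \<nu> (B i)"
    proof (rule mult_left_mono)
      have "emeasure \<nu> (B i) = (\<integral>\<^sup>+z. f z * indicator (ball (fst i) (snd i)) z \<partial>lebesgue)"
        unfolding \<nu> unfolding B_def by (rule refl)
      then show "ennreal (c * measure lebesgue (ball (fst i) (snd i))) \<le> emeasure \<nu> (B i)"
        using i by (auto intro: less_imp_le)
    qed simp
    finally show "emeasure lebesgue (ball (fst i) (5 * snd i)) \<le> ennreal (5 ^ ?N / c) * emeasure \<nu> (B i)" .
  qed
  also have "\<dots> = ennreal (5 ^ ?N / c) * (\<integral>\<^sup>+i. emeasure \<nu> (B i) \<partial>count_space C)"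
    by (rule nn_integral_cmult) simp
  also have "(\<integral>\<^sup>+i. emeasure \<nu> (B i) \<partial>count_space C) = emeasure \<nu> (\<Union>i\<in>C. B i)"
  proof (rule emeasure_UN_countable[symmetric])
    show "disjoint_family_on B C"
      using C(3) by (auto simp: disjoint_family_on_def pairwise_def disjnt_def B_def)
  qed (use C in \<open>auto simp: \<nu>_def B_def\<close>)
  also have "\<dots> \<le> emeasure \<nu> (space \<nu>)" by (rule emeasure_space)
  also have "\<dots> = (\<integral>\<^sup>+x. f x \<partial>lebesgue)"
    unfolding \<nu>_def by (subst emeasure_density) auto
  finally show ?thesis by (simp add: mult_left_mono)
qed

text \<open>Values of \<open>f\<close> up to c / 2 contribute at most c / 2 to any average, so an
  average above c leaves more than c / 2 to the larger values. The weak-type bound can thus be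
  applied, at each height, to a truncation adapted to that height.\<close>

lemma maximal_gt_subset_truncation:
  assumes c: "0 < c" and f [measurable]: "f \<in> borel_measurable lebesgue" and f_nonneg: "\<And>x. 0 \<le> f x"
  shows "{x. ennreal c < maximal (\<lambda>x. ennreal (f x)) x}
    \<subseteq> {x. ennreal (c / 2) < maximal (\<lambda>x. ennreal (f x) * indicator {x. c / 2 < f x} x) x}"
proof
  fix x assume "x \<in> {x. ennreal c < maximal (\<lambda>x. ennreal (f x)) x}"
  then obtain y r where yr: "dist y x < r" "ennreal (c * measure lebesgue (ball y r))
      < (\<integral>\<^sup>+z. ennreal (f z) * indicator (ball y r) z \<partial>lebesgue)"
    using c by (auto simp: less_maximal_iff)
  define m where "m = measure lebesgue (ball y r)"
  have r: "0 < r" using yr(1) by (meson dist_not_less_zero le_less_trans not_less)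
  have [measurable]: "ball y r \<in> sets lebesgue" by simp
  have [measurable]: "{x. c / 2 < f x} \<in> sets lebesgue"
    using borel_measurable_less[OF borel_measurable_const f, of "c / 2"] by simp
  have "ennreal (c / 2 * m) + ennreal (c / 2 * m) = ennreal (c * m)"
    using c by (simp add: ennreal_plus[symmetric] m_def del: ennreal_plus)
  also have "\<dots> < (\<integral>\<^sup>+z. ennreal (f z) * indicator (ball y r) z \<partial>lebesgue)" using yr(2) by (simp add: m_def)
  also have "\<dots> \<le> (\<integral>\<^sup>+z. ennreal (c / 2) * indicator (ball y r) z
      + ennreal (f z) * indicator {x. c / 2 < f x} z * indicator (ball y r) z \<partial>lebesgue)"
    by (intro nn_integral_mono) (auto simp: indicator_def not_less ennreal_leI)
  also have "\<dots> = ennreal (c / 2 * m) + (\<integral>\<^sup>+z. ennreal (f z) * indicator {x. c / 2 < f x} z * indicator (ball y r) z \<partial>lebesgue)"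
    using c r by (subst nn_integral_add) (measurable, simp add: nn_integral_cmult_ball m_def content_ball)
  finally have "ennreal (c / 2 * m) < (\<integral>\<^sup>+z. ennreal (f z) * indicator {x. c / 2 < f x} z * indicator (ball y r) z \<partial>lebesgue)"
    using add_left_mono[of _ "ennreal (c / 2 * m)" "ennreal (c / 2 * m)"] by (auto simp: not_less[symmetric])
  then show "x \<in> {x. ennreal (c / 2) < maximal (\<lambda>x. ennreal (f x) * indicator {x. c / 2 < f x} x) x}"
    using yr(1) c by (auto simp: less_maximal_iff m_def)
qed

lemma nn_integral_powr_Ioo:
  fixes a \<beta> :: real
  assumes "-1 < \<beta>" "0 \<le> a"
  shows "(\<integral>\<^sup>+x. ennreal (x powr \<beta>) * indicator {0<..<a} x \<partial>lborel) = ennreal (a powr (\<beta> + 1) / (\<beta> + 1))"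
proof -
  have "((\<lambda>x. x powr \<beta>) has_integral (a powr (\<beta> + 1) / (\<beta> + 1))) {0<..<a}"
    using has_integral_powr_from_0[OF assms] by (simp add: has_integral_Icc_iff_Ioo)
  then have "((\<lambda>x. if x \<in> {0<..<a} then x powr \<beta> else 0) has_integral (a powr (\<beta> + 1) / (\<beta> + 1))) UNIV"
    by (subst has_integral_restrict_UNIV)
  then have "(\<integral>\<^sup>+x. ennreal (if x \<in> {0<..<a} then x powr \<beta> else 0) \<partial>lborel) = ennreal (a powr (\<beta> + 1) / (\<beta> + 1))"
    by (intro nn_integral_has_integral_lborel) auto
  moreover have "ennreal (x powr \<beta>) * indicator {0<..<a} x = ennreal (if x \<in> {0<..<a} then x powr \<beta> else 0)" for x
    by auto
  ultimately show ?thesis by (simp only:)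
qed

text \<open>The layer-cake formula for a p-th power, stated for extended values because a maximal
  function may be infinite. If m = \<infinity>, the integral is at least every natural
  number.\<close>

lemma nn_integral_layer_cake:
  fixes p :: real and m :: ennreal
  assumes p: "0 < p"
  shows "(\<integral>\<^sup>+c. ennreal (p * c powr (p - 1)) * indicator {c. 0 < c \<and> ennreal c < m} c \<partial>lborel)
    = (if m = \<infinity> then \<infinity> else ennreal (enn2real m powr p))"
proof -
  have fin: "(\<integral>\<^sup>+c. ennreal (p * c powr (p - 1)) * indicator {c. 0 < c \<and> ennreal c < ennreal a} c \<partial>lborel)
      = ennreal (a powr p)" if a: "0 \<le> a" for a
  proof -
    have "(\<integral>\<^sup>+c. ennreal (p * c powr (p - 1)) * indicator {c. 0 < c \<and> ennreal c < ennreal a} c \<partial>lborel)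
       = (\<integral>\<^sup>+c. ennreal p * (ennreal (c powr (p - 1)) * indicator {0<..<a} c) \<partial>lborel)"
      using p by (intro nn_integral_cong) (auto simp: indicator_def ennreal_mult ennreal_less_iff)
    also have "\<dots> = ennreal p * ennreal (a powr (p - 1 + 1) / (p - 1 + 1))"
      using p a by (subst nn_integral_cmult) (auto simp: nn_integral_powr_Ioo)
    also have "\<dots> = ennreal (a powr p)" using p by (simp add: ennreal_mult[symmetric])
    finally show ?thesis .
  qed
  show ?thesis
  proof (cases m)
    case (real a)
    then show ?thesis using fin[of a] by simp
  next
    case top
    have "ennreal (real n) \<le> (\<integral>\<^sup>+c. ennreal (p * c powr (p - 1)) * indicator {c. 0 < c \<and> ennreal c < m} c \<partial>lborel)" for n
    proof -
      have "ennreal (real n) = ennreal ((real n powr (1 / p)) powr p)" using p by (simp add: powr_powr)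
      also have "\<dots> = (\<integral>\<^sup>+c. ennreal (p * c powr (p - 1)) * indicator {c. 0 < c \<and> ennreal c < ennreal (real n powr (1 / p))} c \<partial>lborel)"
        by (rule fin[symmetric]) simp
      also have "\<dots> \<le> (\<integral>\<^sup>+c. ennreal (p * c powr (p - 1)) * indicator {c. 0 < c \<and> ennreal c < m} c \<partial>lborel)"
        using top by (intro nn_integral_mono) (auto simp: indicator_def)
      finally show ?thesis .
    qed
    then have "(\<integral>\<^sup>+c. ennreal (p * c powr (p - 1)) * indicator {c. 0 < c \<and> ennreal c < m} c \<partial>lborel) = \<infinity>"
      by (metis ennreal_Ex_less_of_nat ennreal_of_nat_eq_real_of_nat infinity_ennreal_def leD top.not_eq_extremum)
    then show ?thesis using top by simp
  qed
qed

text \<open>Marcinkiewicz interpolation between the weak bound on L^1 and the trivial bound on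
  L^\<infinity>. After exchanging the integrals, the inner one is that of c^(p - 2) over 0 < c < 2 f
  x, which converges at 0 because p > 1; it produces the factor 1 / (p - 1).\<close>

lemma maximal_strong_type:
  fixes f :: "'a::euclidean_space \<Rightarrow> real" and p :: real
  assumes f [measurable]: "f \<in> borel_measurable lebesgue" and f_nonneg: "\<And>x. 0 \<le> f x" and p: "1 < p"
  defines "M \<equiv> maximal (\<lambda>x. ennreal (f x))"
  shows "(\<integral>\<^sup>+x. (if M x = \<infinity> then \<infinity> else ennreal (enn2real (M x) powr p)) \<partial>lebesgue)
    \<le> ennreal (5 ^ DIM('a) * p * 2 powr p / (p - 1)) * (\<integral>\<^sup>+x. ennreal (f x powr p) \<partial>lebesgue)"
proof -
  interpret pair_sigma_finite "lebesgue :: 'a measure" "lborel :: real measure" ..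
  have M_borel [measurable]: "M \<in> borel_measurable lebesgue"
    unfolding M_def by (rule measurable_completion) simp
  have gt [measurable]: "{x. ennreal c < M x} \<in> sets lebesgue" for c
    using borel_measurable_less[OF borel_measurable_const M_borel] by simp
  have [measurable]: "{x. c < f x} \<in> sets lebesgue" for c
    using borel_measurable_less[OF borel_measurable_const f] by simp
  \<comment> \<open>Exchanging the integrals asks for joint measurability, so the indicators are
    rewritten as indicators of measurable sets in the product.\<close>
  have ind: "(indicator {c. 0 < c \<and> ennreal c < M x} c :: ennreal) = indicator {z \<in> space (lebesgue \<Otimes>\<^sub>M lborel). 0 < snd z \<and> ennreal (snd z) < M (fst z)} (x, c)" for x c
    by (simp add: indicator_def space_pair_measure)
  have ind2: "(indicator {x. c / 2 < f x} x * indicator {0<..} c :: ennreal)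
     = indicator {z \<in> space (lebesgue \<Otimes>\<^sub>M lborel). 0 < snd z \<and> snd z / 2 < f (fst z)} (x, c)" for x c
    by (auto simp: indicator_def space_pair_measure)
  let ?A = "5 ^ DIM('a) * 2 * p"
  have "(\<integral>\<^sup>+x. (if M x = \<infinity> then \<infinity> else ennreal (enn2real (M x) powr p)) \<partial>lebesgue)
     = (\<integral>\<^sup>+x. \<integral>\<^sup>+c. ennreal (p * c powr (p - 1)) * indicator {c. 0 < c \<and> ennreal c < M x} c \<partial>lborel \<partial>lebesgue)"
    using p by (simp add: nn_integral_layer_cake)
  also have "\<dots> = (\<integral>\<^sup>+c. \<integral>\<^sup>+x. ennreal (p * c powr (p - 1)) * indicator {c. 0 < c \<and> ennreal c < M x} c \<partial>lebesgue \<partial>lborel)"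
    unfolding ind by (rule Fubini'[symmetric]) measurable
  also have "\<dots> \<le> (\<integral>\<^sup>+c. \<integral>\<^sup>+x. ennreal (?A * c powr (p - 2)) * (ennreal (f x) * (indicator {x. c / 2 < f x} x * indicator {0<..} c)) \<partial>lebesgue \<partial>lborel)"
  proof (rule nn_integral_mono)
    fix c :: real
    show "(\<integral>\<^sup>+x. ennreal (p * c powr (p - 1)) * indicator {c. 0 < c \<and> ennreal c < M x} c \<partial>lebesgue)
      \<le> (\<integral>\<^sup>+x. ennreal (?A * c powr (p - 2)) * (ennreal (f x) * (indicator {x. c / 2 < f x} x * indicator {0<..} c)) \<partial>lebesgue)"
    proof (cases "0 < c")
      case True
      have "(\<integral>\<^sup>+x. ennreal (p * c powr (p - 1)) * indicator {c. 0 < c \<and> ennreal c < M x} c \<partial>lebesgue)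
         = (\<integral>\<^sup>+x. ennreal (p * c powr (p - 1)) * indicator {x. ennreal c < M x} x \<partial>lebesgue)"
        using True by (intro nn_integral_cong) (auto simp: indicator_def)
      also have "\<dots> = ennreal (p * c powr (p - 1)) * emeasure lebesgue {x. ennreal c < M x}"
        by (rule nn_integral_cmult_indicator) simp
      also have "\<dots> \<le> ennreal (p * c powr (p - 1)) * (ennreal (5 ^ DIM('a) / (c / 2))
          * (\<integral>\<^sup>+x. ennreal (f x) * indicator {x. c / 2 < f x} x \<partial>lebesgue))"
      proof (rule mult_left_mono)
        have "emeasure lebesgue {x. ennreal c < M x}
            \<le> emeasure lebesgue {x. ennreal (c / 2) < maximal (\<lambda>x. ennreal (f x) * indicator {x. c / 2 < f x} x) x}"
          unfolding M_def using True
          by (intro emeasure_mono maximal_gt_subset_truncation f f_nonneg sets_completionI_sets)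
             (simp_all add: open_maximal_gt borel_open)
        also have "\<dots> \<le> ennreal (5 ^ DIM('a) / (c / 2)) * (\<integral>\<^sup>+x. ennreal (f x) * indicator {x. c / 2 < f x} x \<partial>lebesgue)"
          using True by (intro maximal_weak_type) auto
        finally show "emeasure lebesgue {x. ennreal c < M x} \<le> \<dots>" .
      qed simp
      also have "\<dots> = ennreal (?A * c powr (p - 2)) * (\<integral>\<^sup>+x. ennreal (f x) * indicator {x. c / 2 < f x} x \<partial>lebesgue)"
      proof -
        have "c powr (p - 2) = c powr (p - 1) / c"
          using True powr_diff[of c "p - 1" 1] by simp
        then have "p * c powr (p - 1) * (5 ^ DIM('a) / (c / 2)) = ?A * c powr (p - 2)"
          using True by simp
        then show ?thesis
          using p True by (simp add: mult.assoc[symmetric] ennreal_mult[symmetric])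
      qed
      also have "\<dots> = (\<integral>\<^sup>+x. ennreal (?A * c powr (p - 2)) * (ennreal (f x) * indicator {x. c / 2 < f x} x) \<partial>lebesgue)"
        by (rule nn_integral_cmult[symmetric]) simp
      finally show ?thesis using True by simp
    qed simp
  qed
  also have "\<dots> = (\<integral>\<^sup>+x. \<integral>\<^sup>+c. ennreal (?A * c powr (p - 2)) * (ennreal (f x) * (indicator {x. c / 2 < f x} x * indicator {0<..} c)) \<partial>lborel \<partial>lebesgue)"
    unfolding ind2 by (rule Fubini') measurable
  also have "\<dots> = (\<integral>\<^sup>+x. ennreal (5 ^ DIM('a) * p * 2 powr p / (p - 1)) * ennreal (f x powr p) \<partial>lebesgue)"
  proof (rule nn_integral_cong)
    fix x
    have "(\<integral>\<^sup>+c. ennreal (?A * c powr (p - 2)) * (ennreal (f x) * (indicator {x. c / 2 < f x} x * indicator {0<..} c)) \<partial>lborel)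
      = (\<integral>\<^sup>+c. ennreal (?A * f x) * (ennreal (c powr (p - 2)) * indicator {0<..<2 * f x} c) \<partial>lborel)"
      using p f_nonneg[of x] by (intro nn_integral_cong) (auto simp: indicator_def ennreal_mult[symmetric] mult_ac)
    also have "\<dots> = ennreal (?A * f x) * ennreal ((2 * f x) powr (p - 2 + 1) / (p - 2 + 1))"
      using p f_nonneg[of x] by (subst nn_integral_cmult) (auto simp: nn_integral_powr_Ioo)
    also have "\<dots> = ennreal (?A * f x * ((2 * f x) powr (p - 1) / (p - 1)))"
      using p f_nonneg[of x] by (subst ennreal_mult) (auto simp: algebra_simps)
    also have "?A * f x * ((2 * f x) powr (p - 1) / (p - 1)) = 5 ^ DIM('a) * p / (p - 1) * (2 * f x * (2 * f x) powr (p - 1))"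
      by simp
    also have "2 * f x * (2 * f x) powr (p - 1) = (2 * f x) powr p"
      using p f_nonneg[of x] by (cases "f x = 0") (auto simp: powr_diff)
    also have "(2 * f x) powr p = 2 powr p * f x powr p" by (rule powr_mult)
    finally show "(\<integral>\<^sup>+c. ennreal (?A * c powr (p - 2)) * (ennreal (f x) * (indicator {x. c / 2 < f x} x * indicator {0<..} c)) \<partial>lborel)
      = ennreal (5 ^ DIM('a) * p * 2 powr p / (p - 1)) * ennreal (f x powr p)"
      using p by (simp add: ennreal_mult[symmetric] mult_ac)
  qed
  also have "\<dots> = ennreal (5 ^ DIM('a) * p * 2 powr p / (p - 1)) * (\<integral>\<^sup>+x. ennreal (f x powr p) \<partial>lebesgue)"
    by (rule nn_integral_cmult) simp
  finally show ?thesis .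
qed

section \<open>Bump functions\<close>

lemma power_div_fact_le_exp:
  fixes y :: real
  assumes "0 \<le> y"
  shows "y ^ n / fact n \<le> exp y"
proof -
  have "(\<Sum>k\<in>{n}. y ^ k /\<^sub>R fact k) \<le> exp y"
    using assms summable_exp_generic[of y] unfolding exp_def by (intro sum_le_suminf) auto
  then show ?thesis by (simp add: field_simps)
qed

text \<open>The classical profile exp(-1/x) is the case m = 0. The span of the whole family is
  closed under differentiation, so smoothness follows by one induction in which \<open>m\<close>
  stays free.\<close>

definition flat :: "nat \<Rightarrow> real \<Rightarrow> real" where
  "flat m x = (if x \<le> 0 then 0 else exp (- inverse x) / x ^ m)"

lemma flat_nonneg: "0 \<le> flat m x"
  by (simp add: flat_def)

text \<open>With y = 1 / x this reduces to a single term of the exponential series being at most exp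
  y.\<close>

lemma flat_le: "flat m x \<le> fact m"
proof (cases "x \<le> 0")
  case False
  then have "inverse x ^ m / fact m \<le> exp (inverse x)"
    by (intro power_div_fact_le_exp) simp
  then show ?thesis using False by (simp add: flat_def exp_minus field_simps)
qed (simp add: flat_def)

lemma flat_has_derivative:
  "(flat m has_real_derivative (flat (m + 2) x - real m * flat (m + 1) x)) (at x)"
proof -
  consider "x < 0" | "x = 0" | "0 < x" by linarith
  then show ?thesis
  proof cases
    case 1
    have "((\<lambda>x::real. 0::real) has_real_derivative 0) (at x)" by simp
    then have "(flat m has_real_derivative 0) (at x)"
      by (rule has_field_derivative_transform_within_open[of _ _ _ "{..<0}"]) (use 1 in \<open>auto simp: flat_def\<close>)
    then show ?thesis using 1 by (simp add: flat_def)
  next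
    case 2
    \<comment> \<open>For h > 0 the difference quotient equals \<open>flat (m + 2) h * h\<close>,
      and \<open>flat (m + 2)\<close> is bounded by a factorial.\<close>
    have "((\<lambda>h. (flat m (0 + h) - flat m 0) / h) \<longlongrightarrow> 0) (at 0)"
    proof (rule Lim_null_comparison)
      show "((\<lambda>h::real. fact (m + 2) * \<bar>h\<bar>) \<longlongrightarrow> 0) (at 0)"
        by (rule tendsto_eq_intros | simp)+
      show "\<forall>\<^sub>F h in at 0. norm ((flat m (0 + h) - flat m 0) / h) \<le> fact (m + 2) * \<bar>h\<bar>"
      proof (rule always_eventually, intro allI)
        fix h :: real
        show "norm ((flat m (0 + h) - flat m 0) / h) \<le> fact (m + 2) * \<bar>h\<bar>"
        proof (cases "h \<le> 0")
          case False
          have "flat m h / h = flat (m + 2) h * h"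
            using False by (simp add: flat_def field_simps power_add power2_eq_square)
          also have "\<dots> \<le> fact (m + 2) * h"
            using False flat_le[of "m + 2" h] by (intro mult_right_mono) auto
          finally show ?thesis using False flat_nonneg[of m h] by (simp add: flat_def[of m 0])
        qed (simp add: flat_def mult_nonneg_nonpos del: fact_Suc add_2_eq_Suc')
      qed
    qed
    then show ?thesis using 2 unfolding DERIV_def by (simp add: flat_def)
  next
    case 3
    have "((\<lambda>x. exp (- inverse x) / x ^ m) has_real_derivative
        (exp (- inverse x) * (inverse x)\<^sup>2 * x ^ m - exp (- inverse x) * (real m * x ^ (m - 1))) / (x ^ m)\<^sup>2) (at x)"
      using 3 by (auto intro!: derivative_eq_intros simp: power2_eq_square)
    also have "(exp (- inverse x) * (inverse x)\<^sup>2 * x ^ m - exp (- inverse x) * (real m * x ^ (m - 1))) / (x ^ m)\<^sup>2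
       = flat (m + 2) x - real m * flat (m + 1) x"
      using 3 by (cases m) (auto simp: flat_def field_simps power2_eq_square)
    finally show ?thesis
      by (rule has_field_derivative_transform_within_open[of _ _ _ "{0<..}"]) (use 3 in \<open>auto simp: flat_def\<close>)
  qed
qed

lemma continuous_on_flat: "continuous_on S (flat m)"
  by (meson DERIV_isCont continuous_at_imp_continuous_on flat_has_derivative)

lemma continuous_on_flat_compose [continuous_intros]:
  "continuous_on S f \<Longrightarrow> continuous_on S (\<lambda>x. flat m (f x))"
  by (rule continuous_on_compose2[OF continuous_on_flat[of UNIV]]) auto

section \<open>Calculus of the classes C^k and smooth bumps on balls\<close>

lemma C_k_SucI:
  assumes "\<And>x. (f has_derivative f' x) (at x)" and "\<And>i. i \<in> Basis \<Longrightarrow> C_k k (\<lambda>x. f' x i)"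
  shows "C_k (Suc k) f"
proof -
  have "frechet_derivative f (at x) = f' x" for x
    using frechet_derivative_at[OF assms(1)] by simp
  then show ?thesis
    using assms unfolding C_k.simps differentiable_on_def differentiable_def
    by (auto intro: has_derivative_at_withinI)
qed

lemma C_k_SucD:
  assumes "C_k (Suc k) f"
  shows "(f has_derivative frechet_derivative f (at x)) (at x)"
    and "i \<in> Basis \<Longrightarrow> C_k k (\<lambda>x. frechet_derivative f (at x) i)"
  using assms by (auto simp: differentiable_on_def frechet_derivative_works)

text \<open>Serves the product rule, where the derivative of one factor meets the other factor at
  one order less.\<close>

lemma C_k_lower: "C_k (Suc k) f \<Longrightarrow> C_k k f"
proof (induction k arbitrary: f)
  case 0
  then show ?case by (simp add: differentiable_imp_continuous_on)
next
  case (Suc k)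
  have "C_k k (\<lambda>x. frechet_derivative f (at x) i)" if "i \<in> Basis" for i
    using Suc.IH C_k_SucD(2)[OF Suc.prems that] by blast
  then show ?case using Suc.prems by simp
qed

lemma C_k_const: "C_k k (\<lambda>_. c)"
proof (induction k arbitrary: c)
  case (Suc k)
  show ?case by (rule C_k_SucI[where f'="\<lambda>_ _. 0"]) (auto simp: Suc)
qed simp

lemma C_k_add: "C_k k f \<Longrightarrow> C_k k g \<Longrightarrow> C_k k (\<lambda>x. f x + g x)"
proof (induction k arbitrary: f g)
  case 0
  then show ?case by (simp add: continuous_on_add)
next
  case (Suc k)
  show ?case
    by (rule C_k_SucI[OF has_derivative_add[OF C_k_SucD(1)[OF Suc.prems(1)] C_k_SucD(1)[OF Suc.prems(2)]]])
      (intro Suc.IH C_k_SucD(2) Suc.prems)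
qed

lemma C_k_mult: "C_k k f \<Longrightarrow> C_k k g \<Longrightarrow> C_k k (\<lambda>x. f x * g x)"
proof (induction k arbitrary: f g)
  case 0
  then show ?case by (simp add: continuous_on_mult)
next
  case (Suc k)
  show ?case
    by (rule C_k_SucI[OF has_derivative_mult[OF C_k_SucD(1)[OF Suc.prems(1)] C_k_SucD(1)[OF Suc.prems(2)]]])
      (rule C_k_add[OF Suc.IH[OF C_k_lower[OF Suc.prems(1)] C_k_SucD(2)[OF Suc.prems(2)]]
            Suc.IH[OF C_k_SucD(2)[OF Suc.prems(1)] C_k_lower[OF Suc.prems(2)]]])
qed

lemma C_k_inner: "C_k k (\<lambda>x. (x - c) \<bullet> v)"
proof (cases k)
  case 0
  then show ?thesis by (simp add: continuous_intros)
next
  case (Suc j)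
  show ?thesis unfolding Suc
    by (rule C_k_SucI[where f'="\<lambda>_ h. h \<bullet> v"]) (auto intro!: C_k_const derivative_eq_intros)
qed

text \<open>Positive exactly on the open ball for r > 0, and a polynomial in \<open>y\<close>, hence
  smooth also at the centre, where the norm itself is not.\<close>

definition ball_gauge :: "'a::euclidean_space \<Rightarrow> real \<Rightarrow> 'a \<Rightarrow> real" where
  "ball_gauge x r y = 1 - ((y - x) \<bullet> (y - x)) / r\<^sup>2"

lemma ball_gauge_pos_iff: "0 < r \<Longrightarrow> 0 < ball_gauge x r y \<longleftrightarrow> y \<in> ball x r"
proof -
  assume r: "0 < r"
  have "0 < ball_gauge x r y \<longleftrightarrow> (norm (y - x))\<^sup>2 < r\<^sup>2"
    using r by (simp add: ball_gauge_def power2_norm_eq_inner field_simps)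
  also have "\<dots> \<longleftrightarrow> norm (y - x) < r"
    using r by (auto intro: power_strict_mono dest: power2_less_imp_less)
  finally show ?thesis by (simp add: dist_norm norm_minus_commute)
qed

lemma flat_ball_gauge_outside: "0 < r \<Longrightarrow> y \<notin> ball x r \<Longrightarrow> flat m (ball_gauge x r y) = 0"
  using ball_gauge_pos_iff[of r x y] by (auto simp: flat_def)

lemma ball_gauge_has_derivative:
  "((ball_gauge x r) has_derivative (\<lambda>h. (-2 / r\<^sup>2) * ((y - x) \<bullet> h))) (at y)"
  unfolding ball_gauge_def
  by (auto intro!: derivative_eq_intros simp: inner_commute divide_inverse)

lemma continuous_on_ball_gauge [continuous_intros]: "continuous_on S (ball_gauge x r)"
  unfolding ball_gauge_def[abs_def] divide_inverse by (intro continuous_intros)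

lemma flat_ball_gauge_has_derivative:
  "((\<lambda>y. flat m (ball_gauge x r y)) has_derivative (\<lambda>h. (flat (m + 2) (ball_gauge x r y)
     + (- real m) * flat (m + 1) (ball_gauge x r y)) * ((-2 / r\<^sup>2) * ((y - x) \<bullet> h)))) (at y)"
proof -
  have "(flat m has_derivative ((*) (flat (m + 2) (ball_gauge x r y) + (- real m) * flat (m + 1) (ball_gauge x r y))))
      (at (ball_gauge x r y))"
    using flat_has_derivative[of m "ball_gauge x r y"] by (simp add: has_field_derivative_def)
  from has_derivative_compose[OF ball_gauge_has_derivative this] show ?thesis .
qed

lemma C_k_flat_ball_gauge: "C_k k (\<lambda>y. flat m (ball_gauge x r y))"
proof (induction k arbitrary: m)
  case 0
  show ?case by (simp add: continuous_intros)
next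
  case (Suc k)
  show ?case
    by (rule C_k_SucI[OF flat_ball_gauge_has_derivative])
      (intro C_k_mult C_k_add C_k_const C_k_inner Suc)
qed

text \<open>The affine factor is there because the test functions required later are the coordinates
  of v + (\<rho> / r) (y - x) times a bump.\<close>

lemma test_function_affine_bump:
  assumes r: "0 < r"
  shows "test_function UNIV (\<lambda>y. (a + (y - x) \<bullet> v) * flat m (ball_gauge x r y))" (is "test_function _ ?f")
proof -
  have "{y. ?f y \<noteq> 0} \<subseteq> cball x r"
    using flat_ball_gauge_outside[OF r] ball_subset_cball by fastforce
  then have "bounded {y. ?f y \<noteq> 0}"
    using bounded_cball bounded_subset by blast
  moreover have "C_k k ?f" for k
    by (intro C_k_mult C_k_add C_k_const C_k_inner C_k_flat_ball_gauge)
  ultimately show ?thesis by (simp add: test_function_def compact_closure)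
qed

text \<open>The mean value inequality on the convex set \<open>S\<close> dominates the difference
  quotients by \<open>w\<close>; dominated convergence then applies along every sequence tending to
  \<open>l\<close>. Working within \<open>S\<close> includes the one-sided derivatives at the ends
  of a path.\<close>

lemma has_real_derivative_integral:
  fixes f f' :: "real \<Rightarrow> 'b \<Rightarrow> real"
  assumes S: "convex S" and l: "l \<in> S"
    and f: "\<And>l. l \<in> S \<Longrightarrow> integrable M (f l)"
    and f': "f' l \<in> borel_measurable M"
    and der: "\<And>l y. l \<in> S \<Longrightarrow> y \<in> space M \<Longrightarrow> ((\<lambda>l. f l y) has_real_derivative f' l y) (at l within S)"
    and bound: "\<And>l y. l \<in> S \<Longrightarrow> y \<in> space M \<Longrightarrow> \<bar>f' l y\<bar> \<le> w y" and w: "integrable M w"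
  shows "((\<lambda>l. \<integral>y. f l y \<partial>M) has_real_derivative (\<integral>y. f' l y \<partial>M)) (at l within S)"
  unfolding has_field_derivative_iff tendsto_at_iff_sequentially comp_def
proof (intro allI impI)
  fix X assume X: "\<forall>i. X i \<in> S - {l}" "X \<longlonglongrightarrow> l"
  have q: "((\<integral>y. f (X i) y \<partial>M) - (\<integral>y. f l y \<partial>M)) / (X i - l) = (\<integral>y. (f (X i) y - f l y) / (X i - l) \<partial>M)" for i
    using X f l by (simp add: Bochner_Integration.integral_diff)
  have "(\<lambda>i. \<integral>y. (f (X i) y - f l y) / (X i - l) \<partial>M) \<longlonglongrightarrow> (\<integral>y. f' l y \<partial>M)"
  proof (rule integral_dominated_convergence[where w=w])
    show "(\<lambda>y. (f (X i) y - f l y) / (X i - l)) \<in> borel_measurable M" for i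
      using borel_measurable_integrable[OF f] X l by (auto intro!: borel_measurable_divide borel_measurable_diff)
    show "AE y in M. (\<lambda>i. (f (X i) y - f l y) / (X i - l)) \<longlonglongrightarrow> f' l y"
    proof (rule AE_I2)
      fix y assume "y \<in> space M"
      then show "(\<lambda>i. (f (X i) y - f l y) / (X i - l)) \<longlonglongrightarrow> f' l y"
        using der[OF l] X unfolding has_field_derivative_iff tendsto_at_iff_sequentially comp_def by blast
    qed
    show "AE y in M. norm ((f (X i) y - f l y) / (X i - l)) \<le> w y" for i
    proof (rule AE_I2)
      fix y assume y: "y \<in> space M"
      have "norm (f (X i) y - f l y) \<le> w y * norm (X i - l)"
        by (rule field_differentiable_bound[OF S der[OF _ y]]) (use X l bound y in auto)
      then show "norm ((f (X i) y - f l y) / (X i - l)) \<le> w y"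
        using X by (simp add: field_simps)
    qed
  qed (use f' w in auto)
  then show "(\<lambda>i. ((\<integral>y. f (X i) y \<partial>M) - (\<integral>y. f l y \<partial>M)) / (X i - l)) \<longlonglongrightarrow> (\<integral>y. f' l y \<partial>M)"
    by (simp only: q)
qed

section \<open>Mollification and weak gradients\<close>

lemma locally_integrable_borel_measurable:
  fixes f :: "'a::euclidean_space \<Rightarrow> 'b::euclidean_space"
  assumes "locally_integrable UNIV f"
  shows "f \<in> borel_measurable lebesgue"
proof (rule borel_measurable_LIMSEQ_metric)
  show "(\<lambda>x. indicator (cball 0 (real n)) x *\<^sub>R f x) \<in> borel_measurable lebesgue" for n
  proof (rule borel_measurable_integrable)
    show "integrable lebesgue (\<lambda>x. indicator (cball 0 (real n)) x *\<^sub>R f x)"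
      using assms unfolding locally_integrable_def set_integrable_def by (meson compact_cball subset_UNIV)
  qed
  fix x :: 'a
  obtain m where m: "norm x \<le> real m" using real_arch_simple by blast
  have "indicator (cball 0 (real n)) x *\<^sub>R f x = f x" if "m \<le> n" for n
    using that m by (auto simp: indicator_def)
  then have "\<forall>\<^sub>F n in sequentially. indicator (cball 0 (real n)) x *\<^sub>R f x = f x"
    by (auto simp: eventually_sequentially)
  then show "(\<lambda>n. indicator (cball 0 (real n)) x *\<^sub>R f x) \<longlonglongrightarrow> f x"
    by (rule tendsto_eventually)
qed

lemma integrable_norm_indicator_cball:
  fixes f :: "'a::euclidean_space \<Rightarrow> 'b::euclidean_space"
  assumes "locally_integrable UNIV f"
  shows "integrable lebesgue (\<lambda>y. norm (f y) * indicator (cball x R) y)"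
proof -
  have "integrable lebesgue (\<lambda>y. norm (indicator (cball x R) y *\<^sub>R f y))"
    using assms by (intro integrable_norm) (auto simp: locally_integrable_def set_integrable_def)
  then show ?thesis by (simp add: mult.commute)
qed

lemma integrable_mult_bounded_support:
  fixes u k :: "'a::euclidean_space \<Rightarrow> real"
  assumes u: "locally_integrable UNIV u" and k: "k \<in> borel_measurable lebesgue"
    and le: "\<And>y. \<bar>k y\<bar> \<le> B * indicator (cball x R) y"
  shows "integrable lebesgue (\<lambda>y. u y * k y)"
proof (rule Bochner_Integration.integrable_bound)
  show "integrable lebesgue (\<lambda>y. B * (norm (u y) * indicator (cball x R) y))"
    by (intro integrable_mult_right integrable_norm_indicator_cball u)
  show "(\<lambda>y. u y * k y) \<in> borel_measurable lebesgue"
    using locally_integrable_borel_measurable[OF u] k by simp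
  show "AE y in lebesgue. norm (u y * k y) \<le> norm (B * (norm (u y) * indicator (cball x R) y))"
  proof (rule AE_I2)
    fix y
    have "\<bar>k y\<bar> \<le> \<bar>B\<bar> * indicator (cball x R) y"
      using le[of y] by (auto simp: indicator_def split: if_splits)
    then have "\<bar>u y\<bar> * \<bar>k y\<bar> \<le> \<bar>u y\<bar> * (\<bar>B\<bar> * indicator (cball x R) y)"
      by (intro mult_left_mono) simp_all
    then show "norm (u y * k y) \<le> norm (B * (norm (u y) * indicator (cball x R) y))"
      by (simp add: abs_mult mult_ac)
  qed
qed

lemma continuous_imp_borel_measurable_lebesgue:
  fixes f :: "'a::euclidean_space \<Rightarrow> 'b::topological_space"
  assumes "continuous_on UNIV f"
  shows "f \<in> borel_measurable lebesgue"
  by (rule measurable_completion) (simp add: borel_measurable_continuous_onI[OF assms])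

lemma borel_measurable_flat_ball_gauge: "(\<lambda>y. flat m (ball_gauge x r y)) \<in> borel_measurable lebesgue"
  by (intro continuous_imp_borel_measurable_lebesgue continuous_intros)

text \<open>The kernel is not normalised: for r > 0 its integral is \<open>bump_mass\<close>,
  whatever the centre and the radius, and this factor is carried through to the limit.\<close>

definition mollify :: "('a::euclidean_space \<Rightarrow> real) \<Rightarrow> 'a \<Rightarrow> real \<Rightarrow> real" where
  "mollify u x r = (\<integral>y. u y * (flat 0 (ball_gauge x r y) / r ^ DIM('a)) \<partial>lebesgue)"

text \<open>The derivative of the mollifying kernel along a straight path in \<open>(x, r)\<close>, in direction
  \<open>(v, \<rho>)\<close>. It is minus the divergence in \<open>y\<close> of \<open>v + (\<rho> / r) (y - x)\<close> times the kernel, which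
  is what makes the weak gradient applicable.\<close>

definition kernel_deriv :: "'a::euclidean_space \<Rightarrow> real \<Rightarrow> 'a \<Rightarrow> real \<Rightarrow> 'a \<Rightarrow> real" where
  "kernel_deriv v \<rho> x r y = flat 2 (ball_gauge x r y)
       * (2 * ((y - x) \<bullet> v) / r\<^sup>2 + 2 * \<rho> * ((y - x) \<bullet> (y - x)) / r ^ 3) / r ^ DIM('a)
     - real DIM('a) * \<rho> * flat 0 (ball_gauge x r y) / r ^ (DIM('a) + 1)"

lemma kernel_has_derivative:
  fixes x v y :: "'a::euclidean_space"
  assumes r: "0 < r + l * \<rho>"
  shows "((\<lambda>l. flat 0 (ball_gauge (x + l *\<^sub>R v) (r + l * \<rho>) y) / (r + l * \<rho>) ^ DIM('a))
    has_real_derivative kernel_deriv v \<rho> (x + l *\<^sub>R v) (r + l * \<rho>) y) (at l within S)"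
proof -
  \<comment> \<open>Along the path the squared distance to \<open>y\<close> is a quadratic
    polynomial in \<open>l\<close> with these coefficients, so only calculus in one variable
    remains.\<close>
  define a b c where "a = (y - x) \<bullet> (y - x)" and "b = (y - x) \<bullet> v" and "c = v \<bullet> v"
  have sq: "(y - (x + l *\<^sub>R v)) \<bullet> (y - (x + l *\<^sub>R v)) = a - 2 * l * b + l\<^sup>2 * c" for l
    by (simp add: a_def b_def c_def inner_diff_left inner_diff_right inner_add_left inner_add_right
        inner_commute power2_eq_square algebra_simps)
  have lin: "(y - (x + l *\<^sub>R v)) \<bullet> v = b - l * c"
    by (simp add: b_def c_def inner_diff_left inner_add_left)
  have bg: "ball_gauge (x + l *\<^sub>R v) (r + l * \<rho>) y = 1 - (a - 2 * l * b + l\<^sup>2 * c) / (r + l * \<rho>)\<^sup>2" for l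
    by (simp only: ball_gauge_def sq)
  define R where "R = r + l * \<rho>"
  have R: "0 < R" using r by (simp add: R_def)
  have d1: "((\<lambda>l. 1 - (a - 2 * l * b + l\<^sup>2 * c) / (r + l * \<rho>)\<^sup>2) has_real_derivative
      (2 * (b - l * c) / R\<^sup>2 + 2 * \<rho> * (a - 2 * l * b + l\<^sup>2 * c) / R ^ 3)) (at l within S)"
  proof -
    have "((\<lambda>l. 1 - (a - 2 * l * b + l\<^sup>2 * c) / (r + l * \<rho>)\<^sup>2) has_real_derivative
      - (((- 2 * b + 2 * l * c) * (r + l * \<rho>)\<^sup>2 - (a - 2 * l * b + l\<^sup>2 * c) * (2 * (r + l * \<rho>) * \<rho>)) / ((r + l * \<rho>)\<^sup>2 * (r + l * \<rho>)\<^sup>2)))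
      (at l within S)"
      using r by (auto intro!: derivative_eq_intros)
    moreover have "- (((- 2 * b + 2 * l * c) * R\<^sup>2 - A * (2 * R * \<rho>)) / (R\<^sup>2 * R\<^sup>2))
        = 2 * (b - l * c) / R\<^sup>2 + 2 * \<rho> * A / R ^ 3" for A
      using R by (simp add: field_simps power2_eq_square power3_eq_cube)
    ultimately show ?thesis by (simp only: R_def)
  qed
  have d2: "((\<lambda>l. flat 0 (1 - (a - 2 * l * b + l\<^sup>2 * c) / (r + l * \<rho>)\<^sup>2)) has_real_derivative
      flat 2 (1 - (a - 2 * l * b + l\<^sup>2 * c) / R\<^sup>2) * (2 * (b - l * c) / R\<^sup>2 + 2 * \<rho> * (a - 2 * l * b + l\<^sup>2 * c) / R ^ 3)) (at l within S)"
    using DERIV_chain2[OF _ d1, of "flat 0"] flat_has_derivative[of 0] by (simp add: R_def numeral_2_eq_2)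
  have d3: "((\<lambda>l. inverse ((r + l * \<rho>) ^ DIM('a))) has_real_derivative - (real DIM('a) * \<rho> / R ^ (DIM('a) + 1))) (at l within S)"
  proof -
    have "((\<lambda>l. inverse ((r + l * \<rho>) ^ DIM('a))) has_real_derivative
       - (inverse (R ^ DIM('a)) * (real DIM('a) * \<rho> * R ^ (DIM('a) - 1)) * inverse (R ^ DIM('a)))) (at l within S)"
      using R by (auto intro!: derivative_eq_intros simp: R_def)
    moreover have "inverse (R ^ n) * (real n * \<rho> * R ^ (n - 1)) * inverse (R ^ n) = real n * \<rho> / R ^ (n + 1)" for n
      using R by (cases n) (auto simp: field_simps)
    ultimately show ?thesis by simp
  qed
  show ?thesis
    using DERIV_mult[OF d2 d3] R
    unfolding kernel_deriv_def bg sq lin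
    by (simp add: R_def divide_inverse mult_ac)
qed

text \<open>Supplies the dominating function for differentiating under the integral; the lower bound
  \<open>r0\<close> of the radius makes it uniform along a path. The 4 is the bound 2! of
  \<open>flat 2\<close> times the 2 from differentiating the gauge.\<close>

lemma kernel_deriv_bound:
  fixes x v y :: "'a::euclidean_space"
  assumes r0: "0 < r0" "r0 \<le> r"
  shows "\<bar>kernel_deriv v \<rho> x r y\<bar>
    \<le> (4 * (norm v + \<bar>\<rho>\<bar>) + real DIM('a) * \<bar>\<rho>\<bar>) / r0 ^ (DIM('a) + 1) * indicator (ball x r) y"
proof (cases "y \<in> ball x r")
  case True
  have r: "0 < r" using r0 by simp
  let ?N = "DIM('a)"
  have n: "norm (y - x) \<le> r" using True by (simp add: dist_norm norm_minus_commute less_imp_le)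
  have iv: "\<bar>(y - x) \<bullet> v\<bar> \<le> r * norm v"
    using Cauchy_Schwarz_ineq2[of "y - x" v] mult_right_mono[OF n, of "norm v"] by simp
  have ii: "\<bar>(y - x) \<bullet> (y - x)\<bar> \<le> r * r"
    using Cauchy_Schwarz_ineq2[of "y - x" "y - x"] mult_mono[OF n n] r by simp
  have A1: "\<bar>2 * ((y - x) \<bullet> v) / r\<^sup>2\<bar> \<le> 2 * norm v / r"
    using iv r by (simp add: abs_mult field_simps power2_eq_square)
  have "\<bar>2 * \<rho> * ((y - x) \<bullet> (y - x)) / r ^ 3\<bar> = 2 * \<bar>\<rho>\<bar> * \<bar>(y - x) \<bullet> (y - x)\<bar> / r ^ 3"
    using r by (simp add: abs_mult)
  also have "\<dots> \<le> 2 * \<bar>\<rho>\<bar> * (r * r) / r ^ 3"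
    using r by (intro divide_right_mono mult_left_mono ii) auto
  also have "\<dots> = 2 * \<bar>\<rho>\<bar> / r" using r by (simp add: power3_eq_cube)
  finally have A2: "\<bar>2 * \<rho> * ((y - x) \<bullet> (y - x)) / r ^ 3\<bar> \<le> 2 * \<bar>\<rho>\<bar> / r" .
  have dv: "\<bar>X / r ^ n\<bar> \<le> C / r ^ n" if "\<bar>X\<bar> \<le> C" for X C :: real and n
    using that r by (simp add: divide_right_mono)
  have f2: "\<bar>flat 2 (ball_gauge x r y)\<bar> \<le> 2" and f0: "\<bar>flat 0 (ball_gauge x r y)\<bar> \<le> 1"
    using flat_le[of 2 "ball_gauge x r y"] flat_le[of 0 "ball_gauge x r y"] flat_nonneg by (auto simp: fact_2)
  have "\<bar>flat 2 (ball_gauge x r y) * (2 * ((y - x) \<bullet> v) / r\<^sup>2 + 2 * \<rho> * ((y - x) \<bullet> (y - x)) / r ^ 3)\<bar>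
      \<le> 2 * (2 * norm v / r + 2 * \<bar>\<rho>\<bar> / r)"
    unfolding abs_mult by (intro mult_mono f2 order.trans[OF abs_triangle_ineq] add_mono A1 A2) auto
  then have B1: "\<bar>flat 2 (ball_gauge x r y) * (2 * ((y - x) \<bullet> v) / r\<^sup>2 + 2 * \<rho> * ((y - x) \<bullet> (y - x)) / r ^ 3) / r ^ ?N\<bar>
      \<le> 2 * (2 * norm v / r + 2 * \<bar>\<rho>\<bar> / r) / r ^ ?N"
    by (rule dv)
  have "\<bar>real DIM('a) * \<rho> * flat 0 (ball_gauge x r y)\<bar> \<le> real ?N * \<bar>\<rho>\<bar> * 1"
    unfolding abs_mult by (intro mult_mono f0) auto
  then have "\<bar>real DIM('a) * \<rho> * flat 0 (ball_gauge x r y)\<bar> \<le> real ?N * \<bar>\<rho>\<bar>" by (simp only: mult_1_right)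
  from dv[OF this] have B2: "\<bar>real DIM('a) * \<rho> * flat 0 (ball_gauge x r y) / r ^ (?N + 1)\<bar> \<le> real ?N * \<bar>\<rho>\<bar> / r ^ (?N + 1)" .
  have "\<bar>kernel_deriv v \<rho> x r y\<bar> \<le> 2 * (2 * norm v / r + 2 * \<bar>\<rho>\<bar> / r) / r ^ ?N + real ?N * \<bar>\<rho>\<bar> / r ^ (?N + 1)"
    unfolding kernel_deriv_def using B1 B2 by linarith
  also have "\<dots> = (4 * (norm v + \<bar>\<rho>\<bar>) + real ?N * \<bar>\<rho>\<bar>) / r ^ (?N + 1)"
    using r by (simp add: field_simps)
  also have "\<dots> \<le> (4 * (norm v + \<bar>\<rho>\<bar>) + real ?N * \<bar>\<rho>\<bar>) / r0 ^ (?N + 1)"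
    using r0 by (intro divide_left_mono power_mono) auto
  finally show ?thesis using True by simp
next
  case False
  then show ?thesis using r0 by (simp add: kernel_deriv_def flat_ball_gauge_outside)
qed

lemma borel_measurable_kernel_deriv: "kernel_deriv v \<rho> x r \<in> borel_measurable lebesgue"
proof -
  have "continuous_on UNIV (kernel_deriv v \<rho> x r)"
    unfolding kernel_deriv_def[abs_def] divide_inverse by (intro continuous_intros)
  then show ?thesis by (rule continuous_imp_borel_measurable_lebesgue)
qed

text \<open>Each coordinate of the field v + (\<rho> / r) (y - x) times the kernel is a test
  function, and summing the weak partial derivatives over the basis produces the divergence. On the
  ball the field v + (\<rho> / r) (y - x) has norm at most |v| + |\<rho>|.\<close>

lemma weak_gradient_kernel_deriv:
  fixes u :: "'a::euclidean_space \<Rightarrow> real"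
  assumes g: "has_weak_gradient UNIV u g" and r: "0 < r"
  shows "\<bar>\<integral>y. u y * kernel_deriv v \<rho> x r y \<partial>lebesgue\<bar>
    \<le> (norm v + \<bar>\<rho>\<bar>) / r ^ DIM('a) * (\<integral>y. norm (g y) * indicator (cball x r) y \<partial>lebesgue)"
proof -
  let ?N = "DIM('a)"
  have lu: "locally_integrable UNIV u" and lg: "locally_integrable UNIV g"
    using g by (auto simp: has_weak_gradient_def)
  define K where "K y = flat 0 (ball_gauge x r y)" for y
  define \<psi> where "\<psi> i y = ((v \<bullet> i) / r ^ ?N + (y - x) \<bullet> ((\<rho> / r ^ (?N + 1)) *\<^sub>R i)) * K y" for i y
  define D where "D i y = (\<rho> / r ^ (?N + 1)) * K y
      + ((v \<bullet> i) / r ^ ?N + (y - x) \<bullet> ((\<rho> / r ^ (?N + 1)) *\<^sub>R i)) * (flat 2 (ball_gauge x r y) * ((-2 / r\<^sup>2) * ((y - x) \<bullet> i)))" for i y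
  have der: "frechet_derivative (\<psi> i) (at y) i = D i y" if "i \<in> Basis" for i y
  proof -
    let ?c = "(\<rho> / r ^ (?N + 1)) *\<^sub>R i"
    have lin: "((\<lambda>y. a + (y - x) \<bullet> c) has_derivative (\<lambda>h. h \<bullet> c)) (at y)" for a :: real and c
      by (auto intro!: derivative_eq_intros)
    from has_derivative_mult[OF lin[of "(v \<bullet> i) / r ^ ?N" ?c] flat_ball_gauge_has_derivative[of 0 x r y]]
    have "(\<psi> i has_derivative (\<lambda>h. ((v \<bullet> i) / r ^ ?N + (y - x) \<bullet> ?c) *
         ((flat (0 + 2) (ball_gauge x r y) + - real 0 * flat (0 + 1) (ball_gauge x r y)) * (- 2 / r\<^sup>2 * ((y - x) \<bullet> h)))
         + h \<bullet> ?c * flat 0 (ball_gauge x r y))) (at y)"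
      unfolding \<psi>_def[abs_def] K_def .
    then have "frechet_derivative (\<psi> i) (at y) = (\<lambda>h. ((v \<bullet> i) / r ^ ?N + (y - x) \<bullet> ?c) *
         ((flat (0 + 2) (ball_gauge x r y) + - real 0 * flat (0 + 1) (ball_gauge x r y)) * (- 2 / r\<^sup>2 * ((y - x) \<bullet> h)))
         + h \<bullet> ?c * flat 0 (ball_gauge x r y))"
      by (rule frechet_derivative_at[symmetric])
    then show ?thesis using that r by (simp add: D_def K_def numeral_2_eq_2)
  qed
  have tf: "test_function UNIV (\<psi> i)" for i
    unfolding \<psi>_def[abs_def] K_def by (rule test_function_affine_bump[OF r])
  have parts: "(\<integral>y. u y * D i y \<partial>lebesgue) = - (\<integral>y. (g y \<bullet> i) * \<psi> i y \<partial>lebesgue)" if i: "i \<in> Basis" for i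
  proof -
    have "(LINT y:UNIV|lebesgue. u y * frechet_derivative (\<psi> i) (at y) i) = - (LINT y:UNIV|lebesgue. (g y \<bullet> i) * \<psi> i y)"
      using g tf[of i] i unfolding has_weak_gradient_def by blast
    then show ?thesis by (simp add: set_lebesgue_integral_def der[OF i])
  qed
  \<comment> \<open>The part \<open>ca\<close> is repeated N times because y - x has divergence N;
    \<open>cb\<close> and \<open>cc\<close> come from differentiating the bump.\<close>
  have sumD: "(\<Sum>i\<in>Basis. D i y) = - kernel_deriv v \<rho> x r y" for y
  proof -
    define z where "z = y - x"
    define ca cb cc where "ca = \<rho> / r ^ (?N + 1) * K y"
      and "cb = flat 2 (ball_gauge x r y) * (-2 / r\<^sup>2) * (1 / r ^ ?N)"
      and "cc = flat 2 (ball_gauge x r y) * (-2 / r\<^sup>2) * (\<rho> / r ^ (?N + 1))"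
    have "D i y = ca + cb * ((v \<bullet> i) * (z \<bullet> i)) + cc * ((z \<bullet> i) * (z \<bullet> i))" for i
      unfolding D_def z_def[symmetric] ca_def cb_def cc_def
      by (simp add: distrib_left distrib_right mult_ac add_divide_distrib)
    then have "(\<Sum>i\<in>Basis. D i y) = real ?N * ca + cb * (v \<bullet> z) + cc * (z \<bullet> z)"
      by (simp add: sum.distrib sum_distrib_left[symmetric] euclidean_inner[symmetric])
    also have "\<dots> = - kernel_deriv v \<rho> x r y"
      unfolding kernel_deriv_def z_def[symmetric] K_def ca_def cb_def cc_def using r
      by (simp add: inner_commute field_simps power2_eq_square power3_eq_cube)
    finally show ?thesis .
  qed
  have sum\<psi>: "(\<Sum>i\<in>Basis. (g y \<bullet> i) * \<psi> i y) = (g y \<bullet> (v + (\<rho> / r) *\<^sub>R (y - x))) * (K y / r ^ ?N)" for y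
  proof -
    define z where "z = y - x"
    have "(\<Sum>i\<in>Basis. (g y \<bullet> i) * \<psi> i y) = K y * ((1 / r ^ ?N) * (\<Sum>i\<in>Basis. (g y \<bullet> i) * (v \<bullet> i))
       + (\<rho> / r ^ (?N + 1)) * (\<Sum>i\<in>Basis. (g y \<bullet> i) * (z \<bullet> i)))"
      unfolding \<psi>_def z_def[symmetric]
      by (simp add: sum_distrib_left sum.distrib[symmetric] algebra_simps)
    also have "\<dots> = K y * ((1 / r ^ ?N) * (g y \<bullet> v) + (\<rho> / r ^ (?N + 1)) * (g y \<bullet> z))"
      by (simp add: euclidean_inner[symmetric])
    also have "\<dots> = (g y \<bullet> (v + (\<rho> / r) *\<^sub>R z)) * (K y / r ^ ?N)"
      using r by (simp add: inner_add_right field_simps)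
    finally show ?thesis by (simp add: z_def)
  qed
  have Kb: "\<bar>K y\<bar> \<le> indicator (cball x r) y" for y
    using flat_le[of 0 "ball_gauge x r y"] flat_nonneg[of 0 "ball_gauge x r y"] flat_ball_gauge_outside[OF r, of y x 0]
    by (cases "y \<in> ball x r") (auto simp: K_def indicator_def)
  have contD: "continuous_on UNIV (D i)" and cont\<psi>: "continuous_on UNIV (\<psi> i)" for i
    unfolding D_def[abs_def] \<psi>_def[abs_def] K_def divide_inverse by (intro continuous_intros)+
  have supp: "k y = 0" if "y \<notin> cball x r" "k = D i \<or> k = \<psi> i" for k i y
    using that flat_ball_gauge_outside[OF r, of y x] by (auto simp: D_def \<psi>_def K_def)
  have bdd: "\<exists>B. \<forall>y. \<bar>k y\<bar> \<le> B * indicator (cball x r) y"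
    if k: "continuous_on UNIV k" "\<And>y. y \<notin> cball x r \<Longrightarrow> k y = 0" for k :: "'a \<Rightarrow> real"
  proof -
    have "bounded (k ` cball x r)"
      using k(1) by (intro compact_imp_bounded compact_continuous_image continuous_on_subset[OF k(1)]) auto
    then obtain B where "\<forall>y\<in>cball x r. \<bar>k y\<bar> \<le> B"
      unfolding bounded_iff by force
    then show ?thesis using k(2) by (intro exI[of _ B]) (auto simp: indicator_def)
  qed
  have int: "integrable lebesgue (\<lambda>y. f y * k y)"
    if "locally_integrable UNIV f" "continuous_on UNIV k" "\<And>y. y \<notin> cball x r \<Longrightarrow> k y = 0" for f k :: "'a \<Rightarrow> real"
  proof -
    note prems = that
    obtain B where "\<And>y. \<bar>k y\<bar> \<le> B * indicator (cball x r) y" using bdd[OF prems(2,3)] by blast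
    then show ?thesis
      by (intro integrable_mult_bounded_support[OF prems(1)] continuous_imp_borel_measurable_lebesgue prems(2))
  qed
  have lgi: "locally_integrable UNIV (\<lambda>y. g y \<bullet> i)" for i
    using lg unfolding locally_integrable_def set_integrable_def
    by (auto dest: integrable_inner_left simp: inner_scaleR_left[symmetric] simp del: inner_scaleR_left)
  have intD: "integrable lebesgue (\<lambda>y. u y * D i y)" for i
    by (rule int[OF lu contD]) (use supp in blast)
  have int\<psi>: "integrable lebesgue (\<lambda>y. (g y \<bullet> i) * \<psi> i y)" for i
    by (rule int[OF lgi cont\<psi>]) (use supp in blast)
  have "(\<integral>y. u y * kernel_deriv v \<rho> x r y \<partial>lebesgue) = - (\<integral>y. (\<Sum>i\<in>Basis. u y * D i y) \<partial>lebesgue)"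
    by (simp add: sum_distrib_left[symmetric] sumD)
  also have "\<dots> = - (\<Sum>i\<in>Basis. \<integral>y. u y * D i y \<partial>lebesgue)"
    by (subst Bochner_Integration.integral_sum) (use intD in auto)
  also have "\<dots> = (\<Sum>i\<in>Basis. \<integral>y. (g y \<bullet> i) * \<psi> i y \<partial>lebesgue)"
    by (simp add: parts sum_negf)
  also have "\<dots> = (\<integral>y. (\<Sum>i\<in>Basis. (g y \<bullet> i) * \<psi> i y) \<partial>lebesgue)"
    by (rule Bochner_Integration.integral_sum[symmetric]) (use int\<psi> in auto)
  also have "\<dots> = (\<integral>y. (g y \<bullet> (v + (\<rho> / r) *\<^sub>R (y - x))) * (K y / r ^ ?N) \<partial>lebesgue)"
    by (simp only: sum\<psi>)
  finally have eq: "(\<integral>y. u y * kernel_deriv v \<rho> x r y \<partial>lebesgue) = \<dots>" .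
  have "norm (\<integral>y. (g y \<bullet> (v + (\<rho> / r) *\<^sub>R (y - x))) * (K y / r ^ ?N) \<partial>lebesgue)
      \<le> (\<integral>y. (norm v + \<bar>\<rho>\<bar>) / r ^ ?N * (norm (g y) * indicator (cball x r) y) \<partial>lebesgue)"
  proof (rule Bochner_Integration.integral_norm_bound_integral)
    show "integrable lebesgue (\<lambda>y. (norm v + \<bar>\<rho>\<bar>) / r ^ ?N * (norm (g y) * indicator (cball x r) y))"
      by (intro integrable_mult_right integrable_norm_indicator_cball lg)
    have "integrable lebesgue (\<lambda>y. \<Sum>i\<in>Basis. (g y \<bullet> i) * \<psi> i y)"
      by (rule Bochner_Integration.integrable_sum) (use int\<psi> in auto)
    then show "integrable lebesgue (\<lambda>y. (g y \<bullet> (v + (\<rho> / r) *\<^sub>R (y - x))) * (K y / r ^ ?N))"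
      by (simp only: sum\<psi>)
    fix y
    show "norm ((g y \<bullet> (v + (\<rho> / r) *\<^sub>R (y - x))) * (K y / r ^ ?N))
      \<le> (norm v + \<bar>\<rho>\<bar>) / r ^ ?N * (norm (g y) * indicator (cball x r) y)"
    proof (cases "y \<in> cball x r")
      case True
      have "norm (y - x) \<le> r" using True by (simp add: dist_norm norm_minus_commute)
      then have "\<bar>\<rho>\<bar> / r * norm (y - x) \<le> \<bar>\<rho>\<bar> / r * r" using r by (intro mult_left_mono) auto
      then have "norm ((\<rho> / r) *\<^sub>R (y - x)) \<le> \<bar>\<rho>\<bar>" using r by simp
      then have "norm (v + (\<rho> / r) *\<^sub>R (y - x)) \<le> norm v + \<bar>\<rho>\<bar>"
        using norm_triangle_ineq[of v "(\<rho> / r) *\<^sub>R (y - x)"] by linarith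
      then have "\<bar>g y \<bullet> (v + (\<rho> / r) *\<^sub>R (y - x))\<bar> \<le> norm (g y) * (norm v + \<bar>\<rho>\<bar>)"
        using Cauchy_Schwarz_ineq2[of "g y" "v + (\<rho> / r) *\<^sub>R (y - x)"] mult_left_mono[of _ _ "norm (g y)"]
        by (meson norm_ge_zero order_trans)
      moreover have "\<bar>K y / r ^ ?N\<bar> \<le> 1 / r ^ ?N"
        using Kb[of y] True r by (simp add: divide_right_mono)
      ultimately have "\<bar>g y \<bullet> (v + (\<rho> / r) *\<^sub>R (y - x))\<bar> * \<bar>K y / r ^ ?N\<bar> \<le> norm (g y) * (norm v + \<bar>\<rho>\<bar>) * (1 / r ^ ?N)"
        by (intro mult_mono) auto
      then show ?thesis using True by (simp add: abs_mult mult_ac)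
    next
      case False
      then show ?thesis using Kb[of y] by simp
    qed
  qed
  then show ?thesis by (simp add: eq)
qed

lemma integrable_mult_kernel:
  fixes u :: "'a::euclidean_space \<Rightarrow> real"
  assumes u: "locally_integrable UNIV u" and r: "0 < r"
  shows "integrable lebesgue (\<lambda>y. u y * (flat 0 (ball_gauge x r y) / r ^ DIM('a)))"
proof (rule integrable_mult_bounded_support[OF u])
  show "(\<lambda>y. flat 0 (ball_gauge x r y) / r ^ DIM('a)) \<in> borel_measurable lebesgue"
    by (intro borel_measurable_divide borel_measurable_flat_ball_gauge borel_measurable_const)
  show "\<bar>flat 0 (ball_gauge x r y) / r ^ DIM('a)\<bar> \<le> 1 / r ^ DIM('a) * indicator (cball x r) y" for y
    using flat_le[of 0 "ball_gauge x r y"] flat_nonneg[of 0 "ball_gauge x r y"] r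
      flat_ball_gauge_outside[OF r, of y x 0]
    by (cases "y \<in> ball x r") (auto simp: divide_right_mono)
qed

text \<open>The straight path from \<open>(x, \<epsilon>)\<close> to \<open>(x1, r)\<close> runs through balls
  whose doubles contain \<open>x\<close>, so one maximal function at \<open>x\<close> controls all of it.\<close>

lemma mollify_lipschitz:
  fixes u :: "'a::euclidean_space \<Rightarrow> real"
  assumes g: "has_weak_gradient UNIV u g"
    and M: "maximal (\<lambda>y. ennreal (norm (g y))) x \<le> ennreal m" and m: "0 \<le> m"
    and \<epsilon>: "0 < \<epsilon>" "\<epsilon> \<le> r" and x1: "norm (x1 - x) \<le> r"
  shows "\<bar>mollify u x1 r - mollify u x \<epsilon>\<bar> \<le> 2 ^ (DIM('a) + 1) * unit_ball_vol DIM('a) * r * m"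
proof -
  let ?N = "DIM('a)" and ?v = "unit_ball_vol (real DIM('a))"
  have lu: "locally_integrable UNIV u" and lg: "locally_integrable UNIV g"
    using g by (auto simp: has_weak_gradient_def)
  define v where "v = x1 - x"
  define \<rho> where "\<rho> = r - \<epsilon>"
  have \<rho>: "0 \<le> \<rho>" using \<epsilon> by (simp add: \<rho>_def)
  define X where "X l = x + l *\<^sub>R v" for l
  define R where "R l = \<epsilon> + l * \<rho>" for l
  have R_eps: "\<epsilon> \<le> R l" and R_r: "R l \<le> r" and Xx: "norm (X l - x) \<le> l * r"
    if l: "l \<in> {0..1}" for l
  proof -
    show "\<epsilon> \<le> R l" using l \<rho> by (simp add: R_def)
    show "R l \<le> r" using l \<rho> mult_right_mono[of l 1 \<rho>] by (simp add: R_def \<rho>_def)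
    show "norm (X l - x) \<le> l * r" using l x1 by (simp add: X_def v_def mult_left_mono)
  qed
  define w where "w y = (4 * (norm v + \<bar>\<rho>\<bar>) + real ?N * \<bar>\<rho>\<bar>) / \<epsilon> ^ (?N + 1)
      * (norm (u y) * indicator (cball x (2 * r)) y)" for y
  have der: "((\<lambda>l. \<integral>y. u y * (flat 0 (ball_gauge (X l) (R l) y) / R l ^ ?N) \<partial>lebesgue)
      has_real_derivative (\<integral>y. u y * kernel_deriv v \<rho> (X l) (R l) y \<partial>lebesgue)) (at l within {0..1})"
    if l: "l \<in> {0..1}" for l
  proof (rule has_real_derivative_integral[where w=w])
    show "integrable lebesgue (\<lambda>y. u y * (flat 0 (ball_gauge (X l) (R l) y) / R l ^ ?N))" if "l \<in> {0..1}" for l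
      using R_eps[OF that] \<epsilon> by (intro integrable_mult_kernel lu) simp
    show "(\<lambda>y. u y * kernel_deriv v \<rho> (X l) (R l) y) \<in> borel_measurable lebesgue"
      by (intro borel_measurable_times locally_integrable_borel_measurable[OF lu] borel_measurable_kernel_deriv)
    show "integrable lebesgue w"
      unfolding w_def by (intro integrable_mult_right integrable_norm_indicator_cball lu)
    fix l y assume l: "l \<in> {0..(1::real)}"
    have Rpos: "0 < \<epsilon> + l * \<rho>" using R_eps[OF l] \<epsilon> by (simp add: R_def)
    show "((\<lambda>l. u y * (flat 0 (ball_gauge (X l) (R l) y) / R l ^ ?N)) has_real_derivative
        u y * kernel_deriv v \<rho> (X l) (R l) y) (at l within {0..1})"
      unfolding X_def R_def by (intro DERIV_cmult kernel_has_derivative Rpos)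
    have "ball (X l) (R l) \<subseteq> cball x (2 * r)"
    proof
      fix z assume z: "z \<in> ball (X l) (R l)"
      have "l * r \<le> r" using l \<epsilon> mult_right_mono[of l 1 r] by simp
      then have "norm (X l - x) \<le> r" using Xx[OF l] by simp
      then show "z \<in> cball x (2 * r)"
        using z R_r[OF l] dist_triangle[of x z "X l"] by (simp add: dist_norm norm_minus_commute)
    qed
    then have ind: "indicator (ball (X l) (R l)) y \<le> (indicator (cball x (2 * r)) y :: real)"
      by (auto simp: indicator_def)
    let ?B = "(4 * (norm v + \<bar>\<rho>\<bar>) + real ?N * \<bar>\<rho>\<bar>) / \<epsilon> ^ (?N + 1)"
    have "\<bar>kernel_deriv v \<rho> (X l) (R l) y\<bar> \<le> ?B * indicator (ball (X l) (R l)) y"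
      using kernel_deriv_bound[OF \<epsilon>(1) R_eps[OF l]] .
    also have "\<dots> \<le> ?B * indicator (cball x (2 * r)) y"
      using \<epsilon> by (intro mult_left_mono ind) auto
    finally have "\<bar>u y\<bar> * \<bar>kernel_deriv v \<rho> (X l) (R l) y\<bar> \<le> \<bar>u y\<bar> * (?B * indicator (cball x (2 * r)) y)"
      by (intro mult_left_mono) simp_all
    then show "\<bar>u y * kernel_deriv v \<rho> (X l) (R l) y\<bar> \<le> w y"
      by (simp add: w_def abs_mult mult_ac)
  qed (use l in auto)
  have der_le: "norm (\<integral>y. u y * kernel_deriv v \<rho> (X l) (R l) y \<partial>lebesgue) \<le> 2 ^ (?N + 1) * ?v * r * m"
    if l: "l \<in> {0..1}" for l
  proof -
    have R: "0 < R l" using R_eps[OF l] \<epsilon> by simp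
    \<comment> \<open>The radius is (1 - l) \<epsilon> + l r, while the centre has moved by at most
      l r. This is strictly less than twice the radius: for l < 1 because (1 - l) \<epsilon> > 0,
      for l = 1 because r > 0.\<close>
    have near: "dist (X l) x < 2 * R l"
    proof (cases "l = 1")
      case True
      then show ?thesis using Xx[OF l] \<epsilon> by (simp add: R_def \<rho>_def dist_norm)
    next
      case False
      then have "0 < \<epsilon> * (1 - l)" using l \<epsilon> by (intro mult_pos_pos) auto
      moreover have "0 \<le> l * r" using l \<epsilon> by auto
      ultimately show ?thesis using Xx[OF l] by (simp add: R_def \<rho>_def dist_norm algebra_simps)
    qed
    have "ennreal (\<integral>y. norm (g y) * indicator (cball (X l) (R l)) y \<partial>lebesgue)
       = (\<integral>\<^sup>+y. ennreal (norm (g y) * indicator (cball (X l) (R l)) y) \<partial>lebesgue)"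
      by (rule nn_integral_eq_integral[symmetric]) (use integrable_norm_indicator_cball[OF lg] in auto)
    also have "\<dots> \<le> (\<integral>\<^sup>+y. ennreal (norm (g y)) * indicator (ball (X l) (2 * R l)) y \<partial>lebesgue)"
      using R by (intro nn_integral_mono) (auto simp: indicator_def)
    also have "\<dots> \<le> ennreal (measure lebesgue (ball (X l) (2 * R l))) * maximal (\<lambda>y. ennreal (norm (g y))) x"
      by (rule nn_integral_ball_le_maximal[OF near])
    also have "\<dots> \<le> ennreal (measure lebesgue (ball (X l) (2 * R l))) * ennreal m"
      by (intro mult_left_mono M) simp
    also have "\<dots> = ennreal (?v * (2 * R l) ^ ?N * m)"
      using R m by (simp add: content_ball ennreal_mult[symmetric])
    finally have int_le: "(\<integral>y. norm (g y) * indicator (cball (X l) (R l)) y \<partial>lebesgue) \<le> ?v * (2 * R l) ^ ?N * m"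
      using R m by (subst (asm) ennreal_le_iff) auto
    \<comment> \<open>Centre and radius each move by at most r, hence the factor 2 r; doubling the
      ball contributes the remaining 2^N.\<close>
    have vr: "norm v + \<bar>\<rho>\<bar> \<le> 2 * r" using x1 \<rho> \<epsilon> by (simp add: v_def \<rho>_def)
    have "norm (\<integral>y. u y * kernel_deriv v \<rho> (X l) (R l) y \<partial>lebesgue)
      \<le> (norm v + \<bar>\<rho>\<bar>) / R l ^ ?N * (\<integral>y. norm (g y) * indicator (cball (X l) (R l)) y \<partial>lebesgue)"
      using weak_gradient_kernel_deriv[OF g R] by simp
    also have "\<dots> \<le> 2 * r / R l ^ ?N * (?v * (2 * R l) ^ ?N * m)"
      using vr R \<epsilon> by (intro mult_mono divide_right_mono int_le) auto
    also have "\<dots> = 2 ^ (?N + 1) * ?v * r * m"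
      using R by (simp add: power_mult_distrib)
    finally show ?thesis .
  qed
  have "norm ((\<integral>y. u y * (flat 0 (ball_gauge (X 1) (R 1) y) / R 1 ^ ?N) \<partial>lebesgue)
      - (\<integral>y. u y * (flat 0 (ball_gauge (X 0) (R 0) y) / R 0 ^ ?N) \<partial>lebesgue))
     \<le> 2 ^ (?N + 1) * ?v * r * m * norm (1 - 0 :: real)"
    by (rule field_differentiable_bound[OF _ der der_le]) auto
  then show ?thesis
    by (simp add: X_def R_def v_def \<rho>_def mollify_def)
qed

text \<open>The dummy type argument conveys the space, of which only the dimension matters.\<close>

definition bump_mass :: "'a::euclidean_space itself \<Rightarrow> real" where
  "bump_mass _ = (\<integral>y. flat 0 (ball_gauge (0::'a) 1 y) \<partial>lebesgue)"

lemma locally_integrable_continuous: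
  fixes f :: "'a::euclidean_space \<Rightarrow> real"
  assumes "continuous_on UNIV f"
  shows "locally_integrable UNIV f"
  unfolding locally_integrable_def
proof (intro allI impI)
  fix K :: "'a set" assume "compact K \<and> K \<subseteq> UNIV"
  then have "integrable lborel (\<lambda>x. indicator K x *\<^sub>R f x)"
    using assms by (intro borel_integrable_compact) (auto intro: continuous_on_subset)
  then show "set_integrable lebesgue K f"
    unfolding set_integrable_def using integrable_completion borel_measurable_integrable by blast
qed

text \<open>The substitution y = x + r z carries the kernel to the unit ball, and its denominator
  cancels the Jacobian.\<close>

lemma integral_kernel:
  fixes x :: "'a::euclidean_space"
  assumes r: "0 < r"
  shows "(\<integral>y. flat 0 (ball_gauge x r y) / r ^ DIM('a) \<partial>lebesgue) = bump_mass TYPE('a)"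
proof -
  have bm: "(\<lambda>y. flat 0 (ball_gauge x r y)) \<in> borel_measurable borel" for x :: 'a and r
    by (intro borel_measurable_continuous_onI continuous_intros)
  have "(\<integral>y. flat 0 (ball_gauge x r y) / r ^ DIM('a) \<partial>lebesgue) = (\<integral>y. flat 0 (ball_gauge x r y) / r ^ DIM('a) \<partial>lborel)"
    using bm by (intro integral_completion) simp
  also have "\<dots> = (\<integral>y. flat 0 (ball_gauge x r y) / r ^ DIM('a) \<partial>density (distr lborel borel (\<lambda>y. x + r *\<^sub>R y)) (\<lambda>_. \<bar>r\<bar> ^ DIM('a)))"
    using r lborel_affine[of r x] by simp
  also have "\<dots> = (\<integral>y. r ^ DIM('a) *\<^sub>R (flat 0 (ball_gauge x r (x + r *\<^sub>R y)) / r ^ DIM('a)) \<partial>lborel)"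
    using r bm by (subst integral_density) (auto simp: integral_distr)
  also have "\<dots> = (\<integral>y. flat 0 (ball_gauge (0::'a) 1 y) \<partial>lborel)"
    using r by (simp add: ball_gauge_def power2_eq_square)
  also have "\<dots> = bump_mass TYPE('a)"
    unfolding bump_mass_def using bm by (intro integral_completion[symmetric]) simp
  finally show ?thesis .
qed

lemma bump_mass_pos: "0 < bump_mass TYPE('a::euclidean_space)"
proof -
  let ?f = "\<lambda>y::'a. flat 0 (ball_gauge 0 1 y)"
  have int: "integrable lebesgue ?f"
    using integrable_mult_kernel[OF locally_integrable_continuous[of "\<lambda>_::'a. 1"], of 1 0] by simp
  have "(\<integral>y. ?f y \<partial>lebesgue) \<noteq> 0"
  proof
    assume "(\<integral>y. ?f y \<partial>lebesgue) = 0"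
    then have "AE y in lebesgue. ?f y = 0"
      using integral_nonneg_eq_0_iff_AE[OF int] flat_nonneg by auto
    then have "AE y in lebesgue. y \<notin> ball (0::'a) 1"
    proof eventually_elim
      fix y :: 'a assume "?f y = 0"
      then show "y \<notin> ball 0 1"
        using ball_gauge_pos_iff[of 1 0 y] by (auto simp: flat_def split: if_splits)
    qed
    then have "ball (0::'a) 1 \<in> null_sets lebesgue"
      by (subst AE_iff_null_sets) auto
    then have "emeasure lebesgue (ball (0::'a) 1) = 0" by blast
    moreover have "0 < emeasure lebesgue (ball (0::'a) 1)"
      unfolding emeasure_lebesgue_ball[OF zero_le_one] by simp
    ultimately show False by simp
  qed
  moreover have "0 \<le> (\<integral>y. ?f y \<partial>lebesgue)" by (intro integral_nonneg_AE) (simp add: flat_nonneg)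
  ultimately show ?thesis by (simp add: bump_mass_def)
qed

lemma mollify_tendsto_continuous:
  fixes f :: "'a::euclidean_space \<Rightarrow> real"
  assumes f: "continuous_on UNIV f" and r: "\<And>n. 0 < r n" "r \<longlonglongrightarrow> 0"
  shows "(\<lambda>n. mollify f x (r n)) \<longlonglongrightarrow> bump_mass TYPE('a) * f x"
proof (rule tendstoI)
  fix e :: real assume e: "0 < e"
  let ?c = "bump_mass TYPE('a)"
  define \<eta> where "\<eta> = e / (2 * ?c)"
  have c: "0 < ?c" by (rule bump_mass_pos)
  have \<eta>: "0 < \<eta>" using e c by (simp add: \<eta>_def)
  obtain d where d: "0 < d" "\<And>y. dist y x < d \<Longrightarrow> dist (f y) (f x) < \<eta>"
    using f \<eta> by (metis UNIV_I continuous_on_iff)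
  have lf: "locally_integrable UNIV f" "locally_integrable UNIV (\<lambda>_::'a. c)" for c :: real
    using f by (auto intro: locally_integrable_continuous)
  have close: "\<bar>mollify f x \<rho> - ?c * f x\<bar> < e" if \<rho>: "0 < \<rho>" "\<rho> < d" for \<rho>
  proof -
    let ?K = "\<lambda>y. flat 0 (ball_gauge x \<rho> y) / \<rho> ^ DIM('a)"
    have "?c * f x = (\<integral>y. f x * ?K y \<partial>lebesgue)"
      unfolding integral_mult_right_zero integral_kernel[OF \<rho>(1)] by (rule mult.commute)
    then have "mollify f x \<rho> - ?c * f x = (\<integral>y. f y * ?K y - f x * ?K y \<partial>lebesgue)"
      unfolding mollify_def
      by (simp only: Bochner_Integration.integral_diff integrable_mult_kernel lf \<rho>)
    also have "norm \<dots> \<le> (\<integral>y. \<eta> * ?K y \<partial>lebesgue)"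
    proof (rule Bochner_Integration.integral_norm_bound_integral)
      show "integrable lebesgue (\<lambda>y. f y * ?K y - f x * ?K y)" "integrable lebesgue (\<lambda>y. \<eta> * ?K y)"
        by (intro Bochner_Integration.integrable_diff integrable_mult_kernel lf \<rho>)+
      fix y
      have K0: "0 \<le> ?K y" using flat_nonneg \<rho> by simp
      show "norm (f y * ?K y - f x * ?K y) \<le> \<eta> * ?K y"
      proof (cases "y \<in> ball x \<rho>")
        case True
        then have "\<bar>f y - f x\<bar> \<le> \<eta>"
          using d(2)[of y] \<rho> by (simp add: dist_real_def dist_commute less_imp_le)
        then have "\<bar>f y - f x\<bar> * ?K y \<le> \<eta> * ?K y" by (intro mult_right_mono K0)
        moreover have "norm (f y * ?K y - f x * ?K y) = \<bar>f y - f x\<bar> * ?K y"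
          unfolding left_diff_distrib[symmetric] real_norm_def abs_mult using K0 by (simp only: abs_of_nonneg)
        ultimately show ?thesis by simp
      qed (simp add: flat_ball_gauge_outside \<rho>)
    qed
    also have "\<dots> = \<eta> * ?c" unfolding integral_mult_right_zero integral_kernel[OF \<rho>(1)] ..
    also have "\<dots> < e" using c e by (simp add: \<eta>_def)
    finally show ?thesis by simp
  qed
  have "\<forall>\<^sub>F n in sequentially. r n < d" using r(2) d(1) by (rule order_tendstoD(2))
  then show "\<forall>\<^sub>F n in sequentially. dist (mollify f x (r n)) (?c * f x) < e"
    by eventually_elim (use close r(1) in \<open>auto simp: dist_real_def\<close>)
qed

text \<open>The kernel is at most r^(-N) on a ball of volume proportional to r^N. The set
  \<open>B\<close> localises the maximal function, since \<open>h\<close> need not be integrable on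
  the whole space.\<close>

lemma mollify_le_maximal:
  fixes h :: "'a::euclidean_space \<Rightarrow> real"
  assumes h: "locally_integrable UNIV h" and r: "0 < r" and B: "ball x r \<subseteq> B"
  shows "ennreal \<bar>mollify h x r\<bar> \<le> ennreal (unit_ball_vol DIM('a)) * maximal (\<lambda>y. ennreal \<bar>h y\<bar> * indicator B y) x"
proof -
  let ?K = "\<lambda>y. flat 0 (ball_gauge x r y) / r ^ DIM('a)" and ?v = "unit_ball_vol (real DIM('a))"
  have [measurable]: "h \<in> borel_measurable lebesgue" by (rule locally_integrable_borel_measurable[OF h])
  have [measurable]: "ball x r \<in> sets lebesgue" by simp
  have "ennreal \<bar>mollify h x r\<bar> \<le> (\<integral>\<^sup>+y. norm (h y * ?K y) \<partial>lebesgue)"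
    using integral_norm_bound_ennreal[OF integrable_mult_kernel[OF h r, of x]] by (simp add: mollify_def)
  also have "\<dots> \<le> (\<integral>\<^sup>+y. ennreal (1 / r ^ DIM('a)) * (ennreal \<bar>h y\<bar> * indicator (ball x r) y) \<partial>lebesgue)"
  proof (rule nn_integral_mono)
    fix y
    show "ennreal (norm (h y * ?K y)) \<le> ennreal (1 / r ^ DIM('a)) * (ennreal \<bar>h y\<bar> * indicator (ball x r) y)"
    proof (cases "y \<in> ball x r")
      case True
      have "?K y \<le> 1 / r ^ DIM('a)" using flat_le[of 0 "ball_gauge x r y"] r by (intro divide_right_mono) auto
      then have "\<bar>h y\<bar> * ?K y \<le> \<bar>h y\<bar> * (1 / r ^ DIM('a))" by (intro mult_left_mono) auto
      moreover have "norm (h y * ?K y) = \<bar>h y\<bar> * ?K y" using flat_nonneg[of 0 "ball_gauge x r y"] r by (simp add: abs_mult)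
      ultimately have "norm (h y * ?K y) \<le> 1 / r ^ DIM('a) * \<bar>h y\<bar>" by (simp only: mult.commute)
      then have "ennreal (norm (h y * ?K y)) \<le> ennreal (1 / r ^ DIM('a) * \<bar>h y\<bar>)" by (rule ennreal_leI)
      also have "\<dots> = ennreal (1 / r ^ DIM('a)) * ennreal \<bar>h y\<bar>" using r by (intro ennreal_mult) auto
      finally show ?thesis using True by simp
    qed (simp add: flat_ball_gauge_outside r)
  qed
  also have "\<dots> = ennreal (1 / r ^ DIM('a)) * (\<integral>\<^sup>+y. ennreal \<bar>h y\<bar> * indicator (ball x r) y \<partial>lebesgue)"
    by (rule nn_integral_cmult) measurable
  also have "\<dots> = ennreal (1 / r ^ DIM('a)) * (\<integral>\<^sup>+y. (ennreal \<bar>h y\<bar> * indicator B y) * indicator (ball x r) y \<partial>lebesgue)"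
  proof -
    have "indicator (ball x r) y = (indicator B y * indicator (ball x r) y :: ennreal)" for y
      using B by (auto simp: indicator_def)
    then show ?thesis by (metis (no_types, lifting) mult.assoc)
  qed
  also have "\<dots> \<le> ennreal (1 / r ^ DIM('a)) * (ennreal (measure lebesgue (ball x r)) * maximal (\<lambda>y. ennreal \<bar>h y\<bar> * indicator B y) x)"
    using r by (intro mult_left_mono nn_integral_ball_le_maximal) auto
  also have "\<dots> = ennreal ?v * maximal (\<lambda>y. ennreal \<bar>h y\<bar> * indicator B y) x"
    using r by (simp add: mult.assoc[symmetric] ennreal_mult[symmetric] content_ball)
  finally show ?thesis .
qed

section \<open>Lebesgue points\<close>

text \<open>Truncation at height k keeps continuous approximants continuous and makes them uniformly
  bounded.\<close>

definition clamp_at :: "nat \<Rightarrow> real \<Rightarrow> real" where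
  "clamp_at k t = max (- real k) (min (real k) t)"

lemma clamp_at_bounds: "\<bar>clamp_at k t\<bar> \<le> real k" "\<bar>t - clamp_at k t\<bar> \<le> \<bar>t\<bar>"
  by (auto simp: clamp_at_def)

lemma clamp_at_eventually: "\<forall>\<^sub>F k in sequentially. clamp_at k t = t"
proof -
  obtain m where "\<bar>t\<bar> \<le> real m" using real_arch_simple by blast
  then have "clamp_at k t = t" if "m \<le> k" for k using that by (auto simp: clamp_at_def)
  then show ?thesis by (auto simp: eventually_sequentially)
qed

lemma continuous_on_clamp_at [continuous_intros]:
  "continuous_on S f \<Longrightarrow> continuous_on S (\<lambda>x. clamp_at k (f x))"
  unfolding clamp_at_def by (intro continuous_intros)

lemma borel_measurable_clamp_at [measurable]: "clamp_at k \<in> borel_measurable borel"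
  by (intro borel_measurable_continuous_onI continuous_intros)

text \<open>A measurable function is almost everywhere a limit of continuous ones, but nothing
  dominates that sequence. Truncating \<open>u\<close>, and then the approximants at the same
  height, provides a dominating constant on the ball; dominated convergence is used once for each of
  the two steps.\<close>

lemma approx_continuous_L1_ball:
  fixes u :: "'a::euclidean_space \<Rightarrow> real"
  assumes lu: "locally_integrable UNIV u" and \<delta>: "0 < \<delta>"
  obtains f where "continuous_on UNIV f"
    "(\<integral>\<^sup>+y. ennreal \<bar>u y - f y\<bar> * indicator (ball 0 R) y \<partial>lebesgue) \<le> ennreal \<delta>"
proof -
  let ?B = "ball (0::'a) R"
  have um [measurable]: "u \<in> borel_measurable lebesgue" by (rule locally_integrable_borel_measurable[OF lu])
  have [measurable]: "?B \<in> sets lebesgue" by simp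
  have int_u: "integrable lebesgue (\<lambda>y. \<bar>u y\<bar> * indicator ?B y)"
  proof (rule Bochner_Integration.integrable_bound[OF integrable_norm_indicator_cball[OF lu, of 0 R]])
    show "AE y in lebesgue. norm (\<bar>u y\<bar> * indicator ?B y) \<le> norm (norm (u y) * indicator (cball 0 R) y)"
      by (rule AE_I2) (auto simp: indicator_def)
  qed measurable
  have "(\<lambda>k. \<integral>y. \<bar>u y - clamp_at k (u y)\<bar> * indicator ?B y \<partial>lebesgue) \<longlonglongrightarrow> (integral\<^sup>L lebesgue (\<lambda>_::'a. 0::real))"
  proof (rule integral_dominated_convergence[where w="\<lambda>y. \<bar>u y\<bar> * indicator ?B y"])
    show "integrable lebesgue (\<lambda>y. \<bar>u y\<bar> * indicator ?B y)" by (rule int_u)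
    show "AE y in lebesgue. (\<lambda>k. \<bar>u y - clamp_at k (u y)\<bar> * indicator ?B y) \<longlonglongrightarrow> 0"
    proof (rule AE_I2)
      fix y
      have "\<forall>\<^sub>F k in sequentially. \<bar>u y - clamp_at k (u y)\<bar> * indicator ?B y = (0::real)"
        using clamp_at_eventually[of "u y"] by eventually_elim simp
      then show "(\<lambda>k. \<bar>u y - clamp_at k (u y)\<bar> * indicator ?B y) \<longlonglongrightarrow> (0::real)"
        by (rule tendsto_eventually)
    qed
    show "AE y in lebesgue. norm (\<bar>u y - clamp_at k (u y)\<bar> * indicator ?B y) \<le> \<bar>u y\<bar> * indicator ?B y" for k
      by (rule AE_I2) (auto simp: indicator_def clamp_at_bounds)
  qed measurable
  then have "(\<lambda>k. \<integral>y. \<bar>u y - clamp_at k (u y)\<bar> * indicator ?B y \<partial>lebesgue) \<longlonglongrightarrow> 0" by simp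
  then have "\<forall>\<^sub>F k in sequentially. (\<integral>y. \<bar>u y - clamp_at k (u y)\<bar> * indicator ?B y \<partial>lebesgue) < \<delta> / 2"
    using \<delta> by (intro order_tendstoD(2)) auto
  then obtain k where k: "(\<integral>y. \<bar>u y - clamp_at k (u y)\<bar> * indicator ?B y \<partial>lebesgue) < \<delta> / 2"
    by (auto simp: eventually_sequentially)
  have "u measurable_on UNIV"
    using um by (simp add: lebesgue_measurable_imp_measurable_on)
  then obtain N g where N: "negligible N" and g: "\<And>n. continuous_on UNIV (g n)"
      "\<And>x. x \<notin> N \<Longrightarrow> (\<lambda>n. g n x) \<longlonglongrightarrow> u x"
    unfolding measurable_on_def by auto
  have gm [measurable]: "g n \<in> borel_measurable lebesgue" for n
    by (rule continuous_imp_borel_measurable_lebesgue[OF g(1)])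
  have clamp_diff: "\<bar>clamp_at k (u y) - clamp_at k (g n y)\<bar> \<le> 2 * real k" for y n
    using clamp_at_bounds(1)[of k "u y"] clamp_at_bounds(1)[of k "g n y"] by linarith
  have int_B: "integrable lebesgue (\<lambda>y. 2 * real k * indicator ?B y)"
    using emeasure_bounded_finite[OF bounded_ball[of "0::'a" R]]
    by (intro integrable_mult_right integrable_real_indicator) simp_all
  have "(\<lambda>n. \<integral>y. \<bar>clamp_at k (u y) - clamp_at k (g n y)\<bar> * indicator ?B y \<partial>lebesgue) \<longlonglongrightarrow> (integral\<^sup>L lebesgue (\<lambda>_::'a. 0::real))"
  proof (rule integral_dominated_convergence[where w="\<lambda>y. 2 * real k * indicator ?B y"])
    show "integrable lebesgue (\<lambda>y. 2 * real k * indicator ?B y)" by (rule int_B)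
    show "AE y in lebesgue. (\<lambda>n. \<bar>clamp_at k (u y) - clamp_at k (g n y)\<bar> * indicator ?B y) \<longlonglongrightarrow> 0"
      using AE_lebesgue_not_negligible[OF N]
    proof eventually_elim
      fix y assume "y \<notin> N"
      from g(2)[OF this] have "(\<lambda>n. \<bar>clamp_at k (u y) - clamp_at k (g n y)\<bar> * indicator ?B y)
          \<longlonglongrightarrow> \<bar>clamp_at k (u y) - clamp_at k (u y)\<bar> * indicator ?B y"
        unfolding clamp_at_def by (intro tendsto_intros)
      then show "(\<lambda>n. \<bar>clamp_at k (u y) - clamp_at k (g n y)\<bar> * indicator ?B y) \<longlonglongrightarrow> (0::real)" by simp
    qed
    show "AE y in lebesgue. norm (\<bar>clamp_at k (u y) - clamp_at k (g n y)\<bar> * indicator ?B y) \<le> 2 * real k * indicator ?B y" for n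
    proof (rule AE_I2)
      fix y
      show "norm (\<bar>clamp_at k (u y) - clamp_at k (g n y)\<bar> * indicator ?B y) \<le> 2 * real k * indicator ?B y"
        using clamp_diff[of y n] by (auto simp: indicator_def)
    qed
  qed measurable
  then have "(\<lambda>n. \<integral>y. \<bar>clamp_at k (u y) - clamp_at k (g n y)\<bar> * indicator ?B y \<partial>lebesgue) \<longlonglongrightarrow> 0" by simp
  then have "\<forall>\<^sub>F n in sequentially. (\<integral>y. \<bar>clamp_at k (u y) - clamp_at k (g n y)\<bar> * indicator ?B y \<partial>lebesgue) < \<delta> / 2"
    using \<delta> by (intro order_tendstoD(2)) auto
  then obtain n where n: "(\<integral>y. \<bar>clamp_at k (u y) - clamp_at k (g n y)\<bar> * indicator ?B y \<partial>lebesgue) < \<delta> / 2"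
    by (auto simp: eventually_sequentially)
  have int1: "integrable lebesgue (\<lambda>y. \<bar>u y - clamp_at k (u y)\<bar> * indicator ?B y)"
  proof (rule Bochner_Integration.integrable_bound[OF int_u])
    show "AE y in lebesgue. norm (\<bar>u y - clamp_at k (u y)\<bar> * indicator ?B y) \<le> norm (\<bar>u y\<bar> * indicator ?B y)"
      by (rule AE_I2) (auto simp: indicator_def clamp_at_bounds)
  qed measurable
  have int2: "integrable lebesgue (\<lambda>y. \<bar>clamp_at k (u y) - clamp_at k (g n y)\<bar> * indicator ?B y)"
  proof (rule Bochner_Integration.integrable_bound[OF int_B])
    show "AE y in lebesgue. norm (\<bar>clamp_at k (u y) - clamp_at k (g n y)\<bar> * indicator ?B y) \<le> norm (2 * real k * indicator ?B y)"
    proof (rule AE_I2)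
      fix y
      show "norm (\<bar>clamp_at k (u y) - clamp_at k (g n y)\<bar> * indicator ?B y) \<le> norm (2 * real k * indicator ?B y)"
        using clamp_diff[of y n] by (auto simp: indicator_def)
    qed
  qed measurable
  let ?F = "\<lambda>y. \<bar>u y - clamp_at k (u y)\<bar> * indicator ?B y + \<bar>clamp_at k (u y) - clamp_at k (g n y)\<bar> * indicator ?B y"
  have "(\<integral>\<^sup>+y. ennreal \<bar>u y - clamp_at k (g n y)\<bar> * indicator ?B y \<partial>lebesgue) \<le> (\<integral>\<^sup>+y. ennreal (?F y) \<partial>lebesgue)"
    by (intro nn_integral_mono) (auto simp: indicator_def simp flip: ennreal_plus intro!: ennreal_leI)
  also have "\<dots> = ennreal (\<integral>y. ?F y \<partial>lebesgue)"
    by (intro nn_integral_eq_integral Bochner_Integration.integrable_add int1 int2) (auto simp: indicator_def)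
  also have "\<dots> \<le> ennreal \<delta>"
    using k n by (intro ennreal_leI) (simp add: Bochner_Integration.integral_add[OF int1 int2])
  finally show ?thesis
    using g(1)[of n] by (intro that[of "\<lambda>y. clamp_at k (g n y)"] continuous_intros)
qed

text \<open>The Lebesgue differentiation argument. For a continuous \<open>f\<close> the averages
  converge; outside a set of small measure the error u - f is controlled by the weak-type bound for
  its maximal function and by Chebyshev's inequality for its values. Measurability of the
  exceptional set is avoided by covering it with sets of small measure.\<close>

lemma negligible_mollify_not_close:
  fixes u :: "'a::euclidean_space \<Rightarrow> real"
  assumes lu: "locally_integrable UNIV u" and r: "\<And>n. 0 < r n" "r \<longlonglongrightarrow> 0" and \<eta>: "0 < \<eta>"
  shows "negligible {x \<in> ball 0 R. \<not> (\<forall>\<^sub>F n in sequentially. \<bar>mollify u x (r n) - bump_mass TYPE('a) * u x\<bar> < \<eta>)}"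
    (is "negligible ?S")
  unfolding negligible_outer_le
proof (intro allI impI)
  fix e :: real assume e: "0 < e"
  let ?c = "bump_mass TYPE('a)" and ?v = "unit_ball_vol (real DIM('a))" and ?B = "ball (0::'a) R"
  have c: "0 < ?c" by (rule bump_mass_pos)
  have v: "0 < ?v" by simp
  then have v0: "?v \<noteq> 0" by (metis less_irrefl)
  have um [measurable]: "u \<in> borel_measurable lebesgue" by (rule locally_integrable_borel_measurable[OF lu])
  have [measurable]: "?B \<in> sets lebesgue" by simp
  \<comment> \<open>The thresholds become \<eta> / 3 after multiplication by the factor
    \<open>?v\<close> of \<open>mollify_le_maximal\<close> and the factor \<open>?c\<close> of the
    limit. K1 and K2 are the constants of the two measure estimates, and \<delta> is such that
    together they give \<open>e\<close>.\<close>
  define K1 where "K1 = 5 ^ DIM('a) / (\<eta> / (3 * ?v))"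
  define K2 where "K2 = 1 / (\<eta> / (3 * ?c))"
  have K: "0 < K1" "0 < K2" using c v \<eta> by (auto simp: K1_def K2_def)
  define \<delta> where "\<delta> = e / (K1 + K2)"
  have \<delta>: "0 < \<delta>" using e K by (simp add: \<delta>_def)
  obtain f where f: "continuous_on UNIV f"
    "(\<integral>\<^sup>+y. ennreal \<bar>u y - f y\<bar> * indicator ?B y \<partial>lebesgue) \<le> ennreal \<delta>"
    by (rule approx_continuous_L1_ball[OF lu \<delta>])
  have fm [measurable]: "f \<in> borel_measurable lebesgue"
    by (rule continuous_imp_borel_measurable_lebesgue[OF f(1)])
  have lf: "locally_integrable UNIV f" by (rule locally_integrable_continuous[OF f(1)])
  have luf: "locally_integrable UNIV (\<lambda>y. u y - f y)"
    using lu lf by (auto simp: locally_integrable_def)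
  let ?h = "\<lambda>y. ennreal \<bar>u y - f y\<bar> * indicator ?B y"
  define T1 where "T1 = {x. ennreal (\<eta> / (3 * ?v)) < maximal ?h x}"
  define T2 where "T2 = {x. \<eta> / (3 * ?c) \<le> \<bar>u x - f x\<bar> * indicator ?B x}"
  have T1: "T1 \<in> sets lebesgue" unfolding T1_def by (simp add: open_maximal_gt borel_open)
  have T2: "T2 \<in> sets lebesgue"
    using borel_measurable_le[of "\<lambda>_. \<eta> / (3 * ?c)" lebesgue "\<lambda>x. \<bar>u x - f x\<bar> * indicator ?B x"]
    unfolding T2_def by simp
  have "emeasure lebesgue T1 \<le> ennreal K1 * (\<integral>\<^sup>+y. ?h y \<partial>lebesgue)"
    unfolding T1_def K1_def using \<eta> v by (intro maximal_weak_type) auto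
  also have "\<dots> \<le> ennreal K1 * ennreal \<delta>" by (intro mult_left_mono f) simp
  finally have m1: "emeasure lebesgue T1 \<le> ennreal (K1 * \<delta>)" using K \<delta> by (simp add: ennreal_mult)
  have "emeasure lebesgue T2 = (\<integral>\<^sup>+y. indicator T2 y \<partial>lebesgue)" using T2 by simp
  also have "\<dots> \<le> (\<integral>\<^sup>+y. ennreal K2 * ?h y \<partial>lebesgue)"
  proof (rule nn_integral_mono)
    fix y
    show "indicator T2 y \<le> ennreal K2 * ?h y"
    proof (cases "y \<in> T2")
      case True
      have "0 < \<eta> / (3 * ?c)" using \<eta> c by simp
      then have yB: "y \<in> ?B" using True unfolding T2_def by (cases "y \<in> ?B") simp_all
      then have "\<eta> / (3 * ?c) \<le> \<bar>u y - f y\<bar>" using True by (simp add: T2_def)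
      then have "1 \<le> K2 * \<bar>u y - f y\<bar>" using \<eta> c by (simp add: K2_def field_simps)
      then have "ennreal 1 \<le> ennreal (K2 * \<bar>u y - f y\<bar>)" by (rule ennreal_leI)
      also have "\<dots> = ennreal K2 * ennreal \<bar>u y - f y\<bar>" using K by (intro ennreal_mult) auto
      finally show ?thesis using True yB by simp
    qed simp
  qed
  also have "\<dots> = ennreal K2 * (\<integral>\<^sup>+y. ?h y \<partial>lebesgue)" by (rule nn_integral_cmult) measurable
  also have "\<dots> \<le> ennreal K2 * ennreal \<delta>" by (intro mult_left_mono f) simp
  finally have m2: "emeasure lebesgue T2 \<le> ennreal (K2 * \<delta>)" using K \<delta> by (simp add: ennreal_mult)
  have "emeasure lebesgue (T1 \<union> T2) \<le> emeasure lebesgue T1 + emeasure lebesgue T2"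
    using T1 T2 by (rule emeasure_subadditive)
  also have "\<dots> \<le> ennreal (K1 * \<delta>) + ennreal (K2 * \<delta>)" by (intro add_mono m1 m2)
  also have "\<dots> = ennreal e"
  proof -
    have "K1 * \<delta> + K2 * \<delta> = e"
      using K unfolding distrib_right[symmetric] \<delta>_def by simp
    then show ?thesis using K \<delta> by (simp add: ennreal_plus[symmetric] del: ennreal_plus)
  qed
  finally have me: "emeasure lebesgue (T1 \<union> T2) \<le> ennreal e" .
  have "?S \<subseteq> T1 \<union> T2"
  proof (rule subsetI, rule ccontr)
    fix x assume xS: "x \<in> ?S" and xT: "x \<notin> T1 \<union> T2"
    then have xB: "x \<in> ?B" by simp
    have M: "maximal ?h x \<le> ennreal (\<eta> / (3 * ?v))" using xT by (simp add: T1_def not_less)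
    have uf: "?c * \<bar>u x - f x\<bar> < \<eta> / 3" using xT xB c by (simp add: T2_def field_simps)
    \<comment> \<open>Small balls around a point of the open ball stay inside it, where cutting off
      u - f has no effect.\<close>
    obtain d where d: "0 < d" "ball x d \<subseteq> ?B" using xB by (meson open_ball openE)
    have "\<forall>\<^sub>F n in sequentially. r n < d" using r(2) d(1) by (rule order_tendstoD(2))
    moreover have "\<forall>\<^sub>F n in sequentially. dist (mollify f x (r n)) (?c * f x) < \<eta> / 3"
      using \<eta> by (intro tendstoD mollify_tendsto_continuous f r) simp
    ultimately have "\<forall>\<^sub>F n in sequentially. \<bar>mollify u x (r n) - ?c * u x\<bar> < \<eta>"
    proof eventually_elim
      fix n assume n: "r n < d" "dist (mollify f x (r n)) (?c * f x) < \<eta> / 3"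
      have "ball x (r n) \<subseteq> ?B" using n(1) d(2) by (meson less_imp_le order_trans subset_ball)
      then have "ennreal \<bar>mollify (\<lambda>y. u y - f y) x (r n)\<bar> \<le> ennreal ?v * maximal ?h x"
        by (intro mollify_le_maximal luf r)
      also have "\<dots> \<le> ennreal ?v * ennreal (\<eta> / (3 * ?v))" by (intro mult_left_mono M) simp
      also have "\<dots> = ennreal (\<eta> / 3)" using \<eta> v0 by (simp add: ennreal_mult[symmetric])
      finally have "\<bar>mollify (\<lambda>y. u y - f y) x (r n)\<bar> \<le> \<eta> / 3" using \<eta> by (simp add: ennreal_le_iff)
      moreover have "mollify (\<lambda>y. u y - f y) x (r n) = mollify u x (r n) - mollify f x (r n)"
        unfolding mollify_def left_diff_distrib
        by (rule Bochner_Integration.integral_diff) (intro integrable_mult_kernel lu lf r)+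
      moreover have "\<bar>?c * f x - ?c * u x\<bar> < \<eta> / 3"
        using uf c by (simp add: right_diff_distrib[symmetric] abs_mult abs_minus_commute)
      ultimately show "\<bar>mollify u x (r n) - ?c * u x\<bar> < \<eta>"
        using n(2) unfolding dist_real_def by linarith
    qed
    then show False using xS by simp
  qed
  moreover have "T1 \<union> T2 \<in> lmeasurable"
    using T1 T2 me by (intro fmeasurableI) (auto intro: le_less_trans)
  moreover have "measure lebesgue (T1 \<union> T2) \<le> e"
    using me e by (simp add: measure_def enn2real_leI)
  ultimately show "\<exists>T. ?S \<subseteq> T \<and> T \<in> lmeasurable \<and> measure lebesgue T \<le> e" by blast
qed

lemma mollify_tendsto_outside_negligible:
  fixes u :: "'a::euclidean_space \<Rightarrow> real"
  assumes lu: "locally_integrable UNIV u" and r: "\<And>n. 0 < r n" "r \<longlonglongrightarrow> 0"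
  obtains Z where "negligible Z" "\<And>x. x \<notin> Z \<Longrightarrow> (\<lambda>n. mollify u x (r n)) \<longlonglongrightarrow> bump_mass TYPE('a) * u x"
proof
  let ?S = "\<lambda>R k. {x \<in> ball 0 (real R). \<not> (\<forall>\<^sub>F n in sequentially. \<bar>mollify u x (r n) - bump_mass TYPE('a) * u x\<bar> < inverse (real (Suc k)))}"
  show "negligible (\<Union>R. \<Union>k. ?S R k)"
    by (intro negligible_Union_nat negligible_mollify_not_close lu r) simp
  fix x assume x: "x \<notin> (\<Union>R. \<Union>k. ?S R k)"
  obtain R where R: "norm x < real R" using reals_Archimedean2 by blast
  show "(\<lambda>n. mollify u x (r n)) \<longlonglongrightarrow> bump_mass TYPE('a) * u x"
  proof (rule tendstoI)
    fix e :: real assume "0 < e"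
    then obtain k where k: "inverse (real (Suc k)) < e" using reals_Archimedean by blast
    have "\<forall>\<^sub>F n in sequentially. \<bar>mollify u x (r n) - bump_mass TYPE('a) * u x\<bar> < inverse (real (Suc k))"
      using x R by auto
    then show "\<forall>\<^sub>F n in sequentially. dist (mollify u x (r n)) (bump_mass TYPE('a) * u x) < e"
      by eventually_elim (use k in \<open>simp add: dist_real_def\<close>)
  qed
qed

text \<open>The averages at x and at y over small radii are both compared with the one of centre x
  and radius |x - y|; each comparison costs |x - y| times the maximal function at its own starting
  point. Letting the radii tend to 0 gives the inequality up to the factor \<open>bump_mass\<close>.
  The exceptional set collects the points without convergence and those with infinite maximal
  function.\<close>

lemma weak_gradient_hajlasz:
  fixes u :: "'a::euclidean_space \<Rightarrow> real" and p :: real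
  assumes g: "has_weak_gradient UNIV u g" and p: "1 < p"
    and fin: "(\<integral>\<^sup>+x. ennreal (norm (g x) powr p) \<partial>lebesgue) < \<infinity>"
  defines "c \<equiv> 2 ^ (DIM('a) + 1) * unit_ball_vol DIM('a) / bump_mass TYPE('a)"
  obtains h Z where "h \<in> borel_measurable lebesgue" "\<And>x. 0 \<le> h x" "negligible Z"
    "\<And>x y. x \<notin> Z \<Longrightarrow> y \<notin> Z \<Longrightarrow> \<bar>u x - u y\<bar> \<le> norm (x - y) * (h x + h y)"
    "(\<integral>\<^sup>+x. ennreal (h x powr p) \<partial>lebesgue)
      \<le> ennreal (c powr p * (5 ^ DIM('a) * p * 2 powr p / (p - 1))) * (\<integral>\<^sup>+x. ennreal (norm (g x) powr p) \<partial>lebesgue)"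
proof -
  let ?b = "bump_mass TYPE('a)" and ?v = "unit_ball_vol (real DIM('a))"
  have b: "0 < ?b" by (rule bump_mass_pos)
  have c: "0 < c" using b by (simp add: c_def)
  have lu: "locally_integrable UNIV u" and lg: "locally_integrable UNIV g"
    using g by (auto simp: has_weak_gradient_def)
  have gm [measurable]: "g \<in> borel_measurable lebesgue" by (rule locally_integrable_borel_measurable[OF lg])
  define r where "r n = inverse (real (Suc n))" for n
  have r: "0 < r n" "r \<longlonglongrightarrow> 0" for n
    unfolding r_def using LIMSEQ_inverse_real_of_nat by auto
  obtain Z0 where Z0: "negligible Z0" "\<And>x. x \<notin> Z0 \<Longrightarrow> (\<lambda>n. mollify u x (r n)) \<longlonglongrightarrow> ?b * u x"
    using mollify_tendsto_outside_negligible[OF lu r] by blast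
  define M where "M = maximal (\<lambda>y. ennreal (norm (g y)))"
  have Mm [measurable]: "M \<in> borel_measurable lebesgue"
    unfolding M_def by (rule measurable_completion) simp
  have strong: "(\<integral>\<^sup>+x. (if M x = \<infinity> then \<infinity> else ennreal (enn2real (M x) powr p)) \<partial>lebesgue)
    \<le> ennreal (5 ^ DIM('a) * p * 2 powr p / (p - 1)) * (\<integral>\<^sup>+x. ennreal (norm (g x) powr p) \<partial>lebesgue)"
    unfolding M_def by (rule maximal_strong_type) (use p in auto)
  also have "\<dots> < \<infinity>" using fin by (simp add: ennreal_mult_less_top)
  finally have "(\<integral>\<^sup>+x. (if M x = \<infinity> then \<infinity> else ennreal (enn2real (M x) powr p)) \<partial>lebesgue) \<noteq> \<infinity>" by simp
  then have "AE x in lebesgue. (if M x = \<infinity> then \<infinity> else ennreal (enn2real (M x) powr p)) \<noteq> \<infinity>"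
    by (intro nn_integral_PInf_AE) auto
  then have "AE x in lebesgue. x \<notin> {x. M x = \<infinity>}" by eventually_elim auto
  moreover have "{x. M x = \<infinity>} \<in> sets lebesgue"
    using measurable_sets[OF Mm, of "{\<infinity>}"] by (simp add: vimage_def)
  ultimately have "{x. M x = \<infinity>} \<in> null_sets lebesgue"
    by (simp add: AE_iff_null_sets)
  then have Z1: "negligible {x. M x = \<infinity>}" by (simp add: negligible_iff_null_sets)
  define h where "h x = c * enn2real (M x)" for x
  have h_meas: "h \<in> borel_measurable lebesgue" unfolding h_def by measurable
  have h_nonneg: "0 \<le> h x" for x using c by (simp add: h_def)
  have osc: "\<bar>u x - u y\<bar> \<le> norm (x - y) * (h x + h y)"
    if x: "x \<notin> Z0 \<union> {x. M x = \<infinity>}" and y: "y \<notin> Z0 \<union> {x. M x = \<infinity>}" for x y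
  proof (cases "x = y")
    case False
    define \<rho> where "\<rho> = norm (x - y)"
    have \<rho>: "0 < \<rho>" using False by (simp add: \<rho>_def)
    define mx my where "mx = enn2real (M x)" and "my = enn2real (M y)"
    have mx: "M x \<le> ennreal mx" "0 \<le> mx" and my: "M y \<le> ennreal my" "0 \<le> my"
      using x y by (auto simp: mx_def my_def top.not_eq_extremum)
    let ?C = "2 ^ (DIM('a) + 1) * ?v"
    have "\<forall>\<^sub>F n in sequentially. r n < \<rho>" using r(2) \<rho> by (rule order_tendstoD(2))
    then have "\<forall>\<^sub>F n in sequentially. \<bar>mollify u x (r n) - mollify u y (r n)\<bar> \<le> ?C * \<rho> * (mx + my)"
    proof eventually_elim
      fix n assume n: "r n < \<rho>"
      have "\<bar>mollify u x \<rho> - mollify u x (r n)\<bar> \<le> ?C * \<rho> * mx"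
        by (rule mollify_lipschitz[OF g mx(1)[unfolded M_def] mx(2)]) (use n r \<rho> in auto)
      \<comment> \<open>This path starts at y and ends at the centre x, whose distance from y equals
        the final radius, just what \<open>mollify_lipschitz\<close> permits.\<close>
      moreover have "\<bar>mollify u x \<rho> - mollify u y (r n)\<bar> \<le> ?C * \<rho> * my"
        by (rule mollify_lipschitz[OF g my(1)[unfolded M_def] my(2)]) (use n r \<rho> \<rho>_def in auto)
      ultimately show "\<bar>mollify u x (r n) - mollify u y (r n)\<bar> \<le> ?C * \<rho> * (mx + my)"
        by (simp add: distrib_left)
    qed
    moreover have "(\<lambda>n. \<bar>mollify u x (r n) - mollify u y (r n)\<bar>) \<longlonglongrightarrow> \<bar>?b * u x - ?b * u y\<bar>"
      using Z0(2) x y by (intro tendsto_intros) auto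
    ultimately have "\<bar>?b * u x - ?b * u y\<bar> \<le> ?C * \<rho> * (mx + my)"
      by (intro tendsto_upperbound[of _ _ sequentially]) auto
    then have "?b * \<bar>u x - u y\<bar> \<le> ?C * \<rho> * (mx + my)"
      using b by (simp add: right_diff_distrib[symmetric] abs_mult)
    then have "\<bar>u x - u y\<bar> \<le> ?C * \<rho> * (mx + my) / ?b"
      using b by (simp add: field_simps)
    then show ?thesis by (simp add: h_def c_def mx_def my_def \<rho>_def distrib_left mult_ac add_divide_distrib)
  qed simp
  have "(\<integral>\<^sup>+x. ennreal (h x powr p) \<partial>lebesgue)
      \<le> (\<integral>\<^sup>+x. ennreal (c powr p) * (if M x = \<infinity> then \<infinity> else ennreal (enn2real (M x) powr p)) \<partial>lebesgue)"
    using c by (intro nn_integral_mono) (auto simp: h_def powr_mult ennreal_mult ennreal_mult_top)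
  also have "\<dots> = ennreal (c powr p) * (\<integral>\<^sup>+x. (if M x = \<infinity> then \<infinity> else ennreal (enn2real (M x) powr p)) \<partial>lebesgue)"
    by (rule nn_integral_cmult) auto
  also have "\<dots> \<le> ennreal (c powr p) * (ennreal (5 ^ DIM('a) * p * 2 powr p / (p - 1)) * (\<integral>\<^sup>+x. ennreal (norm (g x) powr p) \<partial>lebesgue))"
    by (intro mult_left_mono strong) simp
  also have "\<dots> = ennreal (c powr p * (5 ^ DIM('a) * p * 2 powr p / (p - 1))) * (\<integral>\<^sup>+x. ennreal (norm (g x) powr p) \<partial>lebesgue)"
    using p by (simp add: mult.assoc[symmetric] ennreal_mult[symmetric])
  finally have h_norm: "(\<integral>\<^sup>+x. ennreal (h x powr p) \<partial>lebesgue) \<le> \<dots>" .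
  show ?thesis
    by (rule that[of h "Z0 \<union> {x. M x = \<infinity>}", OF h_meas h_nonneg negligible_Un[OF Z0(1) Z1] osc h_norm])
qed

section \<open>Embeddings\<close>

lemma ennreal_powr_ennreal: "0 \<le> x \<Longrightarrow> ennreal_powr (ennreal x) a = ennreal (x powr a)"
  by (simp add: ennreal_powr_def)

lemma ennreal_powr_less_top: "ennreal_powr x a < \<infinity> \<longleftrightarrow> x < \<infinity>"
  by (auto simp: ennreal_powr_def top.not_eq_extremum)

lemma ennreal_powr_inverse: "0 < p \<Longrightarrow> ennreal_powr (ennreal_powr x (1 / p)) p = x"
  by (cases x) (auto simp: ennreal_powr_def powr_powr)

text \<open>The \<open>p\<close>-th powers of the seminorm (put to \<open>0\<close> for \<open>s = 0\<close>) and of the norm on the whole space.\<close>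

definition seminorm_modular :: "real \<Rightarrow> real \<Rightarrow> ('a::euclidean_space \<Rightarrow> real) \<Rightarrow> ennreal" where
  "seminorm_modular s p u =
     (if s = 0 then 0
      else if s = 1 then
        (if \<exists>g. has_weak_gradient UNIV u g
         then \<integral>\<^sup>+x. ennreal (norm (weak_gradient UNIV u x) powr p) \<partial>lebesgue else \<infinity>)
      else ennreal (sobolev_const DIM('a) s p) *
        (\<integral>\<^sup>+(x, y). ennreal (\<bar>u x - u y\<bar> powr p / norm (x - y) powr (real DIM('a) + s * p))
              \<partial>(lebesgue \<Otimes>\<^sub>M lebesgue)))"

definition sobolev_modular :: "real \<Rightarrow> real \<Rightarrow> ('a::euclidean_space \<Rightarrow> real) \<Rightarrow> ennreal" where
  "sobolev_modular s p u = seminorm_modular s p u + (\<integral>\<^sup>+x. ennreal (\<bar>u x\<bar> powr p) \<partial>lebesgue)"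

lemma Lp_norm_UNIV:
  "Lp_norm UNIV p f = ennreal_powr (\<integral>\<^sup>+x. ennreal (norm (f x) powr p) \<partial>lebesgue) (1 / p)"
  by (simp add: Lp_norm_def lebesgue_on_UNIV_eq)

lemma sobolev_seminorm_UNIV:
  assumes "s \<noteq> 0"
  shows "sobolev_seminorm UNIV s p u = ennreal_powr (seminorm_modular s p u) (1 / p)"
proof -
  have "ennreal_powr \<infinity> a = \<infinity>" for a by (simp add: ennreal_powr_def)
  then show ?thesis
    using assms unfolding sobolev_seminorm_def seminorm_modular_def Lp_norm_UNIV lebesgue_on_UNIV_eq
    by (cases "\<exists>g. has_weak_gradient UNIV u g") auto
qed

lemma sobolev_norm_UNIV:
  assumes "0 < p"
  shows "sobolev_norm UNIV s p u = ennreal_powr (sobolev_modular s p u) (1 / p)"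
proof (cases "s = 0")
  case True
  then show ?thesis by (simp add: sobolev_norm_def sobolev_modular_def seminorm_modular_def Lp_norm_UNIV)
next
  case False
  then show ?thesis using assms
    by (simp add: sobolev_norm_def sobolev_seminorm_UNIV Lp_norm_UNIV ennreal_powr_inverse sobolev_modular_def)
qed

lemma mem_sobolev_space_UNIV_iff:
  "u \<in> sobolev_space UNIV s p \<longleftrightarrow> u \<in> borel_measurable lebesgue \<and> sobolev_modular s p u < \<infinity>"
proof (cases "s = 0")
  case True
  then show ?thesis
    by (simp add: sobolev_space_def sobolev_seminorm_def sobolev_modular_def seminorm_modular_def
        Lp_norm_UNIV ennreal_powr_less_top[unfolded infinity_ennreal_def] lebesgue_on_UNIV_eq)
next
  case False
  then show ?thesis
    by (auto simp: sobolev_space_def sobolev_seminorm_UNIV sobolev_modular_def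
        Lp_norm_UNIV ennreal_powr_less_top[unfolded infinity_ennreal_def] lebesgue_on_UNIV_eq)
qed

text \<open>Norms are roots of modulars, so homogeneity dictates the power q / p; the embedding
  constant is then \<open>C powr (1 / q)\<close>.\<close>

lemma sobolev_embeddedI:
  fixes s p t q C :: real
  assumes p: "0 < p" and q: "0 < q" and C: "0 < C"
    and le: "\<And>(u :: 'a::euclidean_space \<Rightarrow> real) \<alpha>. u \<in> borel_measurable lebesgue \<Longrightarrow>
      sobolev_modular s p u = ennreal \<alpha> \<Longrightarrow> 0 \<le> \<alpha> \<Longrightarrow>
      sobolev_modular t q u \<le> ennreal (C * \<alpha> powr (q / p))"
  shows "sobolev_embedded (UNIV :: 'a set) (s, p) (t, q)"
proof -
  have *: "u \<in> sobolev_space UNIV t q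
      \<and> sobolev_norm UNIV t q u \<le> ennreal (C powr (1 / q)) * sobolev_norm UNIV s p u"
    if u: "u \<in> sobolev_space UNIV s p" for u :: "'a \<Rightarrow> real"
  proof -
    have um: "u \<in> borel_measurable lebesgue" and fin: "sobolev_modular s p u < \<infinity>"
      using u by (auto simp: mem_sobolev_space_UNIV_iff)
    obtain \<alpha> where \<alpha>: "sobolev_modular s p u = ennreal \<alpha>" "0 \<le> \<alpha>"
      using fin by (cases "sobolev_modular s p u") auto
    have bd: "sobolev_modular t q u \<le> ennreal (C * \<alpha> powr (q / p))" by (rule le[OF um \<alpha>])
    then have "sobolev_modular t q u < \<infinity>" by (rule le_less_trans) simp
    then obtain \<beta> where \<beta>: "sobolev_modular t q u = ennreal \<beta>" "0 \<le> \<beta>"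
      by (cases "sobolev_modular t q u") auto
    have "\<beta> \<le> C * \<alpha> powr (q / p)" using bd \<beta> C by (simp add: ennreal_le_iff)
    then have "\<beta> powr (1 / q) \<le> (C * \<alpha> powr (q / p)) powr (1 / q)"
      using \<beta> q by (intro powr_mono2) auto
    also have "\<dots> = C powr (1 / q) * \<alpha> powr (1 / p)"
      using q by (simp add: powr_mult powr_powr)
    finally have "sobolev_norm UNIV t q u \<le> ennreal (C powr (1 / q)) * sobolev_norm UNIV s p u"
      using p q \<alpha> \<beta> by (simp add: sobolev_norm_UNIV ennreal_powr_ennreal ennreal_mult[symmetric] ennreal_leI)
    then show ?thesis using um \<beta> by (simp add: mem_sobolev_space_UNIV_iff)
  qed
  show ?thesis
    unfolding sobolev_embedded_def using * C by (auto intro!: exI[of _ "C powr (1 / q)"])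
qed

lemma sobolev_embedded_refl:
  assumes "0 < p"
  shows "sobolev_embedded UNIV (s, p) (s, p)"
  using assms by (intro sobolev_embeddedI[where C=1]) auto

text \<open>The scale parameter \<open>W\<close> is kept free here because the optimal choice \<open>A = W powr p\<close>
  is not available when \<open>A = 0\<close>.\<close>

lemma le_powr_of_scale:
  fixes p q C \<alpha> :: real
  assumes p: "0 < p" and q: "0 < q" and \<alpha>: "0 \<le> \<alpha>" and C: "0 \<le> C"
    and le: "\<And>W. 0 < W \<Longrightarrow> \<alpha> \<le> W powr p \<Longrightarrow> T \<le> ennreal (C * W powr q)"
  shows "T \<le> ennreal (C * \<alpha> powr (q / p))"
proof (cases "\<alpha> = 0")
  case False
  then show ?thesis using le[of "\<alpha> powr (1 / p)"] \<alpha> p by (simp add: powr_powr)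
next
  case True
  have small: "T \<le> ennreal e" if e: "0 < e" for e
  proof -
    define W where "W = (e / (C + 1)) powr (1 / q)"
    have W: "0 < W" using e C by (simp add: W_def)
    have "W powr q = e / (C + 1)" using e C q by (simp add: W_def powr_powr)
    then have "(C + 1) * W powr q = e" using C by simp
    then have "C * W powr q \<le> e" using powr_ge_zero[of W q] by (simp only: distrib_right mult_1_left)
    then show ?thesis using le[OF W] True by (meson ennreal_leI order_trans powr_ge_zero)
  qed
  have "T \<le> 0" by (rule ennreal_le_epsilon) (simp add: small)
  then show ?thesis by simp
qed

text \<open>Takes the constants out of the locale: they are fixed before \<open>u\<close>,
  \<open>w\<close>, \<open>Z\<close> and \<open>W\<close>. Absolute values and the added 1 give one
  positive constant for both bounds.\<close>

lemma hajlasz_uniform_bounds: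
  fixes s p t q :: real
  assumes "0 < s" "1 \<le> p" "s * p < DIM('a::euclidean_space)" "0 \<le> t" "t < s" "p \<le> q"
    and "q \<le> DIM('a) * p / (DIM('a) - (s - t) * p)"
  obtains C where "0 < C"
    "\<And>u w Z W. hajlasz s p W (u :: 'a \<Rightarrow> real) w Z \<Longrightarrow>
       (\<integral>\<^sup>+x. ennreal (\<bar>u x\<bar> powr q) \<partial>lebesgue) \<le> ennreal (C * W powr q)"
    "\<And>u w Z W. hajlasz s p W (u :: 'a \<Rightarrow> real) w Z \<Longrightarrow> t \<noteq> 0 \<Longrightarrow>
       (\<integral>\<^sup>+(x, y). ennreal (\<bar>u x - u y\<bar> powr q / norm (x - y) powr (real DIM('a) + t * q))
              \<partial>(lebesgue \<Otimes>\<^sub>M lebesgue)) \<le> ennreal (C * W powr q)"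
proof -
  define A where "A = hajlasz.decay_const TYPE('a) s p powr q"
  define B where "B = hajlasz.seminorm_const TYPE('a) s p t q"
  have C: "0 < \<bar>A\<bar> + \<bar>B\<bar> + 1" by simp
  have AB: "ennreal (A * X) \<le> ennreal ((\<bar>A\<bar> + \<bar>B\<bar> + 1) * X)" "ennreal (B * X) \<le> ennreal ((\<bar>A\<bar> + \<bar>B\<bar> + 1) * X)"
    if "0 \<le> X" for X
    using that by (auto intro!: ennreal_leI mult_right_mono)
  \<comment> \<open>The upper limit for \<open>q\<close> decreases as \<open>t\<close> grows, so the
    given \<open>q\<close> is also admissible for t = 0, as the L^q bound asks.\<close>
  have "(s - t) * p \<le> s * p" using assms by (intro mult_right_mono) auto
  moreover from this have "0 < DIM('a) - (s - t) * p" "0 < DIM('a) - s * p" using assms by linarith+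
  ultimately have "DIM('a) * p / (DIM('a) - (s - t) * p) \<le> DIM('a) * p / (DIM('a) - s * p)"
    using assms by (intro divide_left_mono mult_pos_pos) auto
  then have q: "q \<le> DIM('a) * p / (DIM('a) - s * p)" using assms by linarith
  show ?thesis
  proof (rule that[OF C])
    fix u w :: "'a \<Rightarrow> real" and Z W assume h: "hajlasz s p W u w Z"
    show "(\<integral>\<^sup>+x. ennreal (\<bar>u x\<bar> powr q) \<partial>lebesgue) \<le> ennreal ((\<bar>A\<bar> + \<bar>B\<bar> + 1) * W powr q)"
      by (rule order.trans[OF hajlasz.Lq_bound[OF h \<open>p \<le> q\<close> q, folded A_def] AB(1)]) simp
    assume "t \<noteq> 0"
    then have "0 < t" using assms by simp
    from hajlasz.seminorm_bound[OF h this \<open>t < s\<close> \<open>p \<le> q\<close> assms(7)]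
    show "(\<integral>\<^sup>+(x, y). ennreal (\<bar>u x - u y\<bar> powr q / norm (x - y) powr (real DIM('a) + t * q))
              \<partial>(lebesgue \<Otimes>\<^sub>M lebesgue)) \<le> ennreal ((\<bar>A\<bar> + \<bar>B\<bar> + 1) * W powr q)"
      unfolding B_def[symmetric] by (rule order.trans[OF _ AB(2)]) simp
  qed
qed

text \<open>Adding |u| to \<open>h\<close> secures the bound of \<open>u\<close> by \<open>w\<close>
  and only weakens the increment inequality. It is the reason why the full norm, not the seminorm
  alone, governs \<open>W\<close>.\<close>

lemma hajlaszI:
  fixes u h :: "'a::euclidean_space \<Rightarrow> real" and s p W c :: real
  assumes s: "0 < s" and p: "1 \<le> p" "s * p < DIM('a)" and W: "0 < W"
    and u: "u \<in> borel_measurable lebesgue" and h: "h \<in> borel_measurable lebesgue" "\<And>x. 0 \<le> h x"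
    and Z: "negligible Z"
    and osc: "\<And>x y. x \<notin> Z \<Longrightarrow> y \<notin> Z \<Longrightarrow> \<bar>u x - u y\<bar> \<le> norm (x - y) powr s * (h x + h y)"
    and c: "0 \<le> c" "(\<integral>\<^sup>+x. ennreal (h x powr p) \<partial>lebesgue) \<le> ennreal c * X"
    and le: "ennreal (2 powr p * (c + 1)) * (X + (\<integral>\<^sup>+x. ennreal (\<bar>u x\<bar> powr p) \<partial>lebesgue)) \<le> ennreal (W powr p)"
  shows "hajlasz s p W u (\<lambda>x. h x + \<bar>u x\<bar>) Z"
proof
  note [measurable] = u h(1)
  show "(\<lambda>x. h x + \<bar>u x\<bar>) \<in> borel_measurable lebesgue" by measurable
  show "\<bar>u x - u y\<bar> \<le> norm (x - y) powr s * (h x + \<bar>u x\<bar> + (h y + \<bar>u y\<bar>))" if "x \<notin> Z" "y \<notin> Z" for x y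
    by (rule order.trans[OF osc[OF that]]) (intro mult_left_mono, auto)
  have "(\<integral>\<^sup>+x. ennreal ((h x + \<bar>u x\<bar>) powr p) \<partial>lebesgue)
     \<le> (\<integral>\<^sup>+x. ennreal (2 powr p) * (ennreal (h x powr p) + ennreal (\<bar>u x\<bar> powr p)) \<partial>lebesgue)"
  proof (rule nn_integral_mono)
    fix x
    have "(h x + \<bar>u x\<bar>) powr p \<le> 2 powr p * (h x powr p + \<bar>u x\<bar> powr p)"
      using h(2)[of x] p by (intro powr_add_le) auto
    then show "ennreal ((h x + \<bar>u x\<bar>) powr p) \<le> ennreal (2 powr p) * (ennreal (h x powr p) + ennreal (\<bar>u x\<bar> powr p))"
      by (simp add: ennreal_plus[symmetric] ennreal_mult[symmetric] ennreal_leI del: ennreal_plus)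
  qed
  also have "\<dots> = ennreal (2 powr p) * ((\<integral>\<^sup>+x. ennreal (h x powr p) \<partial>lebesgue) + (\<integral>\<^sup>+x. ennreal (\<bar>u x\<bar> powr p) \<partial>lebesgue))"
    by (subst nn_integral_cmult, measurable, subst nn_integral_add, measurable)
  also have "\<dots> \<le> ennreal (2 powr p) * (ennreal (c + 1) * X + ennreal (c + 1) * (\<integral>\<^sup>+x. ennreal (\<bar>u x\<bar> powr p) \<partial>lebesgue))"
  proof (intro mult_left_mono add_mono)
    show "(\<integral>\<^sup>+x. ennreal (h x powr p) \<partial>lebesgue) \<le> ennreal (c + 1) * X"
      using c by (meson ennreal_leI le_add_same_cancel1 mult_right_mono order_trans zero_le zero_le_one)
    show "(\<integral>\<^sup>+x. ennreal (\<bar>u x\<bar> powr p) \<partial>lebesgue) \<le> ennreal (c + 1) * (\<integral>\<^sup>+x. ennreal (\<bar>u x\<bar> powr p) \<partial>lebesgue)"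
      using c mult_right_mono[of 1 "ennreal (c + 1)"] by (simp add: ennreal_leI[of 1, simplified])
  qed simp
  also have "\<dots> = ennreal (2 powr p * (c + 1)) * (X + (\<integral>\<^sup>+x. ennreal (\<bar>u x\<bar> powr p) \<partial>lebesgue))"
    using c by (subst ennreal_mult) (simp_all only: distrib_left mult.assoc powr_ge_zero add_nonneg_nonneg zero_le_one)
  finally show "(\<integral>\<^sup>+x. ennreal ((h x + \<bar>u x\<bar>) powr p) \<partial>lebesgue) \<le> ennreal (W powr p)"
    using le by (rule order.trans)
qed (use s p W u h Z in auto)

text \<open>The ball with diameter from x to y contains a point z at which the sum of the two
  Gagliardo kernels is at most twice its average. Distances from x and y to z are below |x - y|, so
  the increments through z are bounded by |x - y|^s times p-th roots of the partial integrals
  \<open>G\<close>. This works for p = 1 too.\<close>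

lemma gagliardo_hajlasz:
  fixes u :: "'a::euclidean_space \<Rightarrow> real" and s p :: real
  assumes s: "0 < s" and p: "1 \<le> p" and u: "u \<in> borel_measurable lebesgue"
  defines "J \<equiv> (\<integral>\<^sup>+(x, y). ennreal (\<bar>u x - u y\<bar> powr p / norm (x - y) powr (real DIM('a) + s * p))
              \<partial>(lebesgue \<Otimes>\<^sub>M lebesgue))"
  assumes fin: "J < \<infinity>"
  obtains h Z where "h \<in> borel_measurable lebesgue" "\<And>x. 0 \<le> h x" "negligible Z"
    "\<And>x y. x \<notin> Z \<Longrightarrow> y \<notin> Z \<Longrightarrow> \<bar>u x - u y\<bar> \<le> norm (x - y) powr s * (h x + h y)"
    "(\<integral>\<^sup>+x. ennreal (h x powr p) \<partial>lebesgue) \<le> ennreal (4 powr p * (2 ^ (DIM('a) + 1) / unit_ball_vol DIM('a))) * J"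
proof -
  let ?N = "DIM('a)" and ?v = "unit_ball_vol (real DIM('a))"
  note [measurable] = u
  have v: "0 < ?v" by simp
  have [measurable]: "(\<lambda>x. x) \<in> lebesgue \<rightarrow>\<^sub>M (borel :: 'a measure)" by (rule measurable_completion) simp
  define k where "k x y = ennreal (\<bar>u x - u y\<bar> powr p / norm (x - y) powr (real ?N + s * p))" for x y
  have k_meas: "(\<lambda>(x, y). k x y) \<in> borel_measurable (lebesgue \<Otimes>\<^sub>M lebesgue)"
    unfolding k_def split_beta by measurable
  have k_meas2: "k x \<in> borel_measurable lebesgue" for x
    unfolding k_def by measurable
  define G where "G x = (\<integral>\<^sup>+y. k x y \<partial>lebesgue)" for x
  have G_meas [measurable]: "G \<in> borel_measurable lebesgue"
    unfolding G_def using lebesgue.borel_measurable_nn_integral_fst[OF k_meas] by simp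
  have GJ: "(\<integral>\<^sup>+x. G x \<partial>lebesgue) = J"
    unfolding G_def J_def using lebesgue.nn_integral_fst[OF k_meas] by (simp add: k_def[abs_def])
  then have "AE x in lebesgue. G x \<noteq> \<infinity>"
    using fin by (intro nn_integral_PInf_AE) auto
  then have "AE x in lebesgue. x \<notin> {x. G x = \<infinity>}" by eventually_elim auto
  moreover have "{x. G x = \<infinity>} \<in> sets lebesgue"
    using measurable_sets[OF G_meas, of "{\<infinity>}"] by (simp add: vimage_def)
  ultimately have "{x. G x = \<infinity>} \<in> null_sets lebesgue" by (simp add: AE_iff_null_sets)
  then have Z: "negligible {x. G x = \<infinity>}" by (simp add: negligible_iff_null_sets)
  \<comment> \<open>One 2 is that of the twofold average; 2^N comes from the volume of a ball of
    radius r / 2.\<close>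
  define K where "K = 2 ^ (?N + 1) / ?v"
  have K: "0 < K" using v by (simp add: K_def)
  define g where "g x = enn2real (G x)" for x
  have g: "0 \<le> g x" for x by (simp add: g_def)
  \<comment> \<open>Half of the 4 adds the two increments through z, the other half absorbs
    \<open>2 powr (1 / p)\<close> from splitting the root of a sum.\<close>
  define h where "h x = 4 * (K * g x) powr (1 / p)" for x
  have h_meas: "h \<in> borel_measurable lebesgue" unfolding h_def g_def by measurable
  have h_nonneg: "0 \<le> h x" for x by (simp add: h_def)
  have osc: "\<bar>u x - u y\<bar> \<le> norm (x - y) powr s * (h x + h y)"
    if x: "x \<notin> {x. G x = \<infinity>}" and y: "y \<notin> {x. G x = \<infinity>}" for x y
  proof (cases "x = y")
    case False
    define r where "r = norm (x - y)"
    have r: "0 < r" using False by (simp add: r_def)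
    define B where "B = ball ((1/2) *\<^sub>R (x + y)) (r / 2)"
    have Gx: "G x = ennreal (g x)" and Gy: "G y = ennreal (g y)"
      using x y by (auto simp: g_def top.not_eq_extremum)
    have "(\<integral>\<^sup>+z. (k x z + k y z) * indicator B z \<partial>lebesgue) \<le> (\<integral>\<^sup>+z. k x z + k y z \<partial>lebesgue)"
      by (intro nn_integral_mono) (auto simp: indicator_def)
    also have "\<dots> = ennreal (g x + g y)"
      using g by (subst nn_integral_add) (simp_all add: k_meas2 G_def[symmetric] Gx Gy)
    finally have le: "(\<integral>\<^sup>+z. (k x z + k y z) * indicator B z \<partial>lebesgue) \<le> ennreal (g x + g y)" .
    have km: "(\<lambda>z. k x z + k y z) \<in> borel_measurable lebesgue"
      by (intro borel_measurable_add k_meas2)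
    have Bs: "B \<in> sets lebesgue" by (simp add: B_def)
    have Be: "emeasure lebesgue B = ennreal (?v * (r / 2) ^ ?N)"
      unfolding B_def by (rule emeasure_lebesgue_ball) (use r in simp)
    obtain z where z: "z \<in> B" "k x z + k y z \<le> ennreal (2 * (g x + g y) / (?v * (r / 2) ^ ?N))"
      by (rule exists_le_twice_average[OF km negligible_empty Bs Be _ le]) (use v r g that in auto)
    have m1: "norm (x - z) < r"
    proof -
      have eq: "x - z = (1/2) *\<^sub>R (x - y) + ((1/2) *\<^sub>R (x + y) - z)"
        by (simp add: algebra_simps flip: scaleR_add_left)
      have "norm (x - z) \<le> norm ((1/2) *\<^sub>R (x - y)) + norm ((1/2) *\<^sub>R (x + y) - z)"
        unfolding eq by (rule norm_triangle_ineq)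
      also have "norm ((1/2) *\<^sub>R (x - y)) = r / 2" by (simp add: r_def norm_minus_commute)
      finally show ?thesis using z(1) by (simp add: B_def dist_norm)
    qed
    have m2: "norm (y - z) < r"
    proof -
      have eq: "y - z = (1/2) *\<^sub>R (y - x) + ((1/2) *\<^sub>R (x + y) - z)"
        by (simp add: algebra_simps flip: scaleR_add_left)
      have "norm (y - z) \<le> norm ((1/2) *\<^sub>R (y - x)) + norm ((1/2) *\<^sub>R (x + y) - z)"
        unfolding eq by (rule norm_triangle_ineq)
      also have "norm ((1/2) *\<^sub>R (y - x)) = r / 2" by (simp add: r_def norm_minus_commute)
      finally show ?thesis using z(1) by (simp add: B_def dist_norm)
    qed
    have e: "0 \<le> real ?N + s * p" using s p by simp
    have diff: "\<bar>u a - u z\<bar> powr p \<le> r powr (real ?N + s * p) * (\<bar>u a - u z\<bar> powr p / norm (a - z) powr (real ?N + s * p))"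
      if "norm (a - z) < r" for a
    proof (cases "a = z")
      case False
      then have "norm (a - z) powr (real ?N + s * p) \<le> r powr (real ?N + s * p)"
        using that e by (intro powr_mono2) auto
      then have "\<bar>u a - u z\<bar> powr p * (norm (a - z) powr (real ?N + s * p) / norm (a - z) powr (real ?N + s * p))
          \<le> \<bar>u a - u z\<bar> powr p * (r powr (real ?N + s * p) / norm (a - z) powr (real ?N + s * p))"
        by (intro mult_left_mono divide_right_mono) auto
      then show ?thesis using False by (simp add: mult_ac)
    qed simp
    define Q where "Q = K * r powr (s * p) * (g x + g y)"
    have "\<bar>u x - u z\<bar> powr p / norm (x - z) powr (real ?N + s * p) + \<bar>u y - u z\<bar> powr p / norm (y - z) powr (real ?N + s * p)
        \<le> 2 * (g x + g y) / (?v * (r / 2) ^ ?N)"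
      using z(2) v r g unfolding k_def
      by (subst (asm) ennreal_plus[symmetric], simp, simp, subst (asm) ennreal_le_iff)
         (auto intro!: divide_nonneg_nonneg mult_nonneg_nonneg)
    then have "r powr (real ?N + s * p) * (\<bar>u x - u z\<bar> powr p / norm (x - z) powr (real ?N + s * p) + \<bar>u y - u z\<bar> powr p / norm (y - z) powr (real ?N + s * p))
        \<le> r powr (real ?N + s * p) * (2 * (g x + g y) / (?v * (r / 2) ^ ?N))"
      by (intro mult_left_mono) auto
    also have "\<dots> = Q"
    proof -
      have "rn * R * (2 * X / (V * (rn / m))) = 2 * m / V * R * X"
        if "rn \<noteq> 0" "m \<noteq> 0" "V \<noteq> 0" for rn R X V m :: real
        using that by (simp add: field_simps)
      from this[of "r ^ ?N" "2 ^ ?N" ?v "r powr (s * p)" "g x + g y"] show ?thesis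
        using r less_imp_neq[OF v] by (simp add: Q_def K_def powr_add powr_realpow power_divide)
    qed
    finally have sum_le: "\<bar>u x - u z\<bar> powr p + \<bar>u y - u z\<bar> powr p \<le> Q"
      using diff[OF m1] diff[OF m2] by (simp add: distrib_left)
    have root: "\<bar>u a - u z\<bar> \<le> Q powr (1 / p)" if "\<bar>u a - u z\<bar> powr p \<le> Q" for a
      using powr_mono2[OF _ _ that, of "1 / p"] p by (simp add: powr_powr)
    have "\<bar>u x - u z\<bar> powr p \<le> Q" "\<bar>u y - u z\<bar> powr p \<le> Q"
      using sum_le powr_ge_zero[of "\<bar>u x - u z\<bar>" p] powr_ge_zero[of "\<bar>u y - u z\<bar>" p] by linarith+
    then have a1: "\<bar>u x - u z\<bar> \<le> Q powr (1 / p)" and a2: "\<bar>u y - u z\<bar> \<le> Q powr (1 / p)"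
      using root by blast+
    have "Q = r powr (s * p) * (K * g x + K * g y)" by (simp add: Q_def algebra_simps)
    then have "Q powr (1 / p) = r powr s * (K * g x + K * g y) powr (1 / p)"
      using p by (simp add: powr_mult powr_powr)
    also have "\<dots> \<le> r powr s * (2 powr (1 / p) * ((K * g x) powr (1 / p) + (K * g y) powr (1 / p)))"
      using K g p by (intro mult_left_mono powr_add_le) auto
    also have "\<dots> \<le> r powr s * (2 * ((K * g x) powr (1 / p) + (K * g y) powr (1 / p)))"
      using p powr_mono[of "1 / p" 1 2] by (intro mult_left_mono mult_right_mono) auto
    finally have "2 * Q powr (1 / p) \<le> r powr s * (h x + h y)"
      by (simp add: h_def algebra_simps)
    then show ?thesis using a1 a2 unfolding r_def by linarith
  qed simp
  have "(\<integral>\<^sup>+x. ennreal (h x powr p) \<partial>lebesgue) \<le> (\<integral>\<^sup>+x. ennreal (4 powr p * K) * G x \<partial>lebesgue)"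
  proof (rule nn_integral_mono)
    fix x
    show "ennreal (h x powr p) \<le> ennreal (4 powr p * K) * G x"
    proof (cases "G x")
      case (real a)
      then show ?thesis using p K g[of x] by (simp add: h_def g_def powr_mult powr_powr ennreal_mult[symmetric] mult.assoc)
    next
      case top
      then show ?thesis using K by (simp add: ennreal_mult_top)
    qed
  qed
  also have "\<dots> = ennreal (4 powr p * K) * J"
    unfolding GJ[symmetric] by (rule nn_integral_cmult) measurable
  finally have h_norm: "(\<integral>\<^sup>+x. ennreal (h x powr p) \<partial>lebesgue) \<le> ennreal (4 powr p * (2 ^ (?N + 1) / ?v)) * J"
    unfolding K_def .
  show ?thesis by (rule that[of h "{x. G x = \<infinity>}", OF h_meas h_nonneg Z osc h_norm])
qed

text \<open>Positivity allows dividing by the normalising constant, so that the seminorm controls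
  the Gagliardo integral. The argument of Gamma is positive since p s > 0 and p + N \<ge> 2.\<close>

lemma sobolev_const_pos:
  assumes "0 < s" "s < 1" "1 \<le> p" "1 \<le> N"
  shows "0 < sobolev_const N s p"
proof -
  have "0 < p * s" using assms by simp
  moreover have "1 \<le> real N" using assms by simp
  ultimately have "0 < p * s + p + real N - 2" using assms by linarith
  then have "0 < (p * s + p + real N - 2) / 2" by simp
  then show ?thesis
    unfolding sobolev_const_def using assms
    by (intro divide_pos_pos mult_pos_pos Gamma_real_pos) auto
qed

text \<open>Joins the two constructions of a gradient, with a constant chosen before
  \<open>u\<close>. The hypothesis \<open>s \<noteq> p\<close> provides p > 1 when s = 1, as the
  maximal function demands.\<close>

lemma sobolev_imp_hajlasz:
  fixes s p :: real
  assumes s: "0 < s" "s \<le> 1" and p: "1 \<le> p" "s * p < DIM('a::euclidean_space)" "s \<noteq> p"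
  obtains K where "0 < K"
    "\<And>(u :: 'a \<Rightarrow> real) W. u \<in> borel_measurable lebesgue \<Longrightarrow> sobolev_modular s p u < \<infinity> \<Longrightarrow> 0 < W \<Longrightarrow>
       ennreal K * sobolev_modular s p u \<le> ennreal (W powr p) \<Longrightarrow> \<exists>w Z. hajlasz s p W u w Z"
proof -
  define gradient where "gradient c u \<longleftrightarrow> (\<exists>h Z. h \<in> borel_measurable lebesgue \<and> (\<forall>x. 0 \<le> h x) \<and> negligible Z \<and>
        (\<forall>x y. x \<notin> Z \<longrightarrow> y \<notin> Z \<longrightarrow> \<bar>u x - u y\<bar> \<le> norm (x - y) powr s * (h x + h y)) \<and>
        (\<integral>\<^sup>+x. ennreal (h x powr p) \<partial>lebesgue) \<le> ennreal c * seminorm_modular s p u)" for c and u :: "'a \<Rightarrow> real"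
  have "\<exists>c\<ge>0. \<forall>u :: 'a \<Rightarrow> real. u \<in> borel_measurable lebesgue \<longrightarrow> sobolev_modular s p u < \<infinity> \<longrightarrow>
     gradient c u"
  proof (cases "s = 1")
    case True
    with p have p1: "1 < p" by simp
    define c where "c = (2 ^ (DIM('a) + 1) * unit_ball_vol DIM('a) / bump_mass TYPE('a)) powr p
        * (5 ^ DIM('a) * p * 2 powr p / (p - 1))"
    show ?thesis
    proof (intro exI[of _ c] conjI allI impI)
      show "0 \<le> c" using p1 by (simp add: c_def)
      fix u :: "'a \<Rightarrow> real" assume fin: "sobolev_modular s p u < \<infinity>"
      have ex: "\<exists>g. has_weak_gradient UNIV u g"
        using fin True by (auto simp: sobolev_modular_def seminorm_modular_def split: if_splits)
      \<comment> \<open>The seminorm is built from a choice; once some weak gradient exists, the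
        chosen function is one, and the estimates are applied to it directly.\<close>
      then have g: "has_weak_gradient UNIV u (weak_gradient UNIV u)"
        unfolding weak_gradient_def by (rule someI_ex)
      have sm: "seminorm_modular s p u = (\<integral>\<^sup>+x. ennreal (norm (weak_gradient UNIV u x) powr p) \<partial>lebesgue)"
        using ex True by (simp add: seminorm_modular_def)
      have "(\<integral>\<^sup>+x. ennreal (norm (weak_gradient UNIV u x) powr p) \<partial>lebesgue) < \<infinity>"
        using fin unfolding sobolev_modular_def sm by simp
      note wg = weak_gradient_hajlasz[OF g p1 this, folded c_def sm]
      obtain h Z where "h \<in> borel_measurable lebesgue" "\<And>x. 0 \<le> h x"
        "negligible Z" "\<And>x y. x \<notin> Z \<Longrightarrow> y \<notin> Z \<Longrightarrow> \<bar>u x - u y\<bar> \<le> norm (x - y) * (h x + h y)"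
        "(\<integral>\<^sup>+x. ennreal (h x powr p) \<partial>lebesgue) \<le> ennreal c * seminorm_modular s p u"
        by (rule wg) blast
      then show "gradient c u"
        unfolding gradient_def using True by (intro exI[of _ h] exI[of _ Z]) simp
    qed
  next
    case False
    with s have s1: "s < 1" by simp
    define b where "b = sobolev_const DIM('a) s p"
    have b: "0 < b" unfolding b_def by (rule sobolev_const_pos) (use s s1 p DIM_positive in \<open>auto simp: Suc_le_eq\<close>)
    define c where "c = 4 powr p * (2 ^ (DIM('a) + 1) / unit_ball_vol DIM('a))"
    have c: "0 \<le> c" by (simp add: c_def)
    show ?thesis
    proof (intro exI[of _ "c / b"] conjI allI impI)
      show "0 \<le> c / b" using b c by simp
      fix u :: "'a \<Rightarrow> real" assume um: "u \<in> borel_measurable lebesgue" and fin: "sobolev_modular s p u < \<infinity>"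
      define J where "J = (\<integral>\<^sup>+(x, y). ennreal (\<bar>u x - u y\<bar> powr p / norm (x - y) powr (real DIM('a) + s * p))
              \<partial>(lebesgue \<Otimes>\<^sub>M lebesgue))"
      have sm: "seminorm_modular s p u = ennreal b * J"
        using s s1 by (simp add: seminorm_modular_def b_def J_def)
      have "ennreal b * J < \<infinity>" using fin unfolding sobolev_modular_def sm by simp
      then have Jfin: "J < \<infinity>" using b by (auto simp: ennreal_mult_less_top)
      \<comment> \<open>The seminorm contains the normalising constant \<open>b\<close>, which the
        bound c / b cancels.\<close>
      have "ennreal (c / b) * (ennreal b * J) = ennreal c * J"
        using b c by (simp add: mult.assoc[symmetric] ennreal_mult[symmetric])
      then have cJ: "ennreal (c / b) * seminorm_modular s p u = ennreal c * J" by (simp only: sm)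
      note gag = gagliardo_hajlasz[OF s(1) p(1) um Jfin[unfolded J_def], folded J_def c_def]
      obtain h Z where "h \<in> borel_measurable lebesgue" "\<And>x. 0 \<le> h x"
        "negligible Z" "\<And>x y. x \<notin> Z \<Longrightarrow> y \<notin> Z \<Longrightarrow> \<bar>u x - u y\<bar> \<le> norm (x - y) powr s * (h x + h y)"
        "(\<integral>\<^sup>+x. ennreal (h x powr p) \<partial>lebesgue) \<le> ennreal c * J"
        by (rule gag) blast
      then show "gradient (c / b) u"
        unfolding gradient_def cJ by (intro exI[of _ h] exI[of _ Z]) simp
    qed
  qed
  then obtain c where c: "0 \<le> c" and ex: "\<And>u :: 'a \<Rightarrow> real. u \<in> borel_measurable lebesgue \<Longrightarrow> sobolev_modular s p u < \<infinity> \<Longrightarrow>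
     gradient c u"
    by blast
  show ?thesis
  proof (rule that[of "2 powr p * (c + 1)"])
    show "0 < 2 powr p * (c + 1)" using c by simp
    fix u :: "'a \<Rightarrow> real" and W :: real
    assume um: "u \<in> borel_measurable lebesgue" and fin: "sobolev_modular s p u < \<infinity>" and W: "0 < W"
      and le: "ennreal (2 powr p * (c + 1)) * sobolev_modular s p u \<le> ennreal (W powr p)"
    obtain h Z where h: "h \<in> borel_measurable lebesgue" "\<And>x. 0 \<le> h x" "negligible Z"
        "\<And>x y. x \<notin> Z \<Longrightarrow> y \<notin> Z \<Longrightarrow> \<bar>u x - u y\<bar> \<le> norm (x - y) powr s * (h x + h y)"
        "(\<integral>\<^sup>+x. ennreal (h x powr p) \<partial>lebesgue) \<le> ennreal c * seminorm_modular s p u"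
      using ex[OF um fin] unfolding gradient_def by blast
    show "\<exists>w Z. hajlasz s p W u w Z"
      using hajlaszI[OF s(1) p(1,2) W um h(1-4) c h(5) le[unfolded sobolev_modular_def]] by blast
  qed
qed

theorem sobolev_embedding_UNIV:
  fixes s p t q :: real
  assumes s: "0 \<le> s" "s \<le> 1" and p: "1 \<le> p" "s * p < DIM('a::euclidean_space)" "s \<noteq> p"
    and t: "0 \<le> t" "t \<le> s" and q: "p \<le> q" "q \<le> DIM('a) * p / (DIM('a) - (s - t) * p)"
  shows "sobolev_embedded (UNIV :: 'a set) (s, p) (t, q)"
proof (cases "t = s")
  \<comment> \<open>For t = s the upper limit of \<open>q\<close> is \<open>p\<close>, so only the
    identity embedding remains.\<close>
  case True
  then have "q = p" using q by simp
  then show ?thesis using True p by (simp add: sobolev_embedded_refl)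
next
  case False
  then have ts: "t < s" using t by simp
  then have s0: "0 < s" using t by simp
  obtain K where K: "0 < K"
    "\<And>(u :: 'a \<Rightarrow> real) W. u \<in> borel_measurable lebesgue \<Longrightarrow> sobolev_modular s p u < \<infinity> \<Longrightarrow> 0 < W \<Longrightarrow>
       ennreal K * sobolev_modular s p u \<le> ennreal (W powr p) \<Longrightarrow> \<exists>w Z. hajlasz s p W u w Z"
    using sobolev_imp_hajlasz[OF s0 s(2) p] by blast
  obtain C where C: "0 < C"
    "\<And>u w Z W. hajlasz s p W (u :: 'a \<Rightarrow> real) w Z \<Longrightarrow>
       (\<integral>\<^sup>+x. ennreal (\<bar>u x\<bar> powr q) \<partial>lebesgue) \<le> ennreal (C * W powr q)"
    "\<And>u w Z W. hajlasz s p W (u :: 'a \<Rightarrow> real) w Z \<Longrightarrow> t \<noteq> 0 \<Longrightarrow>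
       (\<integral>\<^sup>+(x, y). ennreal (\<bar>u x - u y\<bar> powr q / norm (x - y) powr (real DIM('a) + t * q))
              \<partial>(lebesgue \<Otimes>\<^sub>M lebesgue)) \<le> ennreal (C * W powr q)"
    using hajlasz_uniform_bounds[OF s0 p(1,2) t(1) ts q] by blast
  define b where "b = \<bar>sobolev_const DIM('a) t q\<bar>"
  define C' where "C' = (b + 1) * C"
  have C': "0 < C'" using C(1) by (simp add: C'_def b_def)
  have bound: "sobolev_modular t q u \<le> ennreal (C' * W powr q)" if h: "hajlasz s p W u w Z" for u :: "'a \<Rightarrow> real" and W w Z
  proof -
    have "seminorm_modular t q u \<le> ennreal b * ennreal (C * W powr q)"
    proof (cases "t = 0")
      \<comment> \<open>Here 0 < t < s \<le> 1, so the target seminorm is the Gagliardo one.\<close>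
      case False
      then have "seminorm_modular t q u = ennreal (sobolev_const DIM('a) t q) *
        (\<integral>\<^sup>+(x, y). ennreal (\<bar>u x - u y\<bar> powr q / norm (x - y) powr (real DIM('a) + t * q))
              \<partial>(lebesgue \<Otimes>\<^sub>M lebesgue))"
        using ts s by (simp add: seminorm_modular_def)
      also have "\<dots> \<le> ennreal b * ennreal (C * W powr q)"
        using C(3)[OF h False] by (intro mult_mono) (auto simp: b_def intro!: ennreal_leI)
      finally show ?thesis .
    qed (simp add: seminorm_modular_def)
    then have "sobolev_modular t q u \<le> ennreal b * ennreal (C * W powr q) + ennreal (C * W powr q)"
      unfolding sobolev_modular_def using C(2)[OF h] by (rule add_mono)
    also have "\<dots> = ennreal (b * (C * W powr q) + C * W powr q)"
      using C(1) by (simp add: ennreal_mult b_def)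
    also have "b * (C * W powr q) + C * W powr q = C' * W powr q"
      by (simp add: C'_def algebra_simps)
    finally show ?thesis .
  qed
  show ?thesis
  proof (rule sobolev_embeddedI[where C="C' * K powr (q / p)"])
    show "0 < p" "0 < q" using p q by auto
    show "0 < C' * K powr (q / p)" using C' K(1) by simp
    fix u :: "'a \<Rightarrow> real" and \<alpha> :: real
    assume um: "u \<in> borel_measurable lebesgue" and \<alpha>: "sobolev_modular s p u = ennreal \<alpha>" "0 \<le> \<alpha>"
    \<comment> \<open>Every \<open>W\<close> with K \<alpha> \<le> W^p is admissible, and
      \<open>le_powr_of_scale\<close> passes to the smallest one, or to the limit 0 if \<alpha> =
      0.\<close>
    have "sobolev_modular t q u \<le> ennreal (C' * (K * \<alpha>) powr (q / p))"
    proof (rule le_powr_of_scale)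
      fix W :: real assume W: "0 < W" "K * \<alpha> \<le> W powr p"
      have "ennreal K * sobolev_modular s p u \<le> ennreal (W powr p)"
        using W(2) K(1) \<alpha> by (simp add: ennreal_mult[symmetric] ennreal_leI)
      then obtain w Z where "hajlasz s p W u w Z"
        using K(2)[OF um _ W(1)] \<alpha> by auto
      then show "sobolev_modular t q u \<le> ennreal (C' * W powr q)" by (rule bound)
    qed (use p q K(1) \<alpha> C' in auto)
    then show "sobolev_modular t q u \<le> ennreal (C' * K powr (q / p) * \<alpha> powr (q / p))"
      by (simp add: powr_mult mult.assoc)
  qed
qed

theorem theorem1p1:
  fixes s p t q :: real
  assumes "0 \<le> s" and "s \<le> 1" and "1 \<le> p"
    and "s * p < real CARD('n::finite)" and "s \<noteq> p"
    and "0 \<le> t" and "t \<le> s"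
    and "p \<le> q" and "q \<le> real CARD('n) * p / (real CARD('n) - (s - t) * p)"
  shows "(\<exists>C::real. 0 < C \<and>
            (\<forall>u\<in>sobolev_space (UNIV :: (real ^ 'n) set) s p.
               sobolev_norm UNIV t q u \<le> ennreal C * sobolev_norm UNIV s p u)) \<and>
         sobolev_embedded (UNIV :: (real ^ 'n) set) (s, p) (t, q) \<and>
         (\<forall>\<theta>\<^sub>1 \<theta>\<^sub>2. 0 \<le> \<theta>\<^sub>1 \<and> \<theta>\<^sub>1 \<le> \<theta>\<^sub>2 \<and> \<theta>\<^sub>2 \<le> 1 \<longrightarrow>
            sobolev_embedded (UNIV :: (real ^ 'n) set)
              (sobolev_curve s p t q \<theta>\<^sub>1) (sobolev_curve s p t q \<theta>\<^sub>2))"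
proof (intro conjI allI impI)
  let ?N = "real CARD('n)"
  show emb: "sobolev_embedded (UNIV :: (real ^ 'n) set) (s, p) (t, q)"
    by (rule sobolev_embedding_UNIV) (use assms in simp_all)
  then show "\<exists>C::real. 0 < C \<and> (\<forall>u\<in>sobolev_space (UNIV :: (real ^ 'n) set) s p.
               sobolev_norm UNIV t q u \<le> ennreal C * sobolev_norm UNIV s p u)"
    by (simp add: sobolev_embedded_def)
  fix \<theta>\<^sub>1 \<theta>\<^sub>2 :: real assume \<theta>: "0 \<le> \<theta>\<^sub>1 \<and> \<theta>\<^sub>1 \<le> \<theta>\<^sub>2 \<and> \<theta>\<^sub>2 \<le> 1"
  define S where "S \<theta> = \<theta> * t + (1 - \<theta>) * s" for \<theta>
  define P where "P \<theta> = p * q / (q + \<theta> * (p - q))" for \<theta>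
  have p: "0 < p" and q: "0 < q" using assms by auto
  have den: "p \<le> q + \<theta> * (p - q)" "q + \<theta> * (p - q) \<le> q" if "0 \<le> \<theta>" "\<theta> \<le> 1" for \<theta>
  proof -
    have "0 \<le> (1 - \<theta>) * (q - p)" "0 \<le> \<theta> * (q - p)" using that assms by auto
    then show "p \<le> q + \<theta> * (p - q)" "q + \<theta> * (p - q) \<le> q" by (auto simp: algebra_simps)
  qed
  have invP: "1 / P \<theta> = 1 / p + \<theta> * (1 / q - 1 / p)" for \<theta>
    using p q by (simp add: P_def field_simps)
  have P_ge: "p \<le> P \<theta>" if "0 \<le> \<theta>" "\<theta> \<le> 1" for \<theta>
    using den[OF that] p q unfolding P_def by (simp add: pos_le_divide_eq)
  \<comment> \<open>The upper limit of \<open>q\<close> in reciprocal form: linear in s, t, 1 / p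
    and 1 / q, so along the curve both sides scale with the difference of the parameters.\<close>
  have key: "1 / p - 1 / q \<le> (s - t) / ?N"
  proof -
    have "(s - t) * p \<le> s * p" using assms by (intro mult_right_mono) auto
    then have pos: "0 < ?N - (s - t) * p" using assms by linarith
    then have "q * (?N - (s - t) * p) \<le> ?N * p" using assms by (simp add: pos_le_divide_eq)
    then have "?N * (q - p) \<le> (s - t) * (p * q)" by (simp add: algebra_simps)
    then show ?thesis using p q by (simp add: field_simps)
  qed
  have dinv: "1 / P \<theta>\<^sub>1 - 1 / P \<theta>\<^sub>2 = (\<theta>\<^sub>2 - \<theta>\<^sub>1) * (1 / p - 1 / q)"
  proof -
    have "(a + x * (b - a)) - (a + y * (b - a)) = (y - x) * (a - b)" for a b x y :: real
      by (simp add: algebra_simps)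
    then show ?thesis by (simp only: invP)
  qed
  have diff: "1 / P \<theta>\<^sub>1 - 1 / P \<theta>\<^sub>2 \<le> (S \<theta>\<^sub>1 - S \<theta>\<^sub>2) / ?N"
  proof -
    have "(\<theta>\<^sub>2 - \<theta>\<^sub>1) * (1 / p - 1 / q) \<le> (\<theta>\<^sub>2 - \<theta>\<^sub>1) * ((s - t) / ?N)" using \<theta> by (intro mult_left_mono key) auto
    also have "\<dots> = (S \<theta>\<^sub>1 - S \<theta>\<^sub>2) / ?N" by (simp add: S_def field_simps)
    finally show ?thesis unfolding dinv .
  qed
  \<comment> \<open>In reciprocal form the condition S P < N holds at \<theta> = 0, and by
    \<open>key\<close> the quantity S / N decreases along the curve at least as fast as 1 /
    P.\<close>
  have sub: "S \<theta> / ?N < 1 / P \<theta>" if "0 \<le> \<theta>" "\<theta> \<le> 1" for \<theta>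
  proof -
    have "s / ?N < 1 / p" using assms p by (simp add: field_simps)
    moreover have "S \<theta> / ?N = s / ?N - \<theta> * ((s - t) / ?N)" by (simp add: S_def field_simps)
    moreover have "\<theta> * (1 / p - 1 / q) \<le> \<theta> * ((s - t) / ?N)" using that by (intro mult_left_mono key)
    moreover have "1 / P \<theta> = 1 / p - \<theta> * (1 / p - 1 / q)" by (simp add: invP algebra_simps)
    ultimately show ?thesis by linarith
  qed
  have P1: "0 < P \<theta>\<^sub>1" "p \<le> P \<theta>\<^sub>1" and P2: "0 < P \<theta>\<^sub>2" using P_ge[of \<theta>\<^sub>1] P_ge[of \<theta>\<^sub>2] p \<theta> by auto
  have S_le: "S \<theta> \<le> s" "t \<le> S \<theta>" if "0 \<le> \<theta>" "\<theta> \<le> 1" for \<theta>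
  proof -
    have "0 \<le> \<theta> * (s - t)" "0 \<le> (1 - \<theta>) * (s - t)" using that assms by auto
    then show "S \<theta> \<le> s" "t \<le> S \<theta>" by (auto simp: S_def algebra_simps)
  qed
  have "sobolev_embedded (UNIV :: (real ^ 'n) set) (S \<theta>\<^sub>1, P \<theta>\<^sub>1) (S \<theta>\<^sub>2, P \<theta>\<^sub>2)"
  proof (rule sobolev_embedding_UNIV)
    show "0 \<le> S \<theta>\<^sub>1" "S \<theta>\<^sub>1 \<le> 1" "0 \<le> S \<theta>\<^sub>2" using S_le[of \<theta>\<^sub>1] S_le[of \<theta>\<^sub>2] \<theta> assms by auto
    show "1 \<le> P \<theta>\<^sub>1" using P1 assms by simp
    show "S \<theta>\<^sub>1 * P \<theta>\<^sub>1 < DIM(real ^ 'n)" using sub[of \<theta>\<^sub>1] \<theta> P1 by (simp add: field_simps)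
    \<comment> \<open>Equality would give p \<le> P = S \<le> s, which together with s \<le> 1 \<le>
      p contradicts \<open>s \<noteq> p\<close>.\<close>
    show "S \<theta>\<^sub>1 \<noteq> P \<theta>\<^sub>1"
    proof
      assume "S \<theta>\<^sub>1 = P \<theta>\<^sub>1"
      then have "p \<le> s" using S_le[of \<theta>\<^sub>1] \<theta> P1 by simp
      then show False using assms by simp
    qed
    have "(\<theta>\<^sub>2 - \<theta>\<^sub>1) * (s - t) \<ge> 0" using \<theta> assms by auto
    then show "S \<theta>\<^sub>2 \<le> S \<theta>\<^sub>1" by (simp add: S_def algebra_simps)
    have "1 / q \<le> 1 / p" using assms p by (intro divide_left_mono mult_pos_pos) auto
    then have "(\<theta>\<^sub>2 - \<theta>\<^sub>1) * (1 / p - 1 / q) \<ge> 0" using \<theta> by (intro mult_nonneg_nonneg) auto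
    then have "1 / P \<theta>\<^sub>2 \<le> 1 / P \<theta>\<^sub>1" using dinv by linarith
    then show "P \<theta>\<^sub>1 \<le> P \<theta>\<^sub>2" using P1 P2 by (simp add: field_simps)
    \<comment> \<open>The denominator of the critical exponent is positive because
      \<open>S \<theta>\<^sub>2\<close> is nonnegative and
      \<open>S \<theta>\<^sub>1 * P \<theta>\<^sub>1\<close> is below the dimension.\<close>
    have "0 \<le> S \<theta>\<^sub>2 / ?N" using S_le[of \<theta>\<^sub>2] \<theta> assms by simp
    then have "(S \<theta>\<^sub>1 - S \<theta>\<^sub>2) / ?N < 1 / P \<theta>\<^sub>1" using sub[of \<theta>\<^sub>1] \<theta> by (simp add: diff_divide_distrib)
    then have pos: "0 < ?N - (S \<theta>\<^sub>1 - S \<theta>\<^sub>2) * P \<theta>\<^sub>1" using P1 by (simp add: field_simps)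
    have "P \<theta>\<^sub>2 * (?N - (S \<theta>\<^sub>1 - S \<theta>\<^sub>2) * P \<theta>\<^sub>1) \<le> ?N * P \<theta>\<^sub>1"
      using diff P1 P2 by (simp add: field_simps)
    then show "P \<theta>\<^sub>2 \<le> DIM(real ^ 'n) * P \<theta>\<^sub>1 / (DIM(real ^ 'n) - (S \<theta>\<^sub>1 - S \<theta>\<^sub>2) * P \<theta>\<^sub>1)"
      using pos by (simp add: pos_le_divide_eq)
  qed
  then show "sobolev_embedded (UNIV :: (real ^ 'n) set)
              (sobolev_curve s p t q \<theta>\<^sub>1) (sobolev_curve s p t q \<theta>\<^sub>2)"
    by (simp add: sobolev_curve_def S_def P_def)
qed

end
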